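(* Let $d\in\mathbb N$, let $U_1,\ldots,U_{d+2}$ be random points sampled uniformly and independently on the half-sphere $\mathbb S^d_+$, and let $P(d)$ be the probability that their spherical convex hull $C_{d+2}\cap\mathbb S^d_+$ is a spherical simplex with $d+1$ vertices. Then $$ P(d)=\pi^{-(d+1)}\,(d+2)\,\frac{\sqrt\pi\,\Gamma\left(\frac{d+2}{2}\right)}{\Gamma\left(\frac{d+3}{2}\right)}\cdot(d+1)^2A[d,-1]. $$
   Context: $\mathbb S^d_+=\{x=(x_0,\ldots,x_d)\in\mathbb R^{d+1}:x_0\ge0,\ \|x\|=1\}$, and $C_{d+2}=\operatorname{pos}(U_1,\ldots,U_{d+2})=\{\sum_{i=1}^{d+2}\lambda_iU_i:\lambda_1,\ldots,\lambda_{d+2}\ge0\}$. Vertices of $C_{d+2}\cap\mathbb S^d_+$ correspond to the one-dimensional faces (extreme rays) of the cone $C_{d+2}$. Definition of $A[n,k]$ for $n\in\mathbb N_0=\{0,1,2,\ldots\}$, $k\in\mathbb Z$: put $Q_0(x)=Q_1(x)=1$ and $Q_n(x)=\prod_{j\in\{1,\ldots,n-1\},\ j\not\equiv n\ (\mathrm{mod}\ 2)}(1+j^2x^2)$ for $n\ge2$. Then $A[n,k]=[x^k]Q_n(x)$ if $k$ is even; $A[n,k]=[x^k]\left(\tanh(\frac{\pi}{2x})Q_n(x)\right)$ if $k$ is odd and $n$ is even; $A[n,k]=[x^k]\left(\coth(\frac{\pi}{2x})Q_n(x)\right)$ if $k$ is odd and $n$ is odd. Here $[x^k]H(x)$ is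 the coefficient of $x^k$ in $H(x)$, a formal series in positive and negative powers of $x$; $\tanh(\pi/(2x))$ and $\coth(\pi/(2x))$ are expanded in powers of $1/x$ via the Laurent expansions of $\tanh y$ and $\coth y$ at $y=0$ with $y=\pi/(2x)$. *)

theory Defs
  imports "HOL-Probability.Probability" "HOL-Complex_Analysis.Complex_Analysis"
begin

definition half_sphere :: "'n \<Rightarrow> (real ^ 'n) set" where
  "half_sphere i0 = {x. x $ i0 \<ge> 0 \<and> norm x = 1}"

(* Polar-coordinate form of the surface measure of the unit sphere in dimension m:
   sigma(A) = m * vol {x : 0 < |x| <= 1, x/|x| in A}.  Here sgn x = x/|x|; the value sgn 0 = 0
   only affects a null set. *)
definition sphere_measure :: "'a::euclidean_space measure" where
  "sphere_measure =
     scale_measure (of_nat DIM('a)) (distr (restrict_space lborel (cball 0 1)) borel sgn)"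

definition uniform_half_sphere :: "'n::finite \<Rightarrow> (real ^ 'n) measure" where
  "uniform_half_sphere i0 = uniform_measure sphere_measure (half_sphere i0)"

definition pos :: "'i set \<Rightarrow> ('i \<Rightarrow> 'a::real_vector) \<Rightarrow> 'a set" where
  "pos I u = {\<Sum>i\<in>I. c i *\<^sub>R u i | c. \<forall>i\<in>I. c i \<ge> (0::real)}"

definition spherical_simplex :: "'a::euclidean_space set \<Rightarrow> bool" where
  "spherical_simplex T \<longleftrightarrow> (\<exists>V. independent V \<and> T = pos V (\<lambda>v. v) \<inter> sphere 0 1)"

(* The vertices of the spherical polytope cut out by the cone C: the unit vectors spanning
   the one-dimensional faces (extreme rays) of C. *)
definition spherical_vertices :: "'a::euclidean_space set \<Rightarrow> 'a set" where
  "spherical_vertices C = {v. norm v = 1 \<and> pos {v} (\<lambda>v. v) face_of C}"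

(* Over an arbitrary ring, so that it can be evaluated at a formal Laurent series. *)
definition Q :: "nat \<Rightarrow> 'a::comm_ring_1 \<Rightarrow> 'a" where
  "Q n x = (\<Prod>j | j \<in> {1..n-1} \<and> j mod 2 \<noteq> n mod 2. 1 + of_nat j ^ 2 * x ^ 2)"

(* The series whose coefficients are the A[n,k], as a formal Laurent series in z = 1/x.
   Thus x is fls_X_inv, tanh(pi/(2x)) becomes the Laurent expansion of tanh(pi*z/2) at z = 0,
   and the coefficient of x^k is the coefficient of z^(-k). *)
definition A_series :: "nat \<Rightarrow> int \<Rightarrow> complex fls" where
  "A_series n k =
     (if even k then Q n fls_X_inv
      else if even n then laurent_expansion (\<lambda>z. tanh (of_real pi * z / 2)) 0 * Q n fls_X_inv
      else laurent_expansion (\<lambda>z. cosh (of_real pi * z / 2) / sinh (of_real pi * z / 2)) 0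
             * Q n fls_X_inv)"

(* Laurent expansions are only available over the complex numbers; the coefficients are real. *)
definition A :: "nat \<Rightarrow> int \<Rightarrow> real" where
  "A n k = Re (fls_nth (A_series n k) (- k))"

end

theory Submission
  imports Defs "HOL-Real_Asymp.Real_Asymp"
begin

text \<open>The event says that one of the \<open>n = d + 2\<close> points lies in the cone of the other \<open>m = d + 1\<close> points,
  and these \<open>n\<close> events are equally likely and almost surely disjoint. Only directions matter, so the
  points may be replaced by Gaussian vectors in the half-space. Writing one point as \<open>\<Sum> c\<^sub>k Z\<^sub>k\<close> in terms of
  the others turns its law into \<open>\<bar>det Z\<bar> dc\<close>; integrating the rows of \<open>Z\<close> other than the one carrying
  the half-space constraint leaves a universal constant times an integral over \<open>c > 0\<close> and \<open>r > 0\<close> (the constrained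
  row) that depends only on \<open>\<bar>c\<bar>\<close> and on \<open>\<bar>r\<bar>\<^sup>2 + (r \<bullet> c)\<^sup>2\<close>. The constant is read off from the unconstrained
  case, where the total mass is known. By homogeneity the remaining integral can be rewritten as the
  integral of \<open>exp (- (\<bar>c\<bar>\<^sup>2 + \<bar>r\<bar>\<^sup>2) / 2 - (r \<bullet> c) cosh y)\<close> over \<open>c, r, y > 0\<close>; the coordinates separate,
  each contributing \<open>y / sinh y\<close>, which gives \<open>\<integral> (y / sinh y)\<^sup>m dy\<close>.
  Expanding in powers of \<open>exp (- y)\<close>, these integrals satisfy the same recursion in \<open>m\<close>, in steps of 2, as the
  coefficients \<open>A[m - 1, k]\<close>; for \<open>m = 1, 2\<close> they are the Taylor coefficients of \<open>tanh\<close> and \<open>coth\<close> by the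
  reflection formula of the digamma function.\<close>

text \<open>The rows of \<open>Z\<close> are points, while the half-space constraint restricts one
  coordinate of every point, that is one column. In the transposed matrix this is a single row
  \<open>i0\<close>, and for fixed \<open>c\<close> the weight factorises over rows, each row
  \<open>r\<close> carrying \<open>exp (- (|r|^2 + (r \<bullet> c)^2) / 2)\<close>. The obstacle is
  the Jacobian \<open>\<bar>det Z\<bar>\<close>, which still couples the rows. A linear map
  depending on \<open>c\<close> makes the quadratic form standard; the determinant is linear in row
  \<open>i0\<close>, so rotation invariance of the other rows makes its absolute value integrate to
  a constant times the length of row \<open>i0\<close>. The constraints on \<open>c\<close> and on
  row \<open>i0\<close> do not enter this constant, which is why the unconstrained problem can
  determine it. Three scaling arguments, all based on integration over an additional positive factor
  \<open>exp t\<close>, replace polar coordinates: they identify the uniform law with Gaussian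
  directions, remove the length of row \<open>i0\<close>, and absorb the power of
  \<open>1 + |c|^2\<close>. Integrals are taken in \<open>ennreal\<close>, so exchanging them
  requires measurability only; constants stay multiplied on both sides until they can be cancelled
  as finite nonzero numbers.\<close>

no_notation fps_nth (infixl \<open>$\<close> 75)

section \<open>Lebesgue measure on vectors and matrices\<close>

lemma borel_measurable_vec_nth [measurable (raw)]:
  fixes f :: "'b \<Rightarrow> 'a::euclidean_space ^ 'n"
  assumes "f \<in> borel_measurable M"
  shows "(\<lambda>x. f x $ i) \<in> borel_measurable M"
proof -
  have "(\<lambda>v::'a^'n. v $ i) \<in> borel_measurable borel"
    by (intro borel_measurable_continuous_onI continuous_intros)
  from measurable_compose[OF assms this] show ?thesis .
qed

lemma borel_measurable_vec_lambda [measurable (raw)]: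
  fixes f :: "'n::finite \<Rightarrow> 'b \<Rightarrow> 'a::euclidean_space"
  assumes "\<And>i. f i \<in> borel_measurable M"
  shows "(\<lambda>x. \<chi> i. f i x) \<in> borel_measurable M"
proof (subst borel_measurable_euclidean_space, intro ballI)
  fix b :: "'a^'n" assume "b \<in> Basis"
  then obtain i u where b: "b = axis i u" by (auto simp: Basis_vec_def)
  note assms[measurable]
  show "(\<lambda>x. (\<chi> i. f i x) \<bullet> b) \<in> borel_measurable M"
    unfolding b by (simp add: inner_axis)
qed

lemma borel_measurable_det [measurable (raw)]:
  fixes f :: "'b \<Rightarrow> real ^ 'n ^ 'n"
  assumes [measurable]: "f \<in> borel_measurable M"
  shows "(\<lambda>x. det (f x)) \<in> borel_measurable M"
  unfolding det_def by measurable

lemma borel_measurable_matrix_vector_mult [measurable (raw)]: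
  fixes f :: "'b \<Rightarrow> real ^ 'n ^ 'm" and g :: "'b \<Rightarrow> real ^ 'n"
  assumes [measurable]: "f \<in> borel_measurable M" "g \<in> borel_measurable M"
  shows "(\<lambda>x. f x *v g x) \<in> borel_measurable M"
  unfolding matrix_vector_mult_def by measurable

lemma borel_measurable_vector_matrix_mult [measurable (raw)]:
  fixes f :: "'b \<Rightarrow> real ^ 'n ^ 'm" and g :: "'b \<Rightarrow> real ^ 'm"
  assumes [measurable]: "f \<in> borel_measurable M" "g \<in> borel_measurable M"
  shows "(\<lambda>x. g x v* f x) \<in> borel_measurable M"
  unfolding vector_matrix_mult_def by measurable

section \<open>Lebesgue measure as a product over components\<close>

lemma product_sigma_finite_lborel: "product_sigma_finite (\<lambda>_. lborel :: 'a::euclidean_space measure)"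
  by (simp add: product_sigma_finite_def sigma_finite_lborel)

lemma prod_Basis_vec:
  fixes f :: "'a::euclidean_space ^ 'n \<Rightarrow> 'b::comm_monoid_mult"
  shows "(\<Prod>b\<in>Basis. f b) = (\<Prod>i\<in>UNIV. \<Prod>b\<in>Basis. f (axis i b))"
proof -
  have "(\<Prod>b\<in>Basis. f b) = (\<Prod>i\<in>UNIV. \<Prod>b\<in>axis i ` Basis. f b)"
    unfolding Basis_vec_def
    by (subst prod.UNION_disjoint[symmetric]) (auto simp: axis_eq_axis intro!: prod.cong)
  also have "\<dots> = (\<Prod>i\<in>UNIV. \<Prod>b\<in>Basis. f (axis i b))"
    by (intro prod.cong refl, subst prod.reindex) (auto simp: inj_on_def axis_eq_axis)
  finally show ?thesis .
qed

lemma mem_box_vec: "x \<in> box l u \<longleftrightarrow> (\<forall>i. x $ i \<in> box (l $ i) (u $ i))"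
  for x :: "'a::euclidean_space ^ 'n"
  by (auto simp: mem_box Basis_vec_def inner_axis)

text \<open>The component type is an arbitrary Euclidean space, so the same statement covers vectors
  split into coordinates and matrices split into rows. Boxes of the vector space are products of
  boxes of the components, and boxes determine Lebesgue measure.\<close>

lemma lborel_vec_eq_distr_PiM:
  "(lborel :: ('a::euclidean_space ^ 'n) measure) = distr (PiM UNIV (\<lambda>_. lborel)) borel vec_lambda"
proof (rule lborel_eqI)
  interpret product_sigma_finite "\<lambda>_::'n. lborel :: 'a measure"
    by (rule product_sigma_finite_lborel)
  have [measurable]: "vec_lambda \<in> PiM UNIV (\<lambda>_::'n. lborel :: 'a measure) \<rightarrow>\<^sub>M borel"
    using borel_measurable_vec_lambda[of "\<lambda>i x. x i" "PiM UNIV (\<lambda>_::'n. lborel :: 'a measure)"]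
    by measurable
  fix l u :: "'a ^ 'n" assume le: "\<And>b. b \<in> Basis \<Longrightarrow> l \<bullet> b \<le> u \<bullet> b"
  have le': "l $ i \<bullet> b \<le> u $ i \<bullet> b" if "b \<in> Basis" for i b
    using le[of "axis i b"] that by (auto simp: inner_axis Basis_vec_def)
  have "vec_lambda -` box l u \<inter> space (PiM UNIV (\<lambda>_::'n. lborel :: 'a measure)) = (\<Pi>\<^sub>E i\<in>UNIV. box (l $ i) (u $ i))"
    by (auto simp: mem_box Basis_vec_def inner_axis space_PiM PiE_iff)
  then have "emeasure (distr (PiM UNIV (\<lambda>_::'n. lborel :: 'a measure)) borel vec_lambda) (box l u) =
      (\<Prod>i\<in>UNIV. emeasure lborel (box (l $ i) (u $ i)))"
    by (subst emeasure_distr) (auto simp: emeasure_PiM)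
  also have "\<dots> = (\<Prod>i\<in>(UNIV::'n set). ennreal (\<Prod>b\<in>Basis. (u $ i - l $ i) \<bullet> b))"
    using le' by (intro prod.cong refl emeasure_lborel_box) auto
  also have "\<dots> = ennreal (\<Prod>i\<in>UNIV. \<Prod>b\<in>Basis. (u $ i - l $ i) \<bullet> b)"
    by (rule prod_ennreal) (auto intro!: prod_nonneg simp: inner_diff_left le')
  also have "(\<Prod>i\<in>UNIV. \<Prod>b\<in>Basis. (u $ i - l $ i) \<bullet> b) = prod ((\<bullet>) (u - l)) Basis"
    by (simp add: prod_Basis_vec inner_axis)
  finally show "emeasure (distr (PiM UNIV (\<lambda>_::'n. lborel :: 'a measure)) borel vec_lambda) (box l u) =
    ennreal (prod ((\<bullet>) (u - l)) Basis)" .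
qed simp

lemma measurable_vec_lambda_PiM [measurable]:
  "vec_lambda \<in> PiM UNIV (\<lambda>_::'n::finite. lborel :: 'a::euclidean_space measure) \<rightarrow>\<^sub>M borel"
  using borel_measurable_vec_lambda[of "\<lambda>i x. x i" "PiM UNIV (\<lambda>_::'n. lborel :: 'a measure)"]
  by measurable

lemma nn_integral_lborel_vec:
  fixes f :: "'a::euclidean_space ^ 'n \<Rightarrow> ennreal"
  assumes [measurable]: "f \<in> borel_measurable borel"
  shows "(\<integral>\<^sup>+x. f x \<partial>lborel) = (\<integral>\<^sup>+x. f (vec_lambda x) \<partial>PiM UNIV (\<lambda>_. lborel))"
  by (subst lborel_vec_eq_distr_PiM, subst nn_integral_distr) auto

lemma nn_integral_lborel_vec_prod:
  fixes f :: "'n::finite \<Rightarrow> 'a::euclidean_space \<Rightarrow> ennreal"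
  assumes [measurable]: "\<And>i. f i \<in> borel_measurable borel"
  shows "(\<integral>\<^sup>+x. (\<Prod>i\<in>UNIV. f i (x $ i)) \<partial>lborel) = (\<Prod>i\<in>UNIV. \<integral>\<^sup>+x. f i x \<partial>lborel)"
proof -
  interpret product_sigma_finite "\<lambda>_::'n. lborel :: 'a measure"
    by (rule product_sigma_finite_lborel)
  show ?thesis
    by (subst nn_integral_lborel_vec) (auto intro!: product_nn_integral_prod)
qed

text \<open>One component is singled out, in both orders of integration. With component
  \<open>k\<close> innermost, a shear that adds a multiple of another component is a plain
  translation; with it outermost, a matrix integral is conditioned on one row.\<close>

lemma nn_integral_lborel_vec_split:
  fixes f :: "'a::euclidean_space ^ 'n \<Rightarrow> ennreal" and k :: 'n
  assumes [measurable]: "f \<in> borel_measurable borel"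
  shows "(\<integral>\<^sup>+x. f x \<partial>lborel) =
    (\<integral>\<^sup>+S. \<integral>\<^sup>+s. f (\<chi> i. if i = k then s else S i) \<partial>lborel \<partial>PiM (UNIV - {k}) (\<lambda>_. lborel))"
    and "(\<integral>\<^sup>+x. f x \<partial>lborel) =
    (\<integral>\<^sup>+s. \<integral>\<^sup>+S. f (\<chi> i. if i = k then s else S i) \<partial>PiM (UNIV - {k}) (\<lambda>_. lborel) \<partial>lborel)"
proof -
  interpret product_sigma_finite "\<lambda>_::'n. lborel :: 'a measure"
    by (rule product_sigma_finite_lborel)
  have ins: "UNIV = insert k (UNIV - {k})" by auto
  have *: "vec_lambda (S(k := s)) = (\<chi> i. if i = k then s else S i)" for S s
    by (simp add: vec_eq_iff)
  have [measurable]: "(\<lambda>x. f (vec_lambda x)) \<in> borel_measurable (PiM (insert k (UNIV - {k})) (\<lambda>_. lborel))"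
    unfolding ins[symmetric] by measurable
  show "(\<integral>\<^sup>+x. f x \<partial>lborel) =
    (\<integral>\<^sup>+S. \<integral>\<^sup>+s. f (\<chi> i. if i = k then s else S i) \<partial>lborel \<partial>PiM (UNIV - {k}) (\<lambda>_. lborel))"
    unfolding *[symmetric]
    by (subst nn_integral_lborel_vec[OF assms], subst ins, rule product_nn_integral_insert) auto
  show "(\<integral>\<^sup>+x. f x \<partial>lborel) =
    (\<integral>\<^sup>+s. \<integral>\<^sup>+S. f (\<chi> i. if i = k then s else S i) \<partial>PiM (UNIV - {k}) (\<lambda>_. lborel) \<partial>lborel)"
    unfolding *[symmetric]
    by (subst nn_integral_lborel_vec[OF assms], subst ins, rule product_nn_integral_insert_rev) auto
qed

section \<open>Linear changes of variables\<close>

lemma nn_integral_scaleR: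
  fixes f :: "'a::euclidean_space \<Rightarrow> ennreal"
  assumes [measurable]: "f \<in> borel_measurable borel" and c: "c \<noteq> 0"
  shows "(\<integral>\<^sup>+x. f x \<partial>lborel) = ennreal (\<bar>c\<bar> ^ DIM('a)) * (\<integral>\<^sup>+x. f (c *\<^sub>R x) \<partial>lborel)"
  by (subst lborel_affine[OF c, of 0])
     (simp add: nn_integral_density nn_integral_distr nn_integral_cmult)

lemma nn_integral_translate:
  fixes f :: "'a::euclidean_space \<Rightarrow> ennreal"
  assumes [measurable]: "f \<in> borel_measurable borel"
  shows "(\<integral>\<^sup>+x. f (x + t) \<partial>lborel) = (\<integral>\<^sup>+x. f x \<partial>lborel)"
  by (subst (2) lborel_affine[of 1 t])
     (simp_all add: nn_integral_density nn_integral_distr nn_integral_cmult add.commute)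

lemma nn_integral_lborel_permute:
  fixes f :: "'a::euclidean_space ^ 'n \<Rightarrow> ennreal" and p :: "'n \<Rightarrow> 'n"
  assumes [measurable]: "f \<in> borel_measurable borel" and p: "bij p"
  shows "(\<integral>\<^sup>+x. f (\<chi> i. x $ p i) \<partial>lborel) = (\<integral>\<^sup>+x. f x \<partial>lborel)"
proof -
  have "lborel = distr lborel borel (\<lambda>x::'a^'n. \<chi> i. x $ p i)"
  proof (rule lborel_eqI)
    fix l u :: "'a^'n" assume le: "\<And>b. b \<in> Basis \<Longrightarrow> l \<bullet> b \<le> u \<bullet> b"
    have q: "p (inv p i) = i" "inv p (p i) = i" for i
      using p by (auto simp: surj_f_inv_f[OF bij_is_surj] inv_f_f[OF bij_is_inj])
    let ?l = "\<chi> i. l $ inv p i" and ?u = "\<chi> i. u $ inv p i"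
    have le': "l $ i \<bullet> b \<le> u $ i \<bullet> b" if "b \<in> Basis" for i b
      using le[of "axis i b"] that by (auto simp: inner_axis Basis_vec_def)
    have "(\<lambda>x::'a^'n. \<chi> i. x $ p i) -` box l u = box ?l ?u"
      unfolding set_eq_iff vimage_eq mem_box_vec vec_lambda_beta by (metis q)
    then have "emeasure (distr lborel borel (\<lambda>x::'a^'n. \<chi> i. x $ p i)) (box l u) = emeasure lborel (box ?l ?u)"
      by (subst emeasure_distr) auto
    also have "\<dots> = ennreal (\<Prod>b\<in>Basis. (?u - ?l) \<bullet> b)"
      by (rule emeasure_lborel_box) (auto simp: Basis_vec_def inner_axis le')
    also have "(\<Prod>b\<in>Basis. (?u - ?l) \<bullet> b) = (\<Prod>b\<in>Basis. (u - l) \<bullet> b)"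
      using prod.reindex_bij_betw[OF p, of "\<lambda>i. \<Prod>b\<in>Basis. (u $ inv p i - l $ inv p i) \<bullet> b"]
      by (simp add: prod_Basis_vec inner_axis q)
    finally show "emeasure (distr lborel borel (\<lambda>x::'a^'n. \<chi> i. x $ p i)) (box l u) = ennreal (prod ((\<bullet>) (u - l)) Basis)" .
  qed simp
  then have "(\<integral>\<^sup>+x. f x \<partial>lborel) = (\<integral>\<^sup>+x. f x \<partial>distr lborel borel (\<lambda>x::'a^'n. \<chi> i. x $ p i))" by simp
  also have "\<dots> = (\<integral>\<^sup>+x. f (\<chi> i. x $ p i) \<partial>lborel)"
    by (rule nn_integral_distr) measurable
  finally show ?thesis by simp
qed

text \<open>Used to pass between points as rows, which is how their law is given, and coordinates as
  rows, where the half-space constraint concerns a single row.\<close>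

lemma nn_integral_lborel_transpose:
  fixes f :: "real ^ 'n ^ 'n \<Rightarrow> ennreal"
  assumes [measurable]: "f \<in> borel_measurable borel"
  shows "(\<integral>\<^sup>+x. f (transpose x) \<partial>lborel) = (\<integral>\<^sup>+x. f x \<partial>lborel)"
proof -
  have [measurable]: "(transpose :: real^'n^'n \<Rightarrow> _) \<in> borel_measurable borel"
    unfolding transpose_def by measurable
  have "lborel = distr lborel borel (transpose :: real^'n^'n \<Rightarrow> _)"
  proof (rule lborel_eqI)
    fix l u :: "real^'n^'n" assume le: "\<And>b. b \<in> Basis \<Longrightarrow> l \<bullet> b \<le> u \<bullet> b"
    have tb: "transpose b \<in> Basis" if "b \<in> Basis" for b :: "real^'n^'n"
    proof -
      from that obtain i j where "b = axis i (axis j 1)" by (auto simp: Basis_vec_def)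
      then have "transpose b = axis j (axis i 1)" by (simp add: vec_eq_iff transpose_def axis_def)
      then show ?thesis by (auto simp: Basis_vec_def)
    qed
    have ti: "transpose x \<bullet> y = x \<bullet> transpose y" for x y :: "real^'n^'n"
      unfolding inner_vec_def transpose_def by (simp, subst sum.swap, simp)
    have td: "transpose x - transpose y = transpose (x - y)" for x y :: "real^'n^'n"
      by (simp add: vec_eq_iff transpose_def)
    have "transpose -` box l u = box (transpose l) (transpose u)"
    proof -
      have "(\<forall>b\<in>Basis. P (transpose b)) \<longleftrightarrow> (\<forall>b\<in>Basis. P (b::real^'n^'n))" for P
        using tb by (metis transpose_transpose)
      from this[of "\<lambda>b. l \<bullet> b < x \<bullet> transpose b \<and> x \<bullet> transpose b < u \<bullet> b" for x]
      show ?thesis by (auto simp: mem_box ti)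
    qed
    then have "emeasure (distr lborel borel transpose) (box l u) = emeasure lborel (box (transpose l) (transpose u))"
      by (subst emeasure_distr) auto
    also have "\<dots> = ennreal (\<Prod>b\<in>Basis. (transpose u - transpose l) \<bullet> b)"
      by (rule emeasure_lborel_box) (auto simp: ti le tb)
    also have "(\<Prod>b\<in>Basis. (transpose u - transpose l) \<bullet> b) = (\<Prod>b\<in>Basis. (u - l) \<bullet> b)"
      by (rule prod.reindex_bij_witness[where i=transpose and j=transpose]) (auto simp: tb ti td)
    finally show "emeasure (distr lborel borel transpose) (box l u) = ennreal (prod ((\<bullet>) (u - l)) Basis)" .
  qed simp
  then have "(\<integral>\<^sup>+x. f x \<partial>lborel) = (\<integral>\<^sup>+x. f x \<partial>distr lborel borel (transpose :: real^'n^'n \<Rightarrow> _))" by simp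
  also have "\<dots> = (\<integral>\<^sup>+x. f (transpose x) \<partial>lborel)"
    by (rule nn_integral_distr) measurable
  finally show ?thesis by simp
qed

text \<open>Every square matrix is built from elementary ones, and the rule is multiplicative along
  products; a matrix with a zero row satisfies it vacuously.\<close>

lemma nn_integral_matrix_vector_mult:
  fixes A :: "real ^ 'n ^ 'n" and f :: "real ^ 'n \<Rightarrow> ennreal"
  assumes "det A \<noteq> 0" and "f \<in> borel_measurable borel"
  shows "(\<integral>\<^sup>+x. f x \<partial>lborel) = ennreal \<bar>det A\<bar> * (\<integral>\<^sup>+x. f (A *v x) \<partial>lborel)"
proof -
  \<comment> \<open>\<open>f\<close> is quantified inside the predicate: in the product step the
    hypothesis for \<open>B\<close> is applied to the function that already contains
    \<open>A\<close>.\<close>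
  have "det A \<noteq> 0 \<longrightarrow> (\<forall>f\<in>borel_measurable borel.
    (\<integral>\<^sup>+x. f x \<partial>lborel) = ennreal \<bar>det A\<bar> * (\<integral>\<^sup>+x. f (A *v x) \<partial>lborel))" (is "?P A")
  proof (rule induct_matrix_elementary[where P = "?P"])
    fix A B assume A: "?P A" and B: "?P B"
    show "?P (A ** B)"
    proof (intro impI ballI)
      fix f :: "real^'n \<Rightarrow> ennreal" assume f[measurable]: "f \<in> borel_measurable borel" and "det (A ** B) \<noteq> 0"
      then have "det A \<noteq> 0" "det B \<noteq> 0" by (auto simp: det_mul)
      have "(\<integral>\<^sup>+x. f x \<partial>lborel) = ennreal \<bar>det A\<bar> * (\<integral>\<^sup>+x. f (A *v x) \<partial>lborel)"
        using A \<open>det A \<noteq> 0\<close> f by blast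
      also have "(\<integral>\<^sup>+x. f (A *v x) \<partial>lborel) = ennreal \<bar>det B\<bar> * (\<integral>\<^sup>+x. f (A *v (B *v x)) \<partial>lborel)"
      proof -
        have "(\<lambda>x. f (A *v x)) \<in> borel_measurable borel" by measurable
        with B \<open>det B \<noteq> 0\<close> show ?thesis by blast
      qed
      finally show "(\<integral>\<^sup>+x. f x \<partial>lborel) = ennreal \<bar>det (A ** B)\<bar> * (\<integral>\<^sup>+x. f ((A ** B) *v x) \<partial>lborel)"
        by (simp only: det_mul abs_mult ennreal_mult'' abs_ge_zero matrix_vector_mul_assoc mult.assoc)
    qed
  next
    fix A :: "real^'n^'n" and i assume "row i A = 0"
    then show "?P A" using det_zero_row by auto
  next
    fix A :: "real^'n^'n" assume A: "\<And>i j. i \<noteq> j \<Longrightarrow> A $ i $ j = 0"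
    have d: "det A = (\<Prod>i\<in>UNIV. A $ i $ i)" by (rule det_diagonal) (use A in auto)
    have Av: "A *v x = (\<chi> i. A $ i $ i * x $ i)" for x
    proof -
      have "(\<Sum>j\<in>UNIV. A $ i $ j * x $ j) = (\<Sum>j\<in>UNIV. if j = i then A $ i $ i * x $ i else 0)" for i
        by (rule sum.cong) (auto simp: A)
      then show ?thesis by (simp add: matrix_vector_mult_def vec_eq_iff)
    qed
    show "?P A"
    proof (intro impI ballI)
      fix f :: "real^'n \<Rightarrow> ennreal" assume f[measurable]: "f \<in> borel_measurable borel" and "det A \<noteq> 0"
      then have nz: "A $ i $ i \<noteq> 0" for i by (simp add: d)
      \<comment> \<open>For a basis vector \<open>axis i 1\<close> this sum is the diagonal entry at
        \<open>i\<close>, so \<open>c\<close> turns the matrix into a family of stretching factors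
        indexed by the basis.\<close>
      define c :: "real^'n \<Rightarrow> real" where "c b = (\<Sum>i\<in>UNIV. A $ i $ i * b $ i)" for b
      have c_axis: "c (axis i 1) = A $ i $ i" for i
        unfolding c_def axis_def by (simp add: if_distrib cong: if_cong)
      have cnz: "c b \<noteq> 0" if "b \<in> Basis" for b
        using that nz by (auto simp: Basis_vec_def c_axis)
      have T: "(\<Sum>j\<in>Basis. (c j * (x \<bullet> j)) *\<^sub>R j) = A *v x" for x
      proof -
        have "(\<Sum>j\<in>Basis. (c j * (x \<bullet> j)) *\<^sub>R j) = (\<Sum>j\<in>range (\<lambda>i. axis i (1::real)). (c j * (x \<bullet> j)) *\<^sub>R j)"
          by (rule sum.cong) (auto simp: Basis_vec_def)
        also have "\<dots> = (\<Sum>i\<in>UNIV. (A $ i $ i * x $ i) *\<^sub>R axis i 1)"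
          by (subst sum.reindex) (auto simp: inj_on_def axis_eq_axis c_axis inner_axis)
        also have "\<dots> = A *v x"
          unfolding Av by (simp add: vec_eq_iff axis_def if_distrib cong: if_cong)
        finally show ?thesis .
      qed
      have P: "(\<Prod>j\<in>Basis. \<bar>c j\<bar>) = \<bar>det A\<bar>"
      proof -
        have "(\<Prod>j\<in>Basis. \<bar>c j\<bar>) = (\<Prod>j\<in>range (\<lambda>i. axis i (1::real)). \<bar>c j\<bar>)"
          by (rule prod.cong) (auto simp: Basis_vec_def)
        also have "\<dots> = \<bar>det A\<bar>"
          by (subst prod.reindex) (auto simp: inj_on_def axis_eq_axis c_axis d abs_prod)
        finally show ?thesis .
      qed
      have "lborel = density (distr lborel borel ((*v) A)) (\<lambda>_. \<bar>det A\<bar>)"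
        using lborel_affine_euclidean[where c=c and t=0, OF cnz] by (simp add: T P)
      then have "(\<integral>\<^sup>+x. f x \<partial>lborel) = (\<integral>\<^sup>+x. f x \<partial>density (distr lborel borel ((*v) A)) (\<lambda>_. \<bar>det A\<bar>))"
        by simp
      also have "\<dots> = ennreal \<bar>det A\<bar> * (\<integral>\<^sup>+x. f (A *v x) \<partial>lborel)"
        by (simp add: nn_integral_density nn_integral_distr nn_integral_cmult)
      finally show "(\<integral>\<^sup>+x. f x \<partial>lborel) = ennreal \<bar>det A\<bar> * (\<integral>\<^sup>+x. f (A *v x) \<partial>lborel)" .
    qed
  next
    fix m n :: 'n assume "m \<noteq> n"
    let ?A = "\<chi> i j. mat 1 $ i $ Transposition.transpose m n j :: real^'n^'n"
    have "det ?A = of_int (sign (Transposition.transpose m n)) * det (mat 1 :: real^'n^'n)"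
      by (rule det_permute_columns) (simp add: permutes_swap_id)
    then have d: "\<bar>det ?A\<bar> = 1" by (simp add: sign_def)
    have e: "?A *v x = (\<chi> i. x $ Transposition.transpose m n i)" for x
    proof -
      have "i = Transposition.transpose m n j \<longleftrightarrow> j = Transposition.transpose m n i" for i j
        by (metis transpose_involutory)
      then have "(\<Sum>j\<in>UNIV. if i = Transposition.transpose m n j then x $ j else 0) =
          (\<Sum>j\<in>UNIV. if j = Transposition.transpose m n i then x $ j else 0)" for i
        by (intro sum.cong) auto
      then show ?thesis
        by (simp add: matrix_vector_mult_def mat_def vec_eq_iff if_distrib if_distribR cong: if_cong)
    qed
    show "?P ?A"
      by (intro impI ballI) (simp only: d e nn_integral_lborel_permute[OF _ bij_transpose], simp)
  next
    fix m n :: 'n and c :: real assume mn: "m \<noteq> n"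
    let ?A = "\<chi> i j. if i = m \<and> j = n then c else of_bool (i = j) :: real^'n^'n"
    have e: "?A *v x = (\<chi> i. if i = m then x $ m + c * x $ n else x $ i)" for x
    proof -
      have "(\<Sum>j\<in>UNIV. (if i = m \<and> j = n then c else of_bool (i = j)) * x $ j) =
         (\<Sum>j\<in>UNIV. (if j = i then x $ i else 0) + (if i = m \<and> j = n then c * x $ n else 0))" for i
        by (rule sum.cong) (use mn in auto)
      then show ?thesis
        by (simp add: matrix_vector_mult_def vec_eq_iff sum.distrib)
    qed
    have "?A = (\<chi> k. if k = m then row m (mat 1) + c *s row n (mat 1) else row k (mat 1))"
      using mn by (auto simp: vec_eq_iff row_def mat_def)
    then have d: "det ?A = 1"
      using det_row_operation[OF mn, of "mat 1 :: real^'n^'n" c] by simp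
    show "?P ?A"
    proof (intro impI ballI)
      fix f :: "real^'n \<Rightarrow> ennreal" assume f[measurable]: "f \<in> borel_measurable borel"
      have "(\<integral>\<^sup>+x. f (?A *v x) \<partial>lborel) = 
        (\<integral>\<^sup>+S. \<integral>\<^sup>+s. f (\<chi> i. if i = m then s + c * S n else S i) \<partial>lborel \<partial>PiM (UNIV - {m}) (\<lambda>_. lborel))"
        unfolding e
        by (subst nn_integral_lborel_vec_split(1)[where k=m], measurable)
           (use mn in \<open>auto intro!: nn_integral_cong arg_cong[where f=f] simp: vec_eq_iff\<close>)
      also have "\<dots> = (\<integral>\<^sup>+S. \<integral>\<^sup>+s. f (\<chi> i. if i = m then s else S i) \<partial>lborel \<partial>PiM (UNIV - {m}) (\<lambda>_. lborel))"
      proof (rule nn_integral_cong)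
        fix S :: "'n \<Rightarrow> real"
        show "(\<integral>\<^sup>+s. f (\<chi> i. if i = m then s + c * S n else S i) \<partial>lborel) =
          (\<integral>\<^sup>+s. f (\<chi> i. if i = m then s else S i) \<partial>lborel)"
          by (rule nn_integral_translate[where f="\<lambda>s. f (\<chi> i. if i = m then s else S i)"]) measurable
      qed
      also have "\<dots> = (\<integral>\<^sup>+x. f x \<partial>lborel)"
        by (subst nn_integral_lborel_vec_split(1)[where k=m]) auto
      finally show "(\<integral>\<^sup>+x. f x \<partial>lborel) = ennreal \<bar>det ?A\<bar> * (\<integral>\<^sup>+x. f (?A *v x) \<partial>lborel)"
        by (simp add: d)
    qed
  qed
  with assms show ?thesis by blast
qed

text \<open>The map acts on each of the \<open>CARD('m)\<close> components separately, so its
  Jacobian is a power. This is checked on product sets, where the integral factors into one change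
  of variables per component.\<close>

lemma nn_integral_lborel_vec_matrix:
  fixes A :: "real ^ 'n ^ 'n" and f :: "real ^ 'n ^ 'm \<Rightarrow> ennreal"
  assumes A: "det A \<noteq> 0" and [measurable]: "f \<in> borel_measurable borel"
  shows "(\<integral>\<^sup>+R. f R \<partial>lborel) = ennreal (\<bar>det A\<bar> ^ CARD('m)) * (\<integral>\<^sup>+S. f (\<chi> a. A *v (S $ a)) \<partial>lborel)"
proof -
  interpret product_sigma_finite "\<lambda>_::'m. lborel :: (real^'n) measure"
    by (rule product_sigma_finite_lborel)
  let ?L = "PiM UNIV (\<lambda>_::'m. lborel :: (real^'n) measure)"
  let ?T = "\<lambda>S (a::'m). A *v (S $ a)"
  have [measurable]: "?T \<in> borel \<rightarrow>\<^sub>M ?L"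
    by (rule measurable_PiM_single') (auto simp: space_PiM)
  have "distr (density lborel (\<lambda>_::(real^'n)^'m. ennreal (\<bar>det A\<bar> ^ CARD('m)))) ?L ?T = ?L"
  proof (rule PiM_eqI)
    fix B :: "'m \<Rightarrow> (real^'n) set" assume "\<And>i. i \<in> UNIV \<Longrightarrow> B i \<in> sets lborel"
    then have [measurable]: "B i \<in> sets borel" for i by simp
    have "emeasure (distr (density lborel (\<lambda>_. ennreal (\<bar>det A\<bar> ^ CARD('m)))) ?L ?T) (Pi\<^sub>E UNIV B) =
      (\<integral>\<^sup>+S. indicator (Pi\<^sub>E UNIV B) (?T S) \<partial>density lborel (\<lambda>_. ennreal (\<bar>det A\<bar> ^ CARD('m))))"
      by (subst nn_integral_indicator[symmetric], simp add: sets_PiM_I_finite, subst nn_integral_distr)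
         (auto intro!: sets_PiM_I_finite)
    also have "\<dots> = ennreal (\<bar>det A\<bar> ^ CARD('m)) * (\<integral>\<^sup>+S. indicator (Pi\<^sub>E UNIV B) (?T S) \<partial>lborel)"
      by (subst nn_integral_density) (auto intro!: nn_integral_cmult sets_PiM_I_finite)
    also have "(\<integral>\<^sup>+S. indicator (Pi\<^sub>E UNIV B) (?T S) \<partial>lborel) =
      (\<integral>\<^sup>+S. (\<Prod>a\<in>UNIV. indicator (B a) (A *v (S $ a))) \<partial>lborel)"
      by (intro nn_integral_cong) (auto simp: indicator_def PiE_iff prod_eq_1_iff)
    also have "\<dots> = (\<Prod>a\<in>UNIV. \<integral>\<^sup>+s. indicator (B a) (A *v s) \<partial>lborel)"
      by (rule nn_integral_lborel_vec_prod) measurable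
    also have "ennreal (\<bar>det A\<bar> ^ CARD('m)) * \<dots> =
      (\<Prod>a\<in>UNIV. ennreal \<bar>det A\<bar> * (\<integral>\<^sup>+s. indicator (B a) (A *v s) \<partial>lborel))"
      by (simp add: prod.distrib ennreal_power)
    also have "\<dots> = (\<Prod>a\<in>UNIV. emeasure lborel (B a))"
      by (subst nn_integral_matrix_vector_mult[OF A, symmetric]) auto
    finally show "emeasure (distr (density lborel (\<lambda>_. ennreal (\<bar>det A\<bar> ^ CARD('m)))) ?L ?T) (Pi\<^sub>E UNIV B) =
      (\<Prod>i\<in>UNIV. emeasure lborel (B i))" .
  qed auto
  then have "(\<integral>\<^sup>+R. f R \<partial>lborel) = (\<integral>\<^sup>+R. f (vec_lambda R) \<partial>distr (density lborel (\<lambda>_::(real^'n)^'m. ennreal (\<bar>det A\<bar> ^ CARD('m)))) ?L ?T)"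
    by (simp add: nn_integral_lborel_vec)
  also have "\<dots> = ennreal (\<bar>det A\<bar> ^ CARD('m)) * (\<integral>\<^sup>+S. f (\<chi> a. A *v (S $ a)) \<partial>lborel)"
    by (subst nn_integral_distr) (auto simp: nn_integral_density nn_integral_cmult)
  finally show ?thesis .
qed

section \<open>Radial integrals and homogeneity\<close>

text \<open>Radial integrals are taken with respect to the multiplicative Haar measure, written in the
  exponential coordinate \<^term>\<open>r = exp t\<close>.\<close>

definition radial_integral :: "nat \<Rightarrow> (real \<Rightarrow> ennreal) \<Rightarrow> ennreal" where
  "radial_integral m \<phi> = (\<integral>\<^sup>+t. ennreal (exp (real m * t)) * \<phi> (exp t) \<partial>lborel)"

lemma radial_integral_scale:
  assumes [measurable]: "\<phi> \<in> borel_measurable borel" and c: "c > 0"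
  shows "radial_integral m \<phi> = ennreal (c ^ m) * radial_integral m (\<lambda>r. \<phi> (c * r))"
proof -
  have e: "exp (m * (t + ln c)) = c ^ m * exp (m * t)" "exp (t + ln c) = c * exp t" for t :: real
    using c by (simp_all add: exp_add distrib_left exp_of_nat_mult mult.commute)
  have "radial_integral m \<phi> = (\<integral>\<^sup>+t. ennreal (exp (real m * (t + ln c))) * \<phi> (exp (t + ln c)) \<partial>lborel)"
    unfolding radial_integral_def
    by (subst nn_integral_translate[where f="\<lambda>t. ennreal (exp (real m * t)) * \<phi> (exp t)"]) measurable
  then show ?thesis
    unfolding e radial_integral_def using c
    by (subst nn_integral_cmult[symmetric]) (auto simp: ennreal_mult mult.assoc)
qed

text \<open>Both sides are the same double integral over \<^term>\<open>D\<close> and the scaling group, because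
  \<^term>\<open>q\<close> is homogeneous; no polar decomposition of Lebesgue measure is needed.\<close>

lemma radial_integral_swap:
  fixes q :: "'a::euclidean_space \<Rightarrow> real"
  assumes q[measurable]: "q \<in> borel_measurable borel" and D[measurable]: "D \<in> sets borel"
    and cone: "\<And>t x. t > 0 \<Longrightarrow> t *\<^sub>R x \<in> D \<longleftrightarrow> x \<in> D"
    and hom: "\<And>t x. t > 0 \<Longrightarrow> q (t *\<^sub>R x) = t * q x"
    and pos: "\<And>x. x \<in> D \<Longrightarrow> q x > 0"
    and [measurable]: "\<phi> \<in> borel_measurable borel" "\<psi> \<in> borel_measurable borel"
  shows "(\<integral>\<^sup>+x. indicator D x * \<phi> (q x) \<partial>lborel) * radial_integral DIM('a) \<psi> =
         (\<integral>\<^sup>+x. indicator D x * \<psi> (q x) \<partial>lborel) * radial_integral DIM('a) \<phi>"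
proof -
  let ?m = "DIM('a)"
  \<comment> \<open>Scaling by \<open>q x\<close> moves this factor into the argument of the second
    function and produces the kernel on which the exchange of the two functions acts.\<close>
  have one: "(\<integral>\<^sup>+x. indicator D x * \<phi> (q x) \<partial>lborel) * radial_integral ?m \<psi> =
    (\<integral>\<^sup>+x. \<integral>\<^sup>+t. indicator D x * \<phi> (q x) * \<psi> (q x * exp t) * ennreal (q x ^ ?m * exp (?m * t)) \<partial>lborel \<partial>lborel)"
    if [measurable]: "\<phi> \<in> borel_measurable borel" "\<psi> \<in> borel_measurable borel" for \<phi> \<psi> :: "real \<Rightarrow> ennreal"
  proof -
    have "(\<integral>\<^sup>+x. indicator D x * \<phi> (q x) \<partial>lborel) * radial_integral ?m \<psi> =
      (\<integral>\<^sup>+x. indicator D x * \<phi> (q x) * radial_integral ?m \<psi> \<partial>lborel)"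
      by (subst nn_integral_multc) auto
    also have "\<dots> = (\<integral>\<^sup>+x. \<integral>\<^sup>+t. indicator D x * \<phi> (q x) * \<psi> (q x * exp t) * ennreal (q x ^ ?m * exp (?m * t)) \<partial>lborel \<partial>lborel)"
    proof (rule nn_integral_cong)
      fix x :: 'a
      show "indicator D x * \<phi> (q x) * radial_integral ?m \<psi> =
        (\<integral>\<^sup>+t. indicator D x * \<phi> (q x) * \<psi> (q x * exp t) * ennreal (q x ^ ?m * exp (?m * t)) \<partial>lborel)"
      proof (cases "x \<in> D")
        case True
        from pos[OF this] have p: "q x > 0" .
        show ?thesis
          by (subst radial_integral_scale[OF _ p], simp, unfold radial_integral_def)
             (subst nn_integral_cmult[symmetric], use p in \<open>auto simp: ennreal_mult mult_ac nn_integral_cmult\<close>)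
      qed simp
    qed
    finally show ?thesis .
  qed
  have "(\<integral>\<^sup>+x. indicator D x * \<phi> (q x) \<partial>lborel) * radial_integral ?m \<psi> =
    (\<integral>\<^sup>+t. \<integral>\<^sup>+x. indicator D x * \<phi> (q x) * \<psi> (q x * exp t) * ennreal (q x ^ ?m * exp (?m * t)) \<partial>lborel \<partial>lborel)"
    unfolding one[OF assms(6,7)] by (rule lborel_pair.Fubini') measurable
  \<comment> \<open>Scaling \<open>x\<close> by \<open>exp (- t)\<close> divides \<open>q\<close> by
    \<open>exp t\<close>: the argument of \<open>\<psi>\<close> becomes \<open>q x\<close>, that of
    \<open>\<phi>\<close> becomes \<open>q x * exp (- t)\<close>. The two functions have exchanged
    their places, up to the sign of \<open>t\<close>.\<close>
  also have "\<dots> = (\<integral>\<^sup>+t. \<integral>\<^sup>+x. indicator D x * \<psi> (q x) * \<phi> (q x * exp (-t)) * ennreal (q x ^ ?m * exp (?m * (-t))) \<partial>lborel \<partial>lborel)"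
  proof (rule nn_integral_cong)
    fix t :: real
    let ?F = "\<lambda>x. indicator D x * \<phi> (q x) * \<psi> (q x * exp t) * ennreal (q x ^ ?m * exp (?m * t))"
    have "(\<integral>\<^sup>+x. ?F x \<partial>lborel) = ennreal (\<bar>exp (-t)\<bar> ^ ?m) * (\<integral>\<^sup>+x. ?F (exp (-t) *\<^sub>R x) \<partial>lborel)"
      by (rule nn_integral_scaleR) auto
    also have "\<dots> = (\<integral>\<^sup>+x. ennreal (\<bar>exp (-t)\<bar> ^ ?m) * ?F (exp (-t) *\<^sub>R x) \<partial>lborel)"
      by (rule nn_integral_cmult[symmetric]) measurable
    also have "\<dots> = (\<integral>\<^sup>+x. indicator D x * \<psi> (q x) * \<phi> (q x * exp (-t)) * ennreal (q x ^ ?m * exp (?m * (-t))) \<partial>lborel)"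
    proof (rule nn_integral_cong)
      fix x :: 'a
      have D': "indicator D (exp (-t) *\<^sub>R x) = (indicator D x :: ennreal)"
        by (simp add: indicator_def cone)
      have q': "q (exp (-t) *\<^sub>R x) = exp (-t) * q x" by (simp add: hom)
      have e1: "exp (-t) * q x * exp t = q x" by (simp add: exp_minus)
      have e2: "\<bar>exp (-t)\<bar> ^ ?m * ((exp (-t) * q x) ^ ?m * exp (?m * t)) = q x ^ ?m * exp (?m * (-t))"
      proof -
        have "exp (?m * t) = exp t ^ ?m" "exp (?m * (-t)) = exp (-t) ^ ?m"
          by (simp_all only: exp_of_nat_mult)
        moreover have "exp (-t) ^ ?m * exp t ^ ?m = 1" by (simp add: power_mult_distrib[symmetric] exp_minus)
        ultimately show ?thesis by (simp add: power_mult_distrib)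
      qed
      have ac: "a * (i * p * s * e) = i * s * p * (a * e)" for a i p s e :: ennreal
        by (simp add: ac_simps)
      show "ennreal (\<bar>exp (-t)\<bar> ^ ?m) * (indicator D (exp (-t) *\<^sub>R x) * \<phi> (q (exp (-t) *\<^sub>R x)) *
          \<psi> (q (exp (-t) *\<^sub>R x) * exp t) * ennreal (q (exp (-t) *\<^sub>R x) ^ ?m * exp (?m * t))) =
        indicator D x * \<psi> (q x) * \<phi> (q x * exp (-t)) * ennreal (q x ^ ?m * exp (?m * (-t)))"
      proof (cases "x \<in> D")
        case True
        have "ennreal (\<bar>exp (-t)\<bar> ^ ?m) * ennreal ((exp (-t) * q x) ^ ?m * exp (?m * t)) =
            ennreal (q x ^ ?m * exp (?m * (-t)))"
          unfolding e2[symmetric] using pos[OF True] by (subst ennreal_mult) (auto intro!: mult_nonneg_nonneg)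
        then show ?thesis
          unfolding D' q' e1 mult.commute[of "q x" "exp (-t)"] using ac
          by metis
      qed (simp add: D')
    qed
    finally show "(\<integral>\<^sup>+x. ?F x \<partial>lborel) =
      (\<integral>\<^sup>+x. indicator D x * \<psi> (q x) * \<phi> (q x * exp (-t)) * ennreal (q x ^ ?m * exp (?m * (-t))) \<partial>lborel)" .
  qed
  also have "\<dots> = (\<integral>\<^sup>+t. \<integral>\<^sup>+x. indicator D x * \<psi> (q x) * \<phi> (q x * exp t) * ennreal (q x ^ ?m * exp (?m * t)) \<partial>lborel \<partial>lborel)"
  proof -
    have "(\<lambda>t::real. \<integral>\<^sup>+x. indicator D x * \<psi> (q x) * \<phi> (q x * exp t) * ennreal (q x ^ ?m * exp (?m * t)) \<partial>lborel)
        \<in> borel_measurable borel"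
      by (rule lborel.borel_measurable_nn_integral) measurable
    from nn_integral_real_affine[OF this, of "-1" 0] show ?thesis by simp
  qed
  also have "\<dots> = (\<integral>\<^sup>+x. indicator D x * \<psi> (q x) \<partial>lborel) * radial_integral ?m \<phi>"
    unfolding one[OF assms(7,6)] by (rule lborel_pair.Fubini') measurable
  finally show ?thesis .
qed

text \<open>Substitution on the compact windows \<open>{- real n..real n}\<close>, which
  \<open>exp\<close> maps onto intervals exhausting the positive half-line; monotone convergence
  removes the windows.\<close>

lemma nn_integral_exp_substitution:
  fixes f :: "real \<Rightarrow> real"
  assumes [measurable]: "f \<in> borel_measurable borel" and nonneg: "\<And>x. f x \<ge> 0"
  shows "(\<integral>\<^sup>+t. ennreal (f (exp t) * exp t) \<partial>lborel) = (\<integral>\<^sup>+x. ennreal (f x) * indicator {0<..} x \<partial>lborel)"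
proof -
  have "(\<integral>\<^sup>+x. ennreal (f x) * indicator {exp (- real n)..exp (real n)} x \<partial>lborel) =
    (\<integral>\<^sup>+t. ennreal (f (exp t) * exp t) * indicator {- real n..real n} t \<partial>lborel)" for n
  proof -
    have "(\<integral>\<^sup>+x. ennreal (f x * indicator {exp (- real n)..exp (real n)} x) \<partial>lborel) =
      (\<integral>\<^sup>+t. ennreal (f (exp t) * exp t * indicator {- real n..real n} t) \<partial>lborel)"
      by (rule nn_integral_substitution[where g=exp and g'=exp])
         (auto simp: set_borel_measurable_def intro!: derivative_eq_intros continuous_intros)
    then show ?thesis using nonneg by (simp add: ennreal_mult ennreal_indicator)
  qed
  note eq = this
  have "(\<lambda>n. \<integral>\<^sup>+x. ennreal (f x) * indicator {exp (- real n)..exp (real n)} x \<partial>lborel) \<longlonglongrightarrow>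
    (\<integral>\<^sup>+x. ennreal (f x) * indicator {0<..} x \<partial>lborel)"
  proof (rule nn_integral_LIMSEQ)
    show "incseq (\<lambda>n x. ennreal (f x) * indicator {exp (- real n)..exp (real n)} x)"
      by (auto simp: incseq_def le_fun_def indicator_def)
         (meson dual_order.trans exp_le_cancel_iff neg_le_iff_le of_nat_mono order_trans)+
    fix x :: real
    show "(\<lambda>n. ennreal (f x) * indicator {exp (- real n)..exp (real n)} x) \<longlonglongrightarrow> ennreal (f x) * indicator {0<..} x"
    proof (cases "x > 0")
      case True
      obtain N :: nat where N: "\<bar>ln x\<bar> \<le> N" using real_arch_simple by blast
      have "x \<in> {exp (- real n)..exp (real n)}" if "n \<ge> N" for n
      proof -
        have "\<bar>ln x\<bar> \<le> real n" using N that by linarith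
        then have "exp (- real n) \<le> exp (ln x)" "exp (ln x) \<le> exp (real n)" by (simp_all add: abs_le_iff)
        then show ?thesis using True by simp
      qed
      then show ?thesis
        using True by (intro tendsto_eventually eventually_sequentiallyI[of N]) (simp add: indicator_def)
    next
      case False
      then have "x \<notin> {exp (- real n)..exp (real n)}" for n
        using less_le_trans[OF exp_gt_zero[of "- real n"], of x] by auto
      then have "indicator {exp (- real n)..exp (real n)} x = (0::ennreal)" for n by (simp add: indicator_def)
      with False show ?thesis by (simp only: mult_zero_right) simp
    qed
  qed measurable
  moreover have "(\<lambda>n. \<integral>\<^sup>+t. ennreal (f (exp t) * exp t) * indicator {- real n..real n} t \<partial>lborel) \<longlonglongrightarrow>
    (\<integral>\<^sup>+t. ennreal (f (exp t) * exp t) \<partial>lborel)"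
  proof (rule nn_integral_LIMSEQ)
    show "incseq (\<lambda>n t. ennreal (f (exp t) * exp t) * indicator {- real n..real n} t)"
      by (auto simp: incseq_def le_fun_def indicator_def)
    fix t :: real
    obtain N :: nat where N: "\<bar>t\<bar> \<le> N" using real_arch_simple by blast
    then show "(\<lambda>n. ennreal (f (exp t) * exp t) * indicator {- real n..real n} t) \<longlonglongrightarrow> ennreal (f (exp t) * exp t)"
      by (intro tendsto_eventually eventually_sequentiallyI[of N]) (auto simp: indicator_def abs_le_iff)
  qed measurable
  ultimately show ?thesis unfolding eq using LIMSEQ_unique by blast
qed

text \<open>The variable \<open>x = r^2 / 2\<close> turns this into Euler's integral for the Gamma
  function; in the exponential coordinate the change is affine, replacing \<open>t\<close> by
  \<open>2 * t - ln 2\<close>.\<close>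

lemma radial_integral_Gauss:
  assumes "p \<ge> 1"
  shows "radial_integral p (\<lambda>r. ennreal (exp (- r\<^sup>2 / 2))) = ennreal (2 powr (p / 2 - 1) * Gamma (p / 2))"
proof -
  have sq: "exp t ^ 2 / 2 = exp (2 * t - ln 2)" for t :: real
    by (simp add: exp_diff exp_double)
  have "radial_integral p (\<lambda>r. ennreal (exp (- r\<^sup>2 / 2))) =
    (\<integral>\<^sup>+t. ennreal (exp (p * t) * exp (- exp (2 * t - ln 2))) \<partial>lborel)"
    unfolding radial_integral_def by (simp add: sq[symmetric] ennreal_mult)
  also have "\<dots> = ennreal (1 / 2) * (\<integral>\<^sup>+t. ennreal (exp (p * (ln 2 / 2 + t / 2)) * exp (- exp t)) \<partial>lborel)"
    by (subst nn_integral_real_affine[where c="1/2" and t="ln 2 / 2"]) (simp_all add: algebra_simps)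
  also have "\<dots> = ennreal (1 / 2) * (\<integral>\<^sup>+t. ennreal (2 powr (p / 2)) * ennreal (exp t powr (p / 2 - 1) / exp (exp t) * exp t) \<partial>lborel)"
  proof -
    have "exp (p * (ln 2 / 2 + t / 2)) * exp (- exp t) = 2 powr (p / 2) * (exp t powr (p / 2 - 1) / exp (exp t) * exp t)" for t :: real
    proof -
      have "exp t powr (p / 2 - 1) * exp t = exp (t * (p / 2))"
        by (simp add: powr_def exp_add[symmetric] algebra_simps)
      then show ?thesis by (simp add: powr_def exp_add[symmetric] exp_minus field_simps)
    qed
    then show ?thesis by (simp add: ennreal_mult[symmetric])
  qed
  also have "\<dots> = ennreal (1 / 2) * (ennreal (2 powr (p / 2)) * (\<integral>\<^sup>+x. ennreal (x powr (p / 2 - 1) / exp x) * indicator {0<..} x \<partial>lborel))"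
  proof -
    have "(\<integral>\<^sup>+t. ennreal (exp t powr (p / 2 - 1) / exp (exp t) * exp t) \<partial>lborel) =
        (\<integral>\<^sup>+x. ennreal (x powr (p / 2 - 1) / exp x) * indicator {0<..} x \<partial>lborel)"
      by (rule nn_integral_exp_substitution[where f="\<lambda>x. x powr (p / 2 - 1) / exp x"]) auto
    note S = this
    show ?thesis by (subst nn_integral_cmult, measurable, simp only: S)
  qed
  also have "(\<integral>\<^sup>+x. ennreal (x powr (p / 2 - 1) / exp x) * indicator {0<..} x \<partial>lborel) = ennreal (Gamma (p / 2))"
  proof -
    have "(\<integral>\<^sup>+x. ennreal (x powr (p / 2 - 1) / exp x) * indicator {0<..} x \<partial>lborel) =
      (\<integral>\<^sup>+x. ennreal (indicator {0..} x * x powr (p / 2 - 1) / exp x) \<partial>lborel)"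
      by (rule nn_integral_cong_AE, rule AE_mp[OF AE_lborel_singleton[of 0]]) (auto simp: indicator_def)
    also have "\<dots> = ennreal (Gamma (p / 2))"
      using Gamma_conv_nn_integral_real[of "p / 2"] assms by simp
    finally show ?thesis .
  qed
  also have "ennreal (1 / 2) * (ennreal (2 powr (p / 2)) * ennreal (Gamma (p / 2))) = ennreal (2 powr (p / 2 - 1) * Gamma (p / 2))"
    using assms by (subst ennreal_mult[symmetric], simp, simp, subst ennreal_mult[symmetric]) (auto simp: powr_diff)
  finally show ?thesis .
qed

section \<open>Gaussian integrals\<close>

text \<open>Left unnormalised, so that one weight serves vectors, matrices and half-spaces; the
  powers of \<open>sqrt (2 * pi)\<close> are collected explicitly.\<close>

definition gauss :: "'a::real_normed_vector \<Rightarrow> real" where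
  "gauss x = exp (- (norm x)\<^sup>2 / 2)"

lemma gauss_pos [simp]: "gauss x > 0" and gauss_nonneg [simp]: "gauss x \<ge> 0"
  by (simp_all add: gauss_def)

lemma borel_measurable_gauss [measurable]: "gauss \<in> borel_measurable borel"
  unfolding gauss_def by measurable

lemma power2_norm_vec: "(norm x)\<^sup>2 = (\<Sum>i\<in>UNIV. (norm (x $ i))\<^sup>2)" for x :: "'a::real_normed_vector ^ 'n"
  by (simp add: norm_vec_def L2_set_def sum_nonneg)

lemma gauss_vec: "gauss x = (\<Prod>i\<in>UNIV. gauss (x $ i))" for x :: "'a::real_normed_vector ^ 'n"
  unfolding gauss_def power2_norm_vec
  by (subst exp_sum[symmetric]) (simp_all add: sum_negf sum_divide_distrib)

lemma nn_integral_gauss_real: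
  "(\<integral>\<^sup>+x. ennreal (gauss (x::real)) \<partial>lborel) = ennreal (sqrt (2 * pi))"
  "(\<integral>\<^sup>+x. ennreal (gauss (x::real)) * indicator {0..} x \<partial>lborel) = ennreal (sqrt (2 * pi) / 2)"
proof -
  have "(\<integral>\<^sup>+x. ennreal (std_normal_density x) \<partial>lborel) = 1"
    using prob_space_normal_density[of 1 0] by (simp add: prob_space_def prob_space_axioms_def emeasure_density)
  show *: "(\<integral>\<^sup>+x. ennreal (gauss (x::real)) \<partial>lborel) = ennreal (sqrt (2 * pi))"
  proof -
    have "(\<integral>\<^sup>+x. ennreal (gauss (x::real)) \<partial>lborel) = (\<integral>\<^sup>+x. ennreal (sqrt (2 * pi)) * ennreal (std_normal_density x) \<partial>lborel)"
      by (intro nn_integral_cong) (simp add: gauss_def std_normal_density_def ennreal_mult[symmetric])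
    also have "\<dots> = ennreal (sqrt (2 * pi))"
      by (subst nn_integral_cmult) (simp_all add: \<open>(\<integral>\<^sup>+x. ennreal (std_normal_density x) \<partial>lborel) = 1\<close>)
    finally show ?thesis .
  qed
  have "(\<integral>\<^sup>+x. ennreal (gauss (x::real)) \<partial>lborel) =
     (\<integral>\<^sup>+x. ennreal (gauss x) * indicator {0..} (x::real) + ennreal (gauss x) * indicator {..<0} x \<partial>lborel)"
    by (intro nn_integral_cong) (auto simp: indicator_def)
  also have "\<dots> = (\<integral>\<^sup>+x. ennreal (gauss x) * indicator {0..} (x::real) \<partial>lborel) + (\<integral>\<^sup>+x. ennreal (gauss x) * indicator {..<0} (x::real) \<partial>lborel)"
    by (rule nn_integral_add) measurable
  also have "(\<integral>\<^sup>+x. ennreal (gauss x) * indicator {..<0} (x::real) \<partial>lborel) = (\<integral>\<^sup>+x. ennreal (gauss (- x)) * indicator {..<0} (- x :: real) \<partial>lborel)"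
    by (subst nn_integral_real_affine[where c="-1" and t=0]) simp_all
  also have "\<dots> = (\<integral>\<^sup>+x. ennreal (gauss x) * indicator {0..} (x::real) \<partial>lborel)"
    by (rule nn_integral_cong_AE, rule AE_mp[OF AE_lborel_singleton[of 0]]) (auto simp: indicator_def gauss_def)
  finally have two: "2 * (\<integral>\<^sup>+x. ennreal (gauss (x::real)) * indicator {0..} x \<partial>lborel) = ennreal (sqrt (2 * pi))"
    by (simp only: mult_2 *)
  define h where "h = (\<integral>\<^sup>+x. ennreal (gauss (x::real)) * indicator {0..} x \<partial>lborel)"
  have "h \<noteq> \<infinity>" using two unfolding h_def[symmetric] by (auto simp: ennreal_mult_eq_top_iff)
  then obtain r where r: "h = ennreal r" "r \<ge> 0" by (cases h) auto
  have "ennreal (2 * r) = ennreal (sqrt (2 * pi))"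
    using two r unfolding h_def[symmetric] by (simp add: ennreal_mult)
  then have "2 * r = sqrt (2 * pi)" using r by (subst (asm) ennreal_inj) auto
  with r show "(\<integral>\<^sup>+x. ennreal (gauss (x::real)) * indicator {0..} x \<partial>lborel) = ennreal (sqrt (2 * pi) / 2)"
    unfolding h_def[symmetric] by (simp add: field_simps)
qed

lemma nn_integral_gauss_vec:
  "(\<integral>\<^sup>+x. ennreal (gauss (x::real^'n)) \<partial>lborel) = ennreal (sqrt (2 * pi) ^ CARD('n))"
proof -
  have "(\<integral>\<^sup>+x. ennreal (gauss (x::real^'n)) \<partial>lborel) = (\<integral>\<^sup>+x. (\<Prod>i\<in>UNIV. ennreal (gauss (x $ i :: real))) \<partial>(lborel :: (real^'n) measure))"
    by (intro nn_integral_cong) (simp add: gauss_vec prod_ennreal)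
  also have "\<dots> = (\<Prod>i\<in>(UNIV::'n set). \<integral>\<^sup>+x. ennreal (gauss (x::real)) \<partial>lborel)"
    by (rule nn_integral_lborel_vec_prod) measurable
  finally show ?thesis by (simp add: nn_integral_gauss_real ennreal_power)
qed

lemma nn_integral_gauss_half_space:
  "(\<integral>\<^sup>+x. ennreal (gauss x) * indicator {x. x $ i0 \<ge> 0} (x :: real^'n) \<partial>lborel) = ennreal (sqrt (2 * pi) ^ CARD('n) / 2)"
  for i0 :: "'n::finite"
proof -
  let ?f = "\<lambda>i (x::real). ennreal (gauss x) * (if i = i0 then indicator {0..} x else 1)"
  have "(\<integral>\<^sup>+x. ennreal (gauss x) * indicator {x. x $ i0 \<ge> 0} (x :: real^'n) \<partial>lborel) =
     (\<integral>\<^sup>+x. (\<Prod>i\<in>UNIV. ?f i (x $ i)) \<partial>(lborel :: (real^'n) measure))"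
  proof (intro nn_integral_cong)
    fix x :: "real^'n"
    have "(\<Prod>i\<in>UNIV. if i = i0 then indicator {0..} (x $ i) else 1 :: ennreal) = indicator {0..} (x $ i0)"
      by simp
    then show "ennreal (gauss x) * indicator {x. x $ i0 \<ge> 0} x = (\<Prod>i\<in>UNIV. ?f i (x $ i))"
      by (simp add: gauss_vec prod_ennreal prod.distrib indicator_def)
  qed
  also have "\<dots> = (\<Prod>i\<in>(UNIV::'n set). \<integral>\<^sup>+x. ?f i x \<partial>lborel)"
    by (rule nn_integral_lborel_vec_prod) measurable
  also have "\<dots> = (\<Prod>i\<in>(UNIV::'n set). ennreal (sqrt (2 * pi)) * (if i = i0 then ennreal (1 / 2) else 1))"
    by (intro prod.cong refl)
       (auto simp: nn_integral_gauss_real ennreal_mult[symmetric] simp del: ennreal_half)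
  also have "\<dots> = ennreal (sqrt (2 * pi) ^ CARD('n)) * ennreal (1 / 2)"
    by (simp only: prod.distrib) (simp add: ennreal_power)
  finally show ?thesis by (simp add: ennreal_mult[symmetric] del: ennreal_half)
qed

section \<open>The uniform law on the half-sphere as a law of Gaussian directions\<close>

text \<open>The standard Gaussian law conditioned on the half-space; the factor 2 is the inverse of
  the probability of the half-space.\<close>

definition half_gauss :: "'n \<Rightarrow> (real ^ 'n) measure" where
  "half_gauss i0 = density lborel (\<lambda>x. ennreal (2 / sqrt (2 * pi) ^ CARD('n) * gauss x) * indicator {x. x $ i0 \<ge> 0} x)"

lemma sgn_scaleR_pos: "t > 0 \<Longrightarrow> sgn (t *\<^sub>R x) = sgn x" for x :: "'a::real_normed_vector"
  by (simp add: sgn_scaleR)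

lemma sgn_mem_half_sphere: "sgn x \<in> half_sphere i0 \<longleftrightarrow> x \<noteq> 0 \<and> x $ i0 \<ge> 0" for x :: "real^'n"
  by (auto simp: half_sphere_def norm_sgn sgn_div_norm zero_le_divide_iff divide_inverse[symmetric] zero_le_mult_iff)

lemma half_sphere_borel [measurable]: "half_sphere i0 \<in> sets borel" for i0 :: "'n::finite"
  unfolding half_sphere_def by measurable

lemma sets_sphere_measure [simp]: "sets sphere_measure = sets borel"
  by (simp add: sphere_measure_def)

lemma borel_measurable_sgn' [measurable]: "(sgn :: 'a::euclidean_space \<Rightarrow> 'a) \<in> borel_measurable borel"
  unfolding sgn_div_norm[abs_def] by measurable

lemma emeasure_sphere_measure:
  fixes B :: "'a::euclidean_space set"
  assumes [measurable]: "B \<in> sets borel"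
  shows "emeasure sphere_measure B = of_nat DIM('a) * (\<integral>\<^sup>+x. indicator {x. sgn x \<in> B} x * indicator {..1} (norm x) \<partial>lborel)"
proof -
  have m: "sgn \<in> restrict_space lborel (cball 0 1) \<rightarrow>\<^sub>M (borel :: 'a measure)"
    by (rule measurable_restrict_space1) simp
  have "emeasure sphere_measure B = of_nat DIM('a) * emeasure (restrict_space lborel (cball 0 1)) (sgn -` B \<inter> cball 0 1)"
    unfolding sphere_measure_def using m by (simp add: emeasure_distr space_restrict_space)
  also have "emeasure (restrict_space lborel (cball 0 1)) (sgn -` B \<inter> cball 0 1) = emeasure lborel (sgn -` B \<inter> cball 0 1 :: 'a set)"
    by (rule emeasure_restrict_space) auto
  also have "\<dots> = (\<integral>\<^sup>+x. indicator (sgn -` B \<inter> cball 0 1) x \<partial>lborel)"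
    by (rule nn_integral_indicator[symmetric])
       (use measurable_sets[of "sgn :: 'a \<Rightarrow> 'a" borel borel B] in auto)
  also have "\<dots> = (\<integral>\<^sup>+x. indicator {x. sgn x \<in> B} x * indicator {..1} (norm x) \<partial>lborel)"
    by (intro nn_integral_cong) (auto simp: indicator_def)
  finally show ?thesis .
qed

text \<open>The radial mass of the unit ball is \<open>1 / m\<close>; this is what the factor
  \<open>DIM('a)\<close> in \<open>sphere_measure\<close> compensates.\<close>

lemma radial_integral_unit_interval:
  assumes "m \<ge> 1"
  shows "of_nat m * radial_integral m (indicator {..1}) = 1"
proof -
  have "radial_integral m (indicator {..1}) = (\<integral>\<^sup>+t. ennreal (exp (- real m * t)) * indicator {0..} t \<partial>lborel)"
    unfolding radial_integral_def
    by (subst nn_integral_real_affine[where c="-1" and t=0]) (auto intro!: nn_integral_cong simp: indicator_def)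
  also have "\<dots> = ennreal (0 - (- exp (- real m * 0) / m))"
  proof (rule nn_integral_FTC_atLeast)
    show "((\<lambda>x. - exp (- real m * x) / m) \<longlongrightarrow> 0) at_top"
      using assms by real_asymp
  qed (use assms in \<open>auto intro!: derivative_eq_intros\<close>)
  also have "of_nat m * \<dots> = 1"
    using assms by (simp add: ennreal_of_nat_eq_real_of_nat ennreal_mult[symmetric])
  finally show ?thesis .
qed

text \<open>\<open>radial_integral_swap\<close> for the norm, on the cone of all \<open>x\<close>
  with direction in \<open>B\<close>: the indicator of the unit ball is traded for the Gaussian
  weight. Since \<open>sgn 0 = 0\<close>, the condition on \<open>B\<close> keeps the origin out of
  this cone, on which the norm has to be positive.\<close>

lemma sphere_measure_eq_gauss:
  fixes B :: "'a::euclidean_space set"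
  assumes [measurable]: "B \<in> sets borel" and B0: "0 \<notin> B"
  shows "emeasure sphere_measure B * radial_integral DIM('a) (\<lambda>r. ennreal (exp (- r\<^sup>2 / 2))) =
    (\<integral>\<^sup>+x. indicator {x. sgn x \<in> B} x * ennreal (gauss x) \<partial>lborel)"
proof -
  have "(\<integral>\<^sup>+x. indicator {x. sgn x \<in> B} x * indicator {..1} (norm x) \<partial>lborel) * radial_integral DIM('a) (\<lambda>r. ennreal (exp (- r\<^sup>2 / 2))) =
    (\<integral>\<^sup>+x. indicator {x. sgn x \<in> B} x * ennreal (exp (- (norm x)\<^sup>2 / 2)) \<partial>lborel) * radial_integral DIM('a) (indicator {..1})"
  proof (rule radial_integral_swap)
    show "0 < norm x" if "x \<in> {x. sgn x \<in> B}" for x :: 'a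
      using that B0 by (cases "x = 0") auto
  qed (auto simp: sgn_scaleR_pos)
  then have "emeasure sphere_measure B * radial_integral DIM('a) (\<lambda>r. ennreal (exp (- r\<^sup>2 / 2))) =
    (\<integral>\<^sup>+x. indicator {x. sgn x \<in> B} x * ennreal (gauss x) \<partial>lborel) * (of_nat DIM('a) * radial_integral DIM('a) (indicator {..1}))"
    by (simp add: emeasure_sphere_measure gauss_def mult_ac)
  also have "of_nat DIM('a) * radial_integral DIM('a) (indicator {..1}) = 1"
    by (rule radial_integral_unit_interval) (simp add: Suc_leI)
  finally show ?thesis by simp
qed

text \<open>The surface measure of a part of the half-sphere is proportional to the Gaussian mass of
  its cone. The radial factor is the same for every set, so it cancels in the quotient that defines
  the uniform measure.\<close>

lemma uniform_half_sphere_eq: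
  "uniform_half_sphere i0 = distr (half_gauss i0) borel sgn" for i0 :: "'n::finite"
proof (rule measure_eqI)
  fix B :: "(real^'n) set" assume "B \<in> sets (uniform_half_sphere i0)"
  then have B[measurable]: "B \<in> sets borel" by (simp add: uniform_half_sphere_def)
  let ?H = "half_sphere i0" and ?S = "sphere_measure :: (real^'n) measure"
  define N where "N = sqrt (2 * pi) ^ CARD('n)"
  have N: "N > 0" by (simp add: N_def)
  define g where "g B = (\<integral>\<^sup>+x. indicator {x. sgn x \<in> B} x * ennreal (gauss x) \<partial>lborel)" for B :: "(real^'n) set"
  have H0: "0 \<notin> ?H" by (simp add: half_sphere_def)
  obtain r where r: "radial_integral DIM(real^'n) (\<lambda>r. ennreal (exp (- r\<^sup>2 / 2))) = ennreal r" "r > 0"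
    using radial_integral_Gauss[of "DIM(real^'n)"] by (auto simp: Suc_leI Gamma_real_pos)
  have eq: "emeasure ?S C * ennreal r = g C" if "C \<in> sets borel" "C \<subseteq> ?H" for C
    unfolding g_def r(1)[symmetric] by (rule sphere_measure_eq_gauss) (use that H0 in auto)
  have ae: "AE x in lborel. x \<noteq> (0::real^'n)" by (rule AE_lborel_singleton)
  have gH: "g ?H = ennreal (N / 2)"
    unfolding g_def N_def nn_integral_gauss_half_space[of i0, symmetric]
    by (rule nn_integral_cong_AE, rule AE_mp[OF ae]) (auto simp: sgn_mem_half_sphere indicator_def)
  have SH: "emeasure ?S ?H = ennreal (N / 2 / r)"
  proof -
    have "emeasure ?S ?H * ennreal r = ennreal (N / 2)" using eq[of ?H] gH by simp
    then have "emeasure ?S ?H * ennreal r / ennreal r = ennreal (N / 2) / ennreal r" by simp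
    then show ?thesis using r N by (simp add: divide_ennreal ennreal_mult_divide_eq)
  qed
  have "emeasure ?S (?H \<inter> B) \<le> emeasure ?S ?H" by (rule emeasure_mono) auto
  then obtain s where s: "emeasure ?S (?H \<inter> B) = ennreal s" "s \<ge> 0"
    using SH by (cases "emeasure ?S (?H \<inter> B)") (auto simp: top_unique)
  have gB: "g (?H \<inter> B) = ennreal (s * r)" using eq[of "?H \<inter> B"] s r by (simp add: ennreal_mult)
  have "emeasure (uniform_half_sphere i0) B = ennreal (s / (N / 2 / r))"
    unfolding uniform_half_sphere_def using s r N
    by (subst emeasure_uniform_measure) (auto simp: SH divide_ennreal)
  also have "\<dots> = ennreal (2 / N) * g (?H \<inter> B)"
    unfolding gB using s r N by (simp add: ennreal_mult[symmetric] field_simps)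
  also have "\<dots> = (\<integral>\<^sup>+x. ennreal (2 / N) * (indicator {x. sgn x \<in> ?H \<inter> B} x * ennreal (gauss x)) \<partial>lborel)"
    unfolding g_def by (subst nn_integral_cmult) measurable
  also have "\<dots> = (\<integral>\<^sup>+x. ennreal (2 / N * gauss x) * indicator {x. x $ i0 \<ge> 0} x * indicator B (sgn x) \<partial>lborel)"
    by (rule nn_integral_cong_AE, rule AE_mp[OF ae])
       (use N in \<open>auto simp: sgn_mem_half_sphere indicator_def ennreal_mult[symmetric]\<close>)
  also have "\<dots> = (\<integral>\<^sup>+x. indicator B (sgn x) \<partial>half_gauss i0)"
    unfolding half_gauss_def N_def by (subst nn_integral_density) auto
  also have "\<dots> = (\<integral>\<^sup>+x. indicator B x \<partial>distr (half_gauss i0) borel sgn)"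
    by (subst nn_integral_distr) (auto simp: half_gauss_def)
  also have "\<dots> = emeasure (distr (half_gauss i0) borel sgn) B" by simp
  finally show "emeasure (uniform_half_sphere i0) B = emeasure (distr (half_gauss i0) borel sgn) B" .
qed (simp add: uniform_half_sphere_def)

section \<open>Gaussian integrals of a determinant with one distinguished row\<close>

text \<open>\<open>A\<close> is a square root of the quadratic form: a rotation takes
  \<open>c\<close> to a coordinate axis, and that axis is stretched by
  \<open>sqrt (1 + (norm c)^2)\<close>.\<close>

lemma shear_matrix_exists:
  fixes c :: "real ^ 'n"
  obtains A :: "real ^ 'n ^ 'n"
  where "\<And>r. (norm (A *v r))\<^sup>2 = (norm r)\<^sup>2 + (r \<bullet> c)\<^sup>2" and "\<bar>det A\<bar> = sqrt (1 + (norm c)\<^sup>2)"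
proof -
  obtain k :: 'n where True by simp
  have "norm c = norm (norm c *\<^sub>R axis k (1::real))" by simp
  then obtain f :: "real^'n \<Rightarrow> real^'n" where f: "orthogonal_transformation f" "f c = norm c *\<^sub>R axis k 1"
    using orthogonal_transformation_exists by blast
  define s where "s = sqrt (1 + (norm c)\<^sup>2)"
  have s2: "s\<^sup>2 = 1 + (norm c)\<^sup>2" by (simp add: s_def)
  define Dg where "Dg = (\<chi> i j. if i = j then (if i = k then s else 1) else 0 :: real^'n^'n)"
  have Dg: "(Dg *v x) $ i = (if i = k then s else 1) * x $ i" for x i
  proof -
    have "(\<Sum>j\<in>UNIV. Dg $ i $ j * x $ j) = (\<Sum>j\<in>UNIV. if j = i then (if i = k then s else 1) * x $ i else 0)"
      by (intro sum.cong) (auto simp: Dg_def)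
    then show ?thesis by (simp add: matrix_vector_mult_def)
  qed
  have n: "(norm (Dg *v x))\<^sup>2 = (norm x)\<^sup>2 + (norm c)\<^sup>2 * (x $ k)\<^sup>2" for x
  proof -
    have "(norm (Dg *v x))\<^sup>2 = (\<Sum>i\<in>UNIV. (x $ i)\<^sup>2 + (if i = k then (norm c)\<^sup>2 * (x $ k)\<^sup>2 else 0))"
      unfolding power2_norm_vec[of "Dg *v x"] Dg
      by (intro sum.cong refl) (simp add: power_mult_distrib s2 algebra_simps)
    then show ?thesis by (simp add: sum.distrib power2_norm_vec[of x])
  qed
  have "det Dg = (\<Prod>i\<in>UNIV. Dg $ i $ i)" by (rule det_diagonal) (simp add: Dg_def)
  also have "\<dots> = s" by (simp add: Dg_def)
  finally have dD: "det Dg = s" .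
  have lin: "linear f" using f by (simp add: orthogonal_transformation_def)
  show ?thesis
  proof (rule that[of "Dg ** matrix f"])
    fix r :: "real^'n"
    have fr: "matrix f *v r = f r" using lin by (simp add: matrix_works)
    have "r \<bullet> c = f r \<bullet> f c" using f(1) by (simp add: orthogonal_transformation_def)
    also have "\<dots> = norm c * f r $ k" by (simp only: f(2)) (simp add: inner_axis)
    finally show "(norm ((Dg ** matrix f) *v r))\<^sup>2 = (norm r)\<^sup>2 + (r \<bullet> c)\<^sup>2"
      by (simp add: matrix_vector_mul_assoc[symmetric] fr n power_mult_distrib orthogonal_transformation_norm[OF f(1)])
    have "orthogonal_matrix (matrix f)" using f orthogonal_transformation_matrix by blast
    then have "\<bar>det (matrix f)\<bar> = 1" using det_orthogonal_matrix by fastforce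
    then show "\<bar>det (Dg ** matrix f)\<bar> = sqrt (1 + (norm c)\<^sup>2)"
      by (simp add: det_mul abs_mult dD s_def)
  qed
qed

text \<open>The integral \<open>cofactor_integral\<close> carries a dummy row in position \<^term>\<open>i0\<close>, so that a full matrix
  can be rotated in the proof of its isotropy.\<close>

definition cofactor_integral :: "'n \<Rightarrow> real ^ 'n \<Rightarrow> ennreal" where
  "cofactor_integral i0 s =
    (\<integral>\<^sup>+S. ennreal \<bar>det ((\<chi> a. if a = i0 then s else S $ a) :: real^'n^'n)\<bar> * ennreal (gauss S) \<partial>lborel)"

text \<open>The integral is absolutely homogeneous of degree one in \<open>s\<close>, and rotating
  all rows at once changes neither the absolute determinant nor the Gaussian weight. Hence only the
  length of \<open>s\<close> can matter.\<close>

lemma cofactor_integral_isotropic: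
  fixes i0 :: "'n::finite"
  shows "cofactor_integral i0 s = ennreal (norm s) * cofactor_integral i0 (axis i0 1)"
proof -
  let ?e = "axis i0 1 :: real^'n"
  have scale: "cofactor_integral i0 (t *\<^sub>R s) = ennreal \<bar>t\<bar> * cofactor_integral i0 s" for t and s :: "real^'n"
  proof -
    have "det ((\<chi> a. if a = i0 then t *\<^sub>R s else S $ a) :: real^'n^'n) = t * det ((\<chi> a. if a = i0 then s else S $ a) :: real^'n^'n)" for S :: "real^'n^'n"
      using det_row_mul[of i0 t "\<lambda>_. s" "\<lambda>a. S $ a"] by (simp only: scalar_mult_eq_scaleR[symmetric])
    then show ?thesis
      unfolding cofactor_integral_def
      by (subst nn_integral_cmult[symmetric]) (auto simp: abs_mult ennreal_mult mult.assoc)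
  qed
  have "norm s = norm (norm s *\<^sub>R ?e)" by simp
  then obtain f :: "real^'n \<Rightarrow> real^'n" where f: "orthogonal_transformation f" "f (norm s *\<^sub>R ?e) = s"
    using orthogonal_transformation_exists by metis
  have lin: "linear f" using f by (simp add: orthogonal_transformation_def)
  let ?O = "matrix f"
  have fr: "?O *v r = f r" for r using lin by (simp add: matrix_works)
  have "orthogonal_matrix ?O" using f orthogonal_transformation_matrix by blast
  then have dO: "\<bar>det ?O\<bar> = 1" using det_orthogonal_matrix by fastforce
  have g: "gauss (\<chi> a. f (S $ a)) = gauss S" for S :: "real^'n^'n"
    unfolding gauss_def power2_norm_vec[of S] power2_norm_vec[of "\<chi> a. f (S $ a)"] by (simp add: orthogonal_transformation_norm[OF f(1)])
  have "cofactor_integral i0 s =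
    (\<integral>\<^sup>+S. ennreal \<bar>det ((\<chi> a. if a = i0 then s else f (S $ a)) :: real^'n^'n)\<bar> * ennreal (gauss S) \<partial>lborel)"
    unfolding cofactor_integral_def
    by (subst nn_integral_lborel_vec_matrix[of ?O]) (use dO in \<open>auto simp: fr g cong: if_cong\<close>)
  also have "\<dots> = cofactor_integral i0 (norm s *\<^sub>R ?e)"
    unfolding cofactor_integral_def
  proof (intro nn_integral_cong)
    fix S :: "real^'n^'n"
    \<comment> \<open>Rotating the rows is multiplication by an orthogonal matrix from the right,
      and row \<open>s\<close> is by the choice of \<open>f\<close> the image of
      \<open>norm s *\<^sub>R ?e\<close>.\<close>
    have "((\<chi> a. if a = i0 then s else f (S $ a)) :: real^'n^'n) =
        (\<chi> a. if a = i0 then norm s *\<^sub>R ?e else S $ a) ** transpose ?O"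
      using f fr by (auto simp: vec_eq_iff matrix_matrix_mult_def transpose_def matrix_vector_mult_def
          mult.commute simp flip: fr)
    then have "\<bar>det ((\<chi> a. if a = i0 then s else f (S $ a)) :: real^'n^'n)\<bar> =
        \<bar>det ((\<chi> a. if a = i0 then norm s *\<^sub>R ?e else S $ a) :: real^'n^'n)\<bar>"
      by (simp only: det_mul det_transpose abs_mult dO mult_1_right)
    then show "ennreal \<bar>det ((\<chi> a. if a = i0 then s else f (S $ a)) :: real^'n^'n)\<bar> * ennreal (gauss S) =
      ennreal \<bar>det ((\<chi> a. if a = i0 then norm s *\<^sub>R ?e else S $ a) :: real^'n^'n)\<bar> * ennreal (gauss S)" by (simp only:)
  qed
  also have "\<dots> = ennreal (norm s) * cofactor_integral i0 ?e" by (simp add: scale)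
  finally show ?thesis .
qed

text \<open>Given row \<open>i0\<close>, the Gaussian integral of \<open>\<bar>det S\<bar>\<close>
  over the other rows is proportional to the length of that row. The power of
  \<open>sqrt (2 * pi)\<close> on the left is the mass of the dummy row contained in
  \<open>cofactor_integral\<close>.\<close>

lemma nn_integral_det_gauss:
  fixes i0 :: "'n::finite" and \<phi> :: "real ^ 'n \<Rightarrow> ennreal"
  assumes [measurable]: "\<phi> \<in> borel_measurable borel"
  shows "ennreal (sqrt (2 * pi) ^ CARD('n)) *
      (\<integral>\<^sup>+S. ennreal \<bar>det S\<bar> * ennreal (gauss S) * \<phi> (S $ i0) \<partial>(lborel :: (real^'n^'n) measure)) =
    cofactor_integral i0 (axis i0 1) * (\<integral>\<^sup>+s. ennreal (norm s * gauss s) * \<phi> s \<partial>lborel)"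
proof -
  let ?P = "PiM (UNIV - {i0}) (\<lambda>_. lborel :: (real^'n) measure)"
  let ?N = "ennreal (sqrt (2 * pi) ^ CARD('n))"
  define M where "M s S = (\<chi> a. if a = i0 then s else S a :: real^'n^'n)" for s and S :: "'n \<Rightarrow> real^'n"
  define w where "w S = ennreal (\<Prod>a\<in>UNIV - {i0}. gauss (S a))" for S :: "'n \<Rightarrow> real^'n"
  interpret product_sigma_finite "\<lambda>_::'n. lborel :: (real^'n) measure"
    by (rule product_sigma_finite_lborel)
  interpret P: finite_product_sigma_finite "\<lambda>_::'n. lborel :: (real^'n) measure" "UNIV - {i0}" by standard simp
  have w[measurable]: "w \<in> borel_measurable ?P" unfolding w_def by measurable
  have M[measurable]: "(\<lambda>(s, S). M s S) \<in> lborel \<Otimes>\<^sub>M ?P \<rightarrow>\<^sub>M borel"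
    unfolding M_def case_prod_beta
  proof (intro borel_measurable_vec_lambda)
    fix a show "(\<lambda>x. if a = i0 then fst x else snd x a) \<in> borel_measurable (lborel \<Otimes>\<^sub>M ?P)"
      by (cases "a = i0") (simp_all, measurable)
  qed
  have Ms[measurable]: "M s \<in> ?P \<rightarrow>\<^sub>M borel" for s 
    using measurable_Pair2[OF M, of s] by simp
  have gM: "ennreal (gauss (M s S)) = ennreal (gauss s) * w S" for s S
  proof -
    have "gauss (M s S) = gauss s * (\<Prod>a\<in>UNIV - {i0}. gauss (S a))"
      unfolding gauss_vec[of "M s S"]
      by (subst prod.remove[of _ i0]) (auto simp: M_def intro!: arg_cong2[where f="(*)"] prod.cong)
    then show ?thesis by (simp add: w_def ennreal_mult prod_nonneg)
  qed
  \<comment> \<open>The same integral without the dummy row; \<open>cofactor_integral i0 s\<close>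
    differs from it by the factor \<open>?N\<close>.\<close>
  define G where "G s = (\<integral>\<^sup>+S. ennreal \<bar>det (M s S)\<bar> * w S \<partial>?P)" for s
  have cof: "cofactor_integral i0 s = ?N * G s" for s
  proof -
    have "cofactor_integral i0 s =
      (\<integral>\<^sup>+s'. \<integral>\<^sup>+S. ennreal \<bar>det (M s S)\<bar> * (ennreal (gauss (s' :: real^'n)) * w S) \<partial>?P \<partial>lborel)"
      unfolding cofactor_integral_def
      by (subst nn_integral_lborel_vec_split(2)[where k=i0], measurable) 
         (simp add: gM[unfolded M_def] M_def cong: if_cong)
    also have "\<dots> = (\<integral>\<^sup>+s'. ennreal (gauss (s' :: real^'n)) * G s \<partial>lborel)"
      unfolding G_def
      by (intro nn_integral_cong, subst nn_integral_cmult[symmetric]) (auto simp: mult_ac)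
    also have "\<dots> = ?N * G s"
      by (subst nn_integral_multc) (auto simp: nn_integral_gauss_vec)
    finally show ?thesis .
  qed
  have Gm[measurable]: "G \<in> borel_measurable lborel"
    unfolding G_def by (rule P.borel_measurable_nn_integral) measurable
  have "(\<integral>\<^sup>+S. ennreal \<bar>det S\<bar> * ennreal (gauss S) * \<phi> (S $ i0) \<partial>(lborel :: (real^'n^'n) measure)) =
      (\<integral>\<^sup>+s. \<integral>\<^sup>+S. ennreal \<bar>det (M s S)\<bar> * (ennreal (gauss s) * w S) * \<phi> s \<partial>?P \<partial>lborel)"
    by (subst nn_integral_lborel_vec_split(2)[where k=i0], measurable)
       (simp add: M_def[symmetric] gM, simp add: M_def)
  also have "\<dots> = (\<integral>\<^sup>+s. (ennreal (gauss s) * \<phi> s) * G s \<partial>lborel)"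
    unfolding G_def by (intro nn_integral_cong, subst nn_integral_cmult[symmetric]) (auto simp: mult_ac)
  also have "?N * \<dots> = (\<integral>\<^sup>+s. (ennreal (gauss s) * \<phi> s) * (?N * G s) \<partial>lborel)"
    by (subst nn_integral_cmult[symmetric]) (auto simp: mult_ac)
  also have "\<dots> = (\<integral>\<^sup>+s. cofactor_integral i0 (axis i0 1) * (ennreal (norm s * gauss s) * \<phi> s) \<partial>lborel)"
    unfolding cof[symmetric] by (subst cofactor_integral_isotropic) (simp add: ennreal_mult mult_ac)
  also have "\<dots> = cofactor_integral i0 (axis i0 1) * (\<integral>\<^sup>+s. ennreal (norm s * gauss s) * \<phi> s \<partial>lborel)"
    by (rule nn_integral_cmult) measurable
  finally show ?thesis .
qed

lemma matrix_vector_mult_inverse_cancel: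
  fixes A :: "real ^ 'n ^ 'n"
  assumes "det A \<noteq> 0"
  obtains B where "\<And>x. A *v (B *v x) = x" "\<And>x. B *v (A *v x) = x" "det B = 1 / det A" "det B \<noteq> 0"
proof -
  from assms obtain B where B: "A ** B = mat 1" "B ** A = mat 1"
    unfolding invertible_det_nz[symmetric] invertible_def by blast
  have "det A * det B = 1" using arg_cong[OF B(1), of det] by (simp add: det_mul)
  then have "det B = 1 / det A" "det B \<noteq> 0" using assms by (auto simp: field_simps)
  with that[of B] B show ?thesis by (simp add: matrix_vector_mul_assoc)
qed

text \<open>The inverse shear \<open>B\<close> turns \<open>H\<close> into the squared norm in every
  row at once. This produces \<open>CARD('n) + 1\<close> factors \<open>\<bar>det B\<bar>\<close>:
  one per row from the change of variables, and one from the determinant. One of them is spent on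
  carrying row \<open>i0\<close> back to the variable \<open>r\<close>, where the length of the row
  is \<open>sqrt (H r)\<close>.\<close>

lemma nn_integral_det_shear:
  fixes i0 :: "'n::finite" and c :: "real ^ 'n" and D :: "(real ^ 'n) set"
  assumes [measurable]: "D \<in> sets borel"
  defines "H \<equiv> \<lambda>r. (norm r)\<^sup>2 + (r \<bullet> c)\<^sup>2"
  shows "ennreal (sqrt (2 * pi) ^ CARD('n)) *
      (\<integral>\<^sup>+R. ennreal \<bar>det R\<bar> * ennreal (exp (- (\<Sum>a\<in>UNIV. H (R $ a)) / 2)) * indicator D (R $ i0)
        \<partial>(lborel :: (real^'n^'n) measure)) =
    cofactor_integral i0 (axis i0 1) * (ennreal ((1 / sqrt (1 + (norm c)\<^sup>2)) ^ CARD('n)) *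
      (\<integral>\<^sup>+r. indicator D r * ennreal (sqrt (H r) * exp (- H r / 2)) \<partial>lborel))"
proof -
  obtain A :: "real^'n^'n" where A: "\<And>r. (norm (A *v r))\<^sup>2 = H r" and dA: "\<bar>det A\<bar> = sqrt (1 + (norm c)\<^sup>2)"
    unfolding H_def using shear_matrix_exists by blast
  have "1 + (norm c)\<^sup>2 > 0" by (simp add: add_pos_nonneg)
  then have dA0: "det A \<noteq> 0" using dA by auto
  obtain B where B: "\<And>x. A *v (B *v x) = x" "\<And>x. B *v (A *v x) = x" "det B = 1 / det A" "det B \<noteq> 0"
    using matrix_vector_mult_inverse_cancel[OF dA0] by blast
  have [measurable]: "H \<in> borel_measurable borel" unfolding H_def by measurable
  have HB: "H (B *v s) = (norm s)\<^sup>2" for s using A[of "B *v s"] by (simp add: B)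
  have eB: "exp (- (\<Sum>a\<in>UNIV. H (B *v (S $ a))) / 2) = gauss S" for S :: "real^'n^'n"
    by (simp add: HB gauss_def power2_norm_vec[of S])
  have dB: "\<bar>det (\<chi> a. B *v (S $ a))\<bar> = \<bar>det B\<bar> * \<bar>det S\<bar>" for S :: "real^'n^'n"
  proof -
    have "(\<chi> a. B *v (S $ a)) = S ** transpose B"
      by (simp add: vec_eq_iff matrix_matrix_mult_def transpose_def matrix_vector_mult_def mult.commute)
    then show ?thesis by (simp add: det_mul abs_mult)
  qed
  let ?b = "ennreal \<bar>det B\<bar>" and ?n = "CARD('n)" and ?N = "ennreal (sqrt (2 * pi) ^ CARD('n))"
  have "(\<integral>\<^sup>+R. ennreal \<bar>det R\<bar> * ennreal (exp (- (\<Sum>a\<in>UNIV. H (R $ a)) / 2)) * indicator D (R $ i0)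
        \<partial>(lborel :: (real^'n^'n) measure)) =
    ?b ^ ?n * (\<integral>\<^sup>+S. ?b * (ennreal \<bar>det S\<bar> * ennreal (gauss S) * indicator D (B *v (S $ i0))) \<partial>lborel)"
    by (subst nn_integral_lborel_vec_matrix[OF B(4)], measurable)
       (simp only: eB dB vec_lambda_beta, simp add: ennreal_mult ennreal_power mult.assoc)
  also have "\<dots> = ?b ^ ?n * (?b * (\<integral>\<^sup>+S. ennreal \<bar>det S\<bar> * ennreal (gauss S) * indicator D (B *v (S $ i0)) \<partial>lborel))"
    by (subst nn_integral_cmult) auto
  also have "?N * \<dots> = ?b ^ ?n * (?b * (?N * (\<integral>\<^sup>+S. ennreal \<bar>det S\<bar> * ennreal (gauss S) * indicator D (B *v (S $ i0)) \<partial>lborel)))"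
    by (simp add: mult_ac)
  also have "\<dots> = ?b ^ ?n * (?b * (cofactor_integral i0 (axis i0 1) * (\<integral>\<^sup>+s. ennreal (norm s * gauss s) * indicator D (B *v s) \<partial>lborel)))"
    by (subst nn_integral_det_gauss) auto
  also have "\<dots> = cofactor_integral i0 (axis i0 1) * (?b ^ ?n * (?b * (\<integral>\<^sup>+s. ennreal (norm s * gauss s) * indicator D (B *v s) \<partial>lborel)))"
    by (simp add: mult_ac)
  also have "?b * (\<integral>\<^sup>+s. ennreal (norm s * gauss s) * indicator D (B *v s) \<partial>lborel) =
    (\<integral>\<^sup>+r. indicator D r * ennreal (sqrt (H r) * exp (- H r / 2)) \<partial>lborel)"
    by (subst nn_integral_matrix_vector_mult[OF B(4)], measurable) (simp add: HB gauss_def mult.commute)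
  also have "?b = ennreal (1 / sqrt (1 + (norm c)\<^sup>2))" using B(3) dA by (simp add: abs_divide)
  finally show ?thesis by (simp add: ennreal_power)
qed

text \<open>The polynomial is taken in \<open>1 / t\<close>: its constant coefficient is the
  determinant of the identity, so it is visibly nonzero and has finitely many roots.\<close>

lemma finite_roots_det_affine:
  fixes Z :: "real ^ 'n ^ 'n"
  shows "finite {t. t \<noteq> 0 \<and> det (Z + t *\<^sub>R mat 1) = 0}"
proof -
  define p where "p s = det (mat 1 + s *\<^sub>R Z)" for s :: real
  have "real_polynomial_function (\<lambda>s. mat 1 $ i $ j + s * Z $ i $ j)" for i j
    by (intro real_polynomial_function.intros bounded_linear_ident)
  then have "real_polynomial_function p"
    unfolding p_def det_def
    by (intro real_polynomial_function_sum real_polynomial_function.intros(2,4)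
        real_polynomial_function_prod) (simp_all add: finite_permutations)
  then obtain a n where a: "p = (\<lambda>x. \<Sum>i\<le>n. a i * x ^ i)" using real_polynomial_function_imp_sum by blast
  have "p 0 = 1" by (simp add: p_def)
  moreover have "p 0 = a 0" by (simp add: a power_0_left if_distrib[of "\<lambda>x. _ * x"] cong: if_cong)
  ultimately have "a 0 \<noteq> 0" by simp
  then have "finite {s. p s = 0}" unfolding a using polyfun_finite_roots[of a n] by auto
  moreover have "{t. t \<noteq> 0 \<and> det (Z + t *\<^sub>R mat 1) = 0} \<subseteq> inverse ` {s. p s = 0}"
  proof
    fix t assume t: "t \<in> {t. t \<noteq> 0 \<and> det (Z + t *\<^sub>R mat 1) = 0}"
    have "mat 1 + inverse t *\<^sub>R Z = (\<chi> i. inverse t *s (Z + t *\<^sub>R mat 1) $ i)"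
      using t by (auto simp: vec_eq_iff distrib_left mult.assoc[symmetric])
    then have "p (inverse t) = 0"
      using t by (simp only: p_def det_rows_mul vec_lambda_eta) simp
    then show "t \<in> inverse ` {s. p s = 0}" by (intro image_eqI[of _ _ "inverse t"]) auto
  qed
  ultimately show ?thesis by (meson finite_imageI finite_subset)
qed

text \<open>Averaging over translations: moving \<open>Z\<close> along the identity matrix preserves
  Lebesgue measure, and on each such line the determinant vanishes for finitely many
  \<open>t \<noteq> 0\<close> only. The interval \<open>{1..2}\<close> has length one and avoids
  \<open>t = 0\<close>.\<close>

lemma AE_det_nonzero: "AE Z in (lborel :: (real ^ 'n ^ 'n) measure). det Z \<noteq> 0"
proof -
  let ?f = "\<lambda>Z :: real^'n^'n. indicator {Z. det Z = 0} Z :: ennreal"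
  define e where "e = (\<integral>\<^sup>+Z. ?f Z \<partial>lborel)"
  have "e = (\<integral>\<^sup>+t. indicator {1..2} t * e \<partial>(lborel :: real measure))"
    by (subst nn_integral_multc) auto
  also have "\<dots> = (\<integral>\<^sup>+t. \<integral>\<^sup>+Z. indicator {1..2} t * ?f (Z + t *\<^sub>R mat 1) \<partial>lborel \<partial>(lborel :: real measure))"
    unfolding e_def
    by (intro nn_integral_cong, subst nn_integral_cmult, measurable, subst nn_integral_translate[where f="?f"]) auto
  also have "\<dots> = (\<integral>\<^sup>+Z. \<integral>\<^sup>+t. indicator {1..2} t * ?f (Z + t *\<^sub>R mat 1) \<partial>(lborel :: real measure) \<partial>lborel)"
    by (rule lborel_pair.Fubini') measurable
  also have "\<dots> = (\<integral>\<^sup>+Z. 0 \<partial>(lborel :: (real^'n^'n) measure))"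
  proof (intro nn_integral_cong)
    fix Z :: "real^'n^'n"
    have "{t \<in> {1..2}. det (Z + t *\<^sub>R mat 1) = 0} \<subseteq> {t. t \<noteq> 0 \<and> det (Z + t *\<^sub>R mat 1) = 0}" by auto
    then have "finite {t \<in> {1..2}. det (Z + t *\<^sub>R mat 1) = 0}"
      using finite_roots_det_affine finite_subset by blast
    then have "(\<integral>\<^sup>+t. indicator {t \<in> {1..2}. det (Z + t *\<^sub>R mat 1) = 0} t \<partial>lborel) = 0"
      by (subst nn_integral_indicator) (simp_all add: emeasure_lborel_countable countable_finite borel_closed finite_imp_closed)
    then show "(\<integral>\<^sup>+t. indicator {1..2} t * ?f (Z + t *\<^sub>R mat 1) \<partial>lborel) = 0"
      by (simp add: indicator_def flip: of_bool_conj)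
  qed
  finally have "emeasure lborel {Z :: real^'n^'n. det Z = 0} = 0" by (simp add: e_def)
  then show ?thesis by (intro AE_I[of _ _ "{Z. det Z = 0}"]) auto
qed

text \<open>\<open>c\<close> holds the coefficients of the further point with respect to the rows of
  \<open>Z\<close>, and \<open>\<bar>det Z\<bar>\<close> is the Jacobian of this parametrisation.
  \<open>C\<close> constrains the coefficients, \<open>D\<close> the values of coordinate
  \<open>i0\<close> at the points; both are free, so that the constrained and the unconstrained
  problem are instances.\<close>

lemma nn_integral_det_split:
  fixes i0 :: "'n::finite" and C D :: "(real ^ 'n) set"
  assumes [measurable]: "C \<in> sets borel" "D \<in> sets borel"
  shows "ennreal (sqrt (2 * pi) ^ CARD('n)) *
    (\<integral>\<^sup>+Z. ennreal \<bar>det Z\<bar> * ennreal (gauss Z) * indicator D (transpose Z $ i0) *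
       (\<integral>\<^sup>+c. ennreal (gauss (c v* Z)) * indicator C c \<partial>lborel) \<partial>(lborel :: (real^'n^'n) measure)) =
    cofactor_integral i0 (axis i0 1) * (\<integral>\<^sup>+c. indicator C c * ennreal ((1 / sqrt (1 + (norm c)\<^sup>2)) ^ CARD('n)) *
      (\<integral>\<^sup>+r. indicator D r * ennreal (sqrt ((norm r)\<^sup>2 + (r \<bullet> c)\<^sup>2) * exp (- ((norm r)\<^sup>2 + (r \<bullet> c)\<^sup>2) / 2)) \<partial>lborel) \<partial>lborel)"
proof -
  let ?N = "ennreal (sqrt (2 * pi) ^ CARD('n))"
  have [measurable]: "(transpose :: real^'n^'n \<Rightarrow> _) \<in> borel_measurable borel"
    unfolding transpose_def by measurable
  \<comment> \<open>For fixed \<open>c\<close> the weight of all the points, including the further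
    one, factorises over the rows of the transposed matrix.\<close>
  have ex: "gauss R * gauss (R *v c) = exp (- (\<Sum>a\<in>UNIV. (norm (R $ a))\<^sup>2 + (R $ a \<bullet> c)\<^sup>2) / 2)"
    for R :: "real^'n^'n" and c
    unfolding gauss_def power2_norm_vec[of R] power2_norm_vec[of "R *v c"]
    by (simp add: matrix_vector_mul_component sum.distrib add_divide_distrib flip: exp_add)
  have gt: "gauss (transpose R) = gauss R" for R :: "real^'n^'n"
  proof -
    have "(norm (transpose R))\<^sup>2 = (norm R)\<^sup>2"
      unfolding power2_norm_eq_inner inner_vec_def transpose_def by (simp, subst sum.swap, simp)
    then show ?thesis by (simp add: gauss_def)
  qed
  have "(\<integral>\<^sup>+Z. ennreal \<bar>det Z\<bar> * ennreal (gauss Z) * indicator D (transpose Z $ i0) *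
       (\<integral>\<^sup>+c. ennreal (gauss (c v* Z)) * indicator C c \<partial>lborel) \<partial>(lborel :: (real^'n^'n) measure)) =
    (\<integral>\<^sup>+Z. \<integral>\<^sup>+c. ennreal \<bar>det Z\<bar> * ennreal (gauss Z) * indicator D (transpose Z $ i0) *
       (ennreal (gauss (c v* Z)) * indicator C c) \<partial>lborel \<partial>(lborel :: (real^'n^'n) measure))"
    by (intro nn_integral_cong nn_integral_cmult[symmetric]) measurable
  also have "\<dots> = (\<integral>\<^sup>+c. \<integral>\<^sup>+Z. ennreal \<bar>det Z\<bar> * ennreal (gauss Z) * indicator D (transpose Z $ i0) *
       (ennreal (gauss (c v* Z)) * indicator C c) \<partial>(lborel :: (real^'n^'n) measure) \<partial>lborel)"
    by (rule lborel_pair.Fubini') measurable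
  also have "\<dots> = (\<integral>\<^sup>+c. indicator C c * (\<integral>\<^sup>+R. ennreal \<bar>det R\<bar> *
      ennreal (exp (- (\<Sum>a\<in>UNIV. (norm (R $ a))\<^sup>2 + (R $ a \<bullet> c)\<^sup>2) / 2)) *
      indicator D (R $ i0) \<partial>(lborel :: (real^'n^'n) measure)) \<partial>lborel)"
  proof (rule nn_integral_cong)
    fix c :: "real^'n"
    have "(\<integral>\<^sup>+Z. ennreal \<bar>det Z\<bar> * ennreal (gauss Z) * indicator D (transpose Z $ i0) *
       (ennreal (gauss (c v* Z)) * indicator C c) \<partial>(lborel :: (real^'n^'n) measure)) =
      (\<integral>\<^sup>+R. ennreal \<bar>det (transpose R)\<bar> * ennreal (gauss (transpose R)) * indicator D (transpose (transpose R) $ i0) *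
       (ennreal (gauss (c v* transpose R)) * indicator C c) \<partial>(lborel :: (real^'n^'n) measure))"
      by (rule nn_integral_lborel_transpose[symmetric]) measurable
    also have "\<dots> = (\<integral>\<^sup>+R. indicator C c * (ennreal \<bar>det R\<bar> *
      ennreal (exp (- (\<Sum>a\<in>UNIV. (norm (R $ a))\<^sup>2 + (R $ a \<bullet> c)\<^sup>2) / 2)) *
      indicator D (R $ i0)) \<partial>(lborel :: (real^'n^'n) measure))"
      unfolding ex[symmetric] gt by (intro nn_integral_cong) (simp add: ennreal_mult mult_ac)
    also have "\<dots> = indicator C c * (\<integral>\<^sup>+R. ennreal \<bar>det R\<bar> *
      ennreal (exp (- (\<Sum>a\<in>UNIV. (norm (R $ a))\<^sup>2 + (R $ a \<bullet> c)\<^sup>2) / 2)) *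
      indicator D (R $ i0) \<partial>(lborel :: (real^'n^'n) measure))"
      by (rule nn_integral_cmult) measurable
    finally show "(\<integral>\<^sup>+Z. ennreal \<bar>det Z\<bar> * ennreal (gauss Z) * indicator D (transpose Z $ i0) *
       (ennreal (gauss (c v* Z)) * indicator C c) \<partial>(lborel :: (real^'n^'n) measure)) = \<dots>" .
  qed
  also have "?N * \<dots> = (\<integral>\<^sup>+c. indicator C c * (?N * (\<integral>\<^sup>+R. ennreal \<bar>det R\<bar> *
      ennreal (exp (- (\<Sum>a\<in>UNIV. (norm (R $ a))\<^sup>2 + (R $ a \<bullet> c)\<^sup>2) / 2)) *
      indicator D (R $ i0) \<partial>(lborel :: (real^'n^'n) measure))) \<partial>lborel)"
    by (subst nn_integral_cmult[symmetric]) (measurable, simp add: mult_ac)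
  also have "\<dots> = (\<integral>\<^sup>+c. cofactor_integral i0 (axis i0 1) * (indicator C c * ennreal ((1 / sqrt (1 + (norm c)\<^sup>2)) ^ CARD('n)) *
      (\<integral>\<^sup>+r. indicator D r * ennreal (sqrt ((norm r)\<^sup>2 + (r \<bullet> c)\<^sup>2) * exp (- ((norm r)\<^sup>2 + (r \<bullet> c)\<^sup>2) / 2)) \<partial>lborel)) \<partial>lborel)"
    by (subst nn_integral_det_shear, simp) (simp add: mult_ac)
  also have "\<dots> = cofactor_integral i0 (axis i0 1) * (\<integral>\<^sup>+c. indicator C c * ennreal ((1 / sqrt (1 + (norm c)\<^sup>2)) ^ CARD('n)) *
      (\<integral>\<^sup>+r. indicator D r * ennreal (sqrt ((norm r)\<^sup>2 + (r \<bullet> c)\<^sup>2) * exp (- ((norm r)\<^sup>2 + (r \<bullet> c)\<^sup>2) / 2)) \<partial>lborel) \<partial>lborel)"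
    by (rule nn_integral_cmult) measurable
  finally show ?thesis .
qed

section \<open>Normalising constants\<close>

text \<open>For \<open>p \<ge> 1\<close> this is the integral of
  \<open>r^(p - 1) * exp (- r^2 / 2)\<close> over \<open>r > 0\<close>.\<close>

definition gauss_moment :: "nat \<Rightarrow> real" where
  "gauss_moment p = 2 powr (p / 2 - 1) * Gamma (p / 2)"

lemma gauss_moment_pos: "p \<ge> 1 \<Longrightarrow> gauss_moment p > 0"
  by (simp add: gauss_moment_def Gamma_real_pos)

text \<open>Read from right to left, this replaces a power of \<open>1 / sqrt k\<close> by an
  integral over an additional scaling variable, with \<open>k\<close> occurring linearly in an
  exponent.\<close>

lemma radial_integral_scaled_Gauss:
  assumes "p \<ge> 1" "k > 0"
  shows "radial_integral p (\<lambda>r. ennreal (exp (- r\<^sup>2 * k / 2))) = ennreal ((1 / sqrt k) ^ p) * ennreal (gauss_moment p)"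
proof -
  have "radial_integral p (\<lambda>r. ennreal (exp (- r\<^sup>2 * k / 2))) =
    ennreal ((1 / sqrt k) ^ p) * radial_integral p (\<lambda>r. ennreal (exp (- (1 / sqrt k * r)\<^sup>2 * k / 2)))"
    by (rule radial_integral_scale) (use assms in auto)
  also have "(\<lambda>r. ennreal (exp (- (1 / sqrt k * r)\<^sup>2 * k / 2))) = (\<lambda>r. ennreal (exp (- r\<^sup>2 / 2)))"
    using assms by (auto simp: power_mult_distrib power_divide)
  also have "radial_integral p \<dots> = ennreal (gauss_moment p)"
    using radial_integral_Gauss[OF assms(1)] by (simp only: gauss_moment_def)
  finally show ?thesis .
qed

text \<open>The factor \<open>sqrt (H r)\<close> is removed by homogeneity: it has degree one, so an
  integral over a cone of a function of it is a constant of the cone times a radial integral. An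
  extra factor \<open>r\<close> in the radial integral raises the index of the moment by
  one.\<close>

lemma nn_integral_cone_sqrt_quadratic:
  fixes c :: "real ^ 'n" and D :: "(real ^ 'n) set"
  assumes [measurable]: "D \<in> sets borel" and cone: "\<And>t x. t > 0 \<Longrightarrow> t *\<^sub>R x \<in> D \<longleftrightarrow> x \<in> D"
  defines "H \<equiv> \<lambda>r. (norm r)\<^sup>2 + (r \<bullet> c)\<^sup>2"
  shows "(\<integral>\<^sup>+r. indicator D r * ennreal (sqrt (H r) * exp (- H r / 2)) \<partial>lborel) * ennreal (gauss_moment CARD('n)) =
    (\<integral>\<^sup>+r. indicator D r * ennreal (exp (- H r / 2)) \<partial>lborel) * ennreal (gauss_moment (CARD('n) + 1))"
proof -
  have [measurable]: "H \<in> borel_measurable borel" unfolding H_def by measurable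
  have H0: "H r \<ge> 0" for r by (simp add: H_def)
  have Hpos: "H r > 0" if "r \<noteq> 0" for r using that by (simp add: H_def add_pos_nonneg)
  \<comment> \<open>The origin is taken out because \<open>radial_integral_swap\<close> asks for a
    positive \<open>q\<close> on the whole cone.\<close>
  let ?D = "D - {0}"
  have del: "(\<integral>\<^sup>+r. indicator D r * f r \<partial>lborel) = (\<integral>\<^sup>+r. indicator ?D r * f r \<partial>lborel)" for f
    by (rule nn_integral_cong_AE, rule AE_mp[OF AE_lborel_singleton[of 0]]) (auto simp: indicator_def)
  have "(\<integral>\<^sup>+r. indicator ?D r * ennreal (sqrt (H r) * exp (- (sqrt (H r))\<^sup>2 / 2)) \<partial>lborel) *
      radial_integral DIM(real^'n) (\<lambda>r. ennreal (exp (- r\<^sup>2 / 2))) =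
    (\<integral>\<^sup>+r. indicator ?D r * ennreal (exp (- (sqrt (H r))\<^sup>2 / 2)) \<partial>lborel) *
      radial_integral DIM(real^'n) (\<lambda>r. ennreal (r * exp (- r\<^sup>2 / 2)))"
  proof (rule radial_integral_swap)
    show "t *\<^sub>R x \<in> ?D \<longleftrightarrow> x \<in> ?D" if "t > 0" for t x using that cone by auto
    show "sqrt (H (t *\<^sub>R x)) = t * sqrt (H x)" if "t > 0" for t x
    proof -
      have "H (t *\<^sub>R x) = t\<^sup>2 * H x" by (simp add: H_def power_mult_distrib algebra_simps)
      with that show ?thesis by (simp add: real_sqrt_mult)
    qed
    show "sqrt (H x) > 0" if "x \<in> ?D" for x using that Hpos by simp
  qed measurable
  moreover have "radial_integral DIM(real^'n) (\<lambda>r. ennreal (exp (- r\<^sup>2 / 2))) = ennreal (gauss_moment CARD('n))"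
    using radial_integral_scaled_Gauss[of "CARD('n)" 1] by (simp add: Suc_leI)
  moreover have "radial_integral DIM(real^'n) (\<lambda>r. ennreal (r * exp (- r\<^sup>2 / 2))) = ennreal (gauss_moment (CARD('n) + 1))"
  proof -
    have "radial_integral DIM(real^'n) (\<lambda>r. ennreal (r * exp (- r\<^sup>2 / 2))) =
        radial_integral (CARD('n) + 1) (\<lambda>r. ennreal (exp (- r\<^sup>2 * 1 / 2)))"
      unfolding radial_integral_def
      by (intro nn_integral_cong) (simp add: ennreal_mult[symmetric] exp_add[symmetric] algebra_simps)
    then show ?thesis using radial_integral_scaled_Gauss[of "CARD('n) + 1" 1] by simp
  qed
  ultimately show ?thesis unfolding del by (simp only: real_sqrt_pow2[OF H0])
qed

lemma nn_integral_shear_gauss: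
  fixes c :: "real ^ 'n"
  shows "(\<integral>\<^sup>+r. ennreal (exp (- ((norm r)\<^sup>2 + (r \<bullet> c)\<^sup>2) / 2)) \<partial>lborel) =
    ennreal (1 / sqrt (1 + (norm c)\<^sup>2)) * ennreal (sqrt (2 * pi) ^ CARD('n))"
proof -
  obtain A :: "real^'n^'n" where A: "\<And>r. (norm (A *v r))\<^sup>2 = (norm r)\<^sup>2 + (r \<bullet> c)\<^sup>2"
    and dA: "\<bar>det A\<bar> = sqrt (1 + (norm c)\<^sup>2)" using shear_matrix_exists by blast
  have p: "sqrt (1 + (norm c)\<^sup>2) > 0" by (simp add: add_pos_nonneg)
  then have "det A \<noteq> 0" using dA by auto
  then have "(\<integral>\<^sup>+r. ennreal (gauss (r :: real^'n)) \<partial>lborel) = ennreal \<bar>det A\<bar> * (\<integral>\<^sup>+r. ennreal (gauss (A *v r)) \<partial>lborel)"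
    by (rule nn_integral_matrix_vector_mult) measurable
  then have "ennreal (sqrt (2 * pi) ^ CARD('n)) = ennreal (sqrt (1 + (norm c)\<^sup>2)) * (\<integral>\<^sup>+r. ennreal (exp (- ((norm r)\<^sup>2 + (r \<bullet> c)\<^sup>2) / 2)) \<partial>lborel)"
    unfolding nn_integral_gauss_vec dA by (simp only: gauss_def A)
  then have "ennreal (1 / sqrt (1 + (norm c)\<^sup>2)) * ennreal (sqrt (2 * pi) ^ CARD('n)) =
    (ennreal (1 / sqrt (1 + (norm c)\<^sup>2)) * ennreal (sqrt (1 + (norm c)\<^sup>2))) * (\<integral>\<^sup>+r. ennreal (exp (- ((norm r)\<^sup>2 + (r \<bullet> c)\<^sup>2) / 2)) \<partial>lborel)"
    by (simp only: mult.assoc)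
  also have "ennreal (1 / sqrt (1 + (norm c)\<^sup>2)) * ennreal (sqrt (1 + (norm c)\<^sup>2)) = 1"
    using p by (subst ennreal_mult[symmetric]) auto
  finally show ?thesis by simp
qed

text \<open>The integrand is the unnormalised density of the multivariate Cauchy law. As a Gaussian
  mixture over the scale \<open>exp t\<close> it can be integrated over \<open>c\<close> inside,
  which leaves a radial integral of index 1.\<close>

lemma nn_integral_Cauchy_vec:
  "(\<integral>\<^sup>+c. ennreal ((1 / sqrt (1 + (norm c)\<^sup>2)) ^ (CARD('n) + 1)) \<partial>(lborel :: (real^'n) measure)) * ennreal (gauss_moment (CARD('n) + 1)) =
    ennreal (sqrt (2 * pi) ^ CARD('n)) * ennreal (gauss_moment 1)"
proof -
  let ?m = "CARD('n)"
  have "(\<integral>\<^sup>+c. ennreal ((1 / sqrt (1 + (norm c)\<^sup>2)) ^ (?m + 1)) \<partial>(lborel :: (real^'n) measure)) * ennreal (gauss_moment (?m + 1)) =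
    (\<integral>\<^sup>+c. radial_integral (?m + 1) (\<lambda>r. ennreal (exp (- r\<^sup>2 * (1 + (norm c)\<^sup>2) / 2))) \<partial>(lborel :: (real^'n) measure))"
    by (subst radial_integral_scaled_Gauss) (auto simp: add_pos_nonneg nn_integral_multc)
  also have "\<dots> = (\<integral>\<^sup>+t. \<integral>\<^sup>+c. ennreal (exp (real (?m + 1) * t)) * ennreal (exp (- (exp t)\<^sup>2 * (1 + (norm c)\<^sup>2) / 2)) \<partial>(lborel :: (real^'n) measure) \<partial>lborel)"
    unfolding radial_integral_def by (rule lborel_pair.Fubini') measurable
  also have "\<dots> = (\<integral>\<^sup>+t. ennreal (sqrt (2 * pi) ^ ?m) * (ennreal (exp (real 1 * t)) * ennreal (exp (- (exp t)\<^sup>2 / 2))) \<partial>lborel)"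
  proof (rule nn_integral_cong)
    fix t :: real
    have "ennreal (sqrt (2 * pi) ^ ?m) = (\<integral>\<^sup>+c. ennreal (gauss c) \<partial>(lborel :: (real^'n) measure))"
      by (simp only: nn_integral_gauss_vec)
    also have "\<dots> = ennreal (\<bar>exp t\<bar> ^ ?m) * (\<integral>\<^sup>+c. ennreal (gauss (exp t *\<^sub>R c)) \<partial>(lborel :: (real^'n) measure))"
      by (subst nn_integral_scaleR[where c="exp t"]) auto
    finally have "ennreal (sqrt (2 * pi) ^ ?m) * (ennreal (exp (real 1 * t)) * ennreal (exp (- (exp t)\<^sup>2 / 2))) =
      (ennreal (exp (real 1 * t)) * ennreal (\<bar>exp t\<bar> ^ ?m) * ennreal (exp (- (exp t)\<^sup>2 / 2))) *
      (\<integral>\<^sup>+c. ennreal (gauss (exp t *\<^sub>R c)) \<partial>(lborel :: (real^'n) measure))" by (simp only: mult_ac)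
    also have "\<dots> = (\<integral>\<^sup>+c. (ennreal (exp (real 1 * t)) * ennreal (\<bar>exp t\<bar> ^ ?m) * ennreal (exp (- (exp t)\<^sup>2 / 2))) *
       ennreal (gauss (exp t *\<^sub>R c)) \<partial>(lborel :: (real^'n) measure))"
      by (rule nn_integral_cmult[symmetric]) measurable
    also have "\<dots> = (\<integral>\<^sup>+c. ennreal (exp (real (?m + 1) * t)) * ennreal (exp (- (exp t)\<^sup>2 * (1 + (norm c)\<^sup>2) / 2)) \<partial>(lborel :: (real^'n) measure))"
      by (intro nn_integral_cong)
         (simp add: gauss_def ennreal_mult[symmetric] exp_of_nat_mult[symmetric] exp_add[symmetric] power_mult_distrib algebra_simps add_divide_distrib diff_divide_distrib)
    finally show "(\<integral>\<^sup>+c. ennreal (exp (real (?m + 1) * t)) * ennreal (exp (- (exp t)\<^sup>2 * (1 + (norm c)\<^sup>2) / 2)) \<partial>(lborel :: (real^'n) measure)) =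
      ennreal (sqrt (2 * pi) ^ ?m) * (ennreal (exp (real 1 * t)) * ennreal (exp (- (exp t)\<^sup>2 / 2)))" by simp
  qed
  also have "\<dots> = ennreal (sqrt (2 * pi) ^ ?m) * radial_integral 1 (\<lambda>r. ennreal (exp (- r\<^sup>2 * 1 / 2)))"
    unfolding radial_integral_def by (subst nn_integral_cmult) auto
  also have "\<dots> = ennreal (sqrt (2 * pi) ^ ?m) * ennreal (gauss_moment 1)"
    by (subst radial_integral_scaled_Gauss) auto
  finally show ?thesis .
qed

section \<open>Integrals over orthants\<close>

lemma nn_integral_swap3:
  fixes F :: "real \<Rightarrow> 'a::euclidean_space \<Rightarrow> 'b::euclidean_space \<Rightarrow> ennreal"
  assumes [measurable]: "(\<lambda>(t, x, y). F t x y) \<in> borel_measurable (lborel \<Otimes>\<^sub>M lborel \<Otimes>\<^sub>M lborel)"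
  shows "(\<integral>\<^sup>+x. \<integral>\<^sup>+y. \<integral>\<^sup>+t. F t x y \<partial>lborel \<partial>lborel \<partial>lborel) = (\<integral>\<^sup>+t. \<integral>\<^sup>+x. \<integral>\<^sup>+y. F t x y \<partial>lborel \<partial>lborel \<partial>lborel)"
proof -
  have [measurable]: "(\<lambda>(y, t). F t x y) \<in> borel_measurable (lborel \<Otimes>\<^sub>M lborel)" for x
    using measurable_compose[OF _ assms, of "\<lambda>(y, t). (t, x, y)" "lborel \<Otimes>\<^sub>M lborel"]
    by (simp add: case_prod_beta')
  have [measurable]: "(\<lambda>(x, t). \<integral>\<^sup>+y. F t x y \<partial>lborel) \<in> borel_measurable (lborel \<Otimes>\<^sub>M lborel)"
  proof -
    have "(\<lambda>(p, y). F (snd p) (fst p) y) \<in> borel_measurable ((lborel \<Otimes>\<^sub>M lborel) \<Otimes>\<^sub>M lborel)"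
      using measurable_compose[OF _ assms, of "\<lambda>(p, y). (snd p, fst p, y)" "(lborel \<Otimes>\<^sub>M lborel) \<Otimes>\<^sub>M lborel"]
      by (simp add: case_prod_beta')
    from lborel.borel_measurable_nn_integral[OF this] show ?thesis by (simp only: case_prod_beta')
  qed
  have "(\<integral>\<^sup>+x. \<integral>\<^sup>+y. \<integral>\<^sup>+t. F t x y \<partial>lborel \<partial>lborel \<partial>lborel) = (\<integral>\<^sup>+x. \<integral>\<^sup>+t. \<integral>\<^sup>+y. F t x y \<partial>lborel \<partial>lborel \<partial>lborel)"
    by (intro nn_integral_cong lborel_pair.Fubini') measurable
  also have "\<dots> = (\<integral>\<^sup>+t. \<integral>\<^sup>+x. \<integral>\<^sup>+y. F t x y \<partial>lborel \<partial>lborel \<partial>lborel)"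
    by (rule lborel_pair.Fubini') measurable
  finally show ?thesis .
qed

text \<open>The quadratic polynomial has the roots \<open>- exp y\<close> and
  \<open>- exp (- y)\<close>; partial fractions give a logarithmic antiderivative that vanishes at
  infinity and equals \<open>- y / sinh y\<close> at 0.\<close>

lemma nn_integral_inverse_quadratic:
  fixes y :: real assumes y: "y > 0"
  shows "(\<integral>\<^sup>+v. ennreal (1 / (1 + v\<^sup>2 + 2 * v * cosh y)) * indicator {0..} v \<partial>lborel) = ennreal (y / sinh y)"
proof -
  have s: "sinh y > 0" using y by simp
  have q: "1 + v\<^sup>2 + 2 * v * cosh y = (v + exp (-y)) * (v + exp y)" for v
    by (simp add: cosh_def power2_eq_square algebra_simps exp_minus)
  let ?F = "\<lambda>v. (ln (v + exp (-y)) - ln (v + exp y)) / (2 * sinh y)"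
  have "(\<integral>\<^sup>+v. ennreal (1 / (1 + v\<^sup>2 + 2 * v * cosh y)) * indicator {0..} v \<partial>lborel) = ennreal (0 - ?F 0)"
  proof (rule nn_integral_FTC_atLeast)
    fix v :: real assume v: "0 \<le> v"
    have p: "v + exp (-y) > 0" "v + exp y > 0" using v by (simp_all add: add_nonneg_pos)
    have d: "2 * sinh y = exp y - exp (-y)" by (simp add: sinh_def)
    have "((\<lambda>v. ln (v + exp (-y)) - ln (v + exp y)) has_real_derivative (1 / (v + exp (-y)) - 1 / (v + exp y))) (at v)"
      using p by (auto intro!: derivative_eq_intros)
    then have "(?F has_real_derivative (1 / (v + exp (-y)) - 1 / (v + exp y)) / (2 * sinh y)) (at v)"
      by (rule DERIV_cdivide)
    also have "(1 / (v + exp (-y)) - 1 / (v + exp y)) / (2 * sinh y) = 1 / (1 + v\<^sup>2 + 2 * v * cosh y)"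
    proof -
      have "1 / (v + exp (-y)) - 1 / (v + exp y) = (2 * sinh y) / ((v + exp (-y)) * (v + exp y))"
        unfolding d using p by (simp add: field_simps)
      then show ?thesis unfolding q using s by simp
    qed
    finally show "(?F has_real_derivative 1 / (1 + v\<^sup>2 + 2 * v * cosh y)) (at v)" .
    show "0 \<le> 1 / (1 + v\<^sup>2 + 2 * v * cosh y)" unfolding q using p by simp
  next
    have "((\<lambda>v. ln (v + exp (-y)) - ln (v + exp y)) \<longlongrightarrow> 0) at_top" by real_asymp
    from tendsto_divide[OF this tendsto_const, of "2 * sinh y"] s show "(?F \<longlongrightarrow> 0) at_top" by simp
  qed measurable
  also have "0 - ?F 0 = y / sinh y" by simp
  finally show ?thesis .
qed

text \<open>In the variables \<open>a\<close> and \<open>v = b / a\<close> the exponent is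
  \<open>- a^2 * q v / 2\<close>, and the Jacobian \<open>a\<close> makes the integral over
  \<open>a\<close> elementary, with value \<open>1 / q v\<close>.\<close>

lemma nn_integral_quadrant:
  fixes y :: real assumes y: "y > 0"
  shows "(\<integral>\<^sup>+a. \<integral>\<^sup>+b. indicator {0<..} a * indicator {0<..} b * ennreal (exp (- (a\<^sup>2 + b\<^sup>2) / 2 - a * b * cosh y)) \<partial>lborel \<partial>lborel)
    = ennreal (y / sinh y)"
proof -
  define q where "q v = 1 + v\<^sup>2 + 2 * v * cosh y" for v
  have qp: "q v > 0" if "v > 0" for v using that unfolding q_def by (intro add_pos_nonneg) auto
  have [measurable]: "q \<in> borel_measurable borel" unfolding q_def by measurable
  have "(\<integral>\<^sup>+a. \<integral>\<^sup>+b. indicator {0<..} a * indicator {0<..} b * ennreal (exp (- (a\<^sup>2 + b\<^sup>2) / 2 - a * b * cosh y)) \<partial>lborel \<partial>lborel) =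
    (\<integral>\<^sup>+a. \<integral>\<^sup>+v. indicator {0<..} v * (ennreal (a * exp (- a\<^sup>2 * q v / 2)) * indicator {0<..} a) \<partial>lborel \<partial>lborel)"
  proof (rule nn_integral_cong)
    fix a :: real
    show "(\<integral>\<^sup>+b. indicator {0<..} a * indicator {0<..} b * ennreal (exp (- (a\<^sup>2 + b\<^sup>2) / 2 - a * b * cosh y)) \<partial>lborel) =
      (\<integral>\<^sup>+v. indicator {0<..} v * (ennreal (a * exp (- a\<^sup>2 * q v / 2)) * indicator {0<..} a) \<partial>lborel)"
    proof (cases "a > 0")
      case a: True
      have "(\<integral>\<^sup>+b. indicator {0<..} a * indicator {0<..} b * ennreal (exp (- (a\<^sup>2 + b\<^sup>2) / 2 - a * b * cosh y)) \<partial>lborel) =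
        ennreal \<bar>a\<bar> * (\<integral>\<^sup>+v. indicator {0<..} a * indicator {0<..} (0 + a * v) * ennreal (exp (- (a\<^sup>2 + (0 + a * v)\<^sup>2) / 2 - a * (0 + a * v) * cosh y)) \<partial>lborel)"
        by (rule nn_integral_real_affine) (use a in auto)
      also have "\<dots> = (\<integral>\<^sup>+v. ennreal \<bar>a\<bar> * (indicator {0<..} a * indicator {0<..} (0 + a * v) * ennreal (exp (- (a\<^sup>2 + (0 + a * v)\<^sup>2) / 2 - a * (0 + a * v) * cosh y))) \<partial>lborel)"
        by (rule nn_integral_cmult[symmetric]) measurable
      also have "\<dots> = (\<integral>\<^sup>+v. indicator {0<..} v * (ennreal (a * exp (- a\<^sup>2 * q v / 2)) * indicator {0<..} a) \<partial>lborel)"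
      proof (rule nn_integral_cong)
        fix v
        have "- (a\<^sup>2 + (0 + a * v)\<^sup>2) / 2 - a * (0 + a * v) * cosh y = - a\<^sup>2 * q v / 2"
          by (simp add: q_def power2_eq_square algebra_simps add_divide_distrib diff_divide_distrib)
        then show "ennreal \<bar>a\<bar> * (indicator {0<..} a * indicator {0<..} (0 + a * v) * ennreal (exp (- (a\<^sup>2 + (0 + a * v)\<^sup>2) / 2 - a * (0 + a * v) * cosh y))) =
          indicator {0<..} v * (ennreal (a * exp (- a\<^sup>2 * q v / 2)) * indicator {0<..} a)"
          using a by (simp add: indicator_def ennreal_mult zero_less_mult_iff)
      qed
      finally show ?thesis .
    qed simp
  qed
  also have "\<dots> = (\<integral>\<^sup>+v. \<integral>\<^sup>+a. indicator {0<..} v * (ennreal (a * exp (- a\<^sup>2 * q v / 2)) * indicator {0<..} a) \<partial>lborel \<partial>lborel)"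
    by (rule lborel_pair.Fubini') measurable
  also have "\<dots> = (\<integral>\<^sup>+v. ennreal (1 / (1 + v\<^sup>2 + 2 * v * cosh y)) * indicator {0..} v \<partial>lborel)"
  proof (rule nn_integral_cong_AE, rule AE_mp[OF AE_lborel_singleton[of "0::real"]], rule AE_I2, rule impI)
    fix v :: real assume "v \<noteq> 0"
    show "(\<integral>\<^sup>+a. indicator {0<..} v * (ennreal (a * exp (- a\<^sup>2 * q v / 2)) * indicator {0<..} a) \<partial>lborel) =
      ennreal (1 / (1 + v\<^sup>2 + 2 * v * cosh y)) * indicator {0..} v"
    proof (cases "v > 0")
      case v: True
      have "(\<integral>\<^sup>+a. indicator {0<..} v * (ennreal (a * exp (- a\<^sup>2 * q v / 2)) * indicator {0<..} a) \<partial>lborel) =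
        (\<integral>\<^sup>+a. ennreal (a * exp (- a\<^sup>2 * q v / 2)) * indicator {0..} a \<partial>lborel)"
        by (rule nn_integral_cong) (use v in \<open>auto simp: indicator_def\<close>)
      also have "\<dots> = ennreal (0 - (- exp (- 0\<^sup>2 * q v / 2) / q v))"
      proof (rule nn_integral_FTC_atLeast)
        have "((\<lambda>x. - exp (- x\<^sup>2 * k / 2) / k) \<longlongrightarrow> 0) at_top" if "k > 0" for k :: real
          using that by real_asymp
        from this[OF qp[OF v]] show "((\<lambda>x. - exp (- x\<^sup>2 * q v / 2) / q v) \<longlongrightarrow> 0) at_top" .
      qed (use qp[OF v] in \<open>auto intro!: derivative_eq_intros\<close>)
      finally show ?thesis using v by (simp add: q_def)
    next
      case False
      with \<open>v \<noteq> 0\<close> show ?thesis by simp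
    qed
  qed
  also have "\<dots> = ennreal (y / sinh y)" by (rule nn_integral_inverse_quadratic[OF y])
  finally show ?thesis .
qed

lemma borel_measurable_cosh [measurable (raw)]:
  fixes f :: "'a \<Rightarrow> real"
  assumes [measurable]: "f \<in> borel_measurable M"
  shows "(\<lambda>x. cosh (f x)) \<in> borel_measurable M"
  unfolding cosh_def by measurable

abbreviation orthant :: "(real ^ 'n) set" where
  "orthant \<equiv> {x. \<forall>k. x $ k > 0}"

lemma indicator_orthant: "indicator orthant x = (\<Prod>k\<in>UNIV. indicator {0<..} (x $ k) :: ennreal)"
  for x :: "real ^ 'n"
  by (auto simp: indicator_def prod_eq_1_iff intro!: prod_zero[symmetric])

lemma nn_integral_quadrant_vec:
  fixes C :: real
  shows "(\<integral>\<^sup>+c. \<integral>\<^sup>+r. indicator orthant c * indicator orthant r * ennreal (exp (- ((norm c)\<^sup>2 + (norm r)\<^sup>2) / 2 - (r \<bullet> c) * C)) \<partial>(lborel :: (real^'n) measure) \<partial>(lborel :: (real^'n) measure))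
   = (\<integral>\<^sup>+a. \<integral>\<^sup>+b. indicator {0<..} a * indicator {0<..} b * ennreal (exp (- (a\<^sup>2 + b\<^sup>2) / 2 - a * b * C)) \<partial>lborel \<partial>lborel) ^ CARD('n)"
proof -
  let ?f = "\<lambda>a b. indicator {0<..} a * indicator {0<..} b * ennreal (exp (- (a\<^sup>2 + b\<^sup>2) / 2 - a * b * C))"
  have f: "indicator orthant c * indicator orthant r * ennreal (exp (- ((norm c)\<^sup>2 + (norm r)\<^sup>2) / 2 - (r \<bullet> c) * C)) =
      (\<Prod>k\<in>UNIV. ?f (c $ k) (r $ k))" for c r :: "real^'n"
  proof -
    have "- ((norm c)\<^sup>2 + (norm r)\<^sup>2) / 2 - (r \<bullet> c) * C = (\<Sum>k\<in>UNIV. - ((c $ k)\<^sup>2 + (r $ k)\<^sup>2) / 2 - c $ k * r $ k * C)"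
    proof -
      have "(r \<bullet> c) * C = (\<Sum>k\<in>UNIV. c $ k * r $ k * C)"
        by (simp add: inner_vec_def sum_distrib_left mult_ac)
      then show ?thesis
        unfolding power2_norm_vec[of c] power2_norm_vec[of r]
        by (simp add: sum_subtractf sum_negf sum.distrib sum_divide_distrib[symmetric])
    qed
    then show ?thesis
      by (simp only: indicator_orthant exp_sum[OF finite_class.finite_UNIV] prod.distrib) (simp add: prod_ennreal)
  qed
  have "(\<integral>\<^sup>+c. \<integral>\<^sup>+r. (\<Prod>k\<in>UNIV. ?f (c $ k) (r $ k)) \<partial>(lborel :: (real^'n) measure) \<partial>(lborel :: (real^'n) measure)) =
    (\<integral>\<^sup>+c. (\<Prod>k\<in>UNIV. \<integral>\<^sup>+b. ?f (c $ k) b \<partial>lborel) \<partial>(lborel :: (real^'n) measure))"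
    by (intro nn_integral_cong nn_integral_lborel_vec_prod) measurable
  also have "\<dots> = (\<Prod>k\<in>(UNIV::'n set). \<integral>\<^sup>+a. \<integral>\<^sup>+b. ?f a b \<partial>lborel \<partial>lborel)"
    by (rule nn_integral_lborel_vec_prod) measurable
  finally show ?thesis unfolding f by simp
qed

text \<open>Folding the line doubles the integral, and the scaling by 2 halves it.\<close>

lemma nn_integral_even_scale:
  fixes g :: "real \<Rightarrow> ennreal"
  assumes [measurable]: "g \<in> borel_measurable borel"
  shows "(\<integral>\<^sup>+t. g \<bar>2 * t\<bar> \<partial>lborel) = (\<integral>\<^sup>+y. indicator {0<..} y * g y \<partial>lborel)"
proof -
  define I where "I = (\<integral>\<^sup>+y. indicator {0<..} y * g y \<partial>lborel)"
  have half: "(\<integral>\<^sup>+t. indicator {0<..} t * g (2 * t) \<partial>lborel) = ennreal (1 / 2) * I"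
    unfolding I_def
    by (subst nn_integral_real_affine[where c="1/2" and t=0])
       (auto intro!: arg_cong2[where f="(*)"] nn_integral_cong simp: indicator_def)
  have "(\<integral>\<^sup>+t. g \<bar>2 * t\<bar> \<partial>lborel) = (\<integral>\<^sup>+t. indicator {0<..} t * g (2 * t) + indicator {0<..} (- t) * g (2 * (- t)) \<partial>lborel)"
    by (rule nn_integral_cong_AE, rule AE_mp[OF AE_lborel_singleton[of "0::real"]])
       (auto simp: indicator_def abs_if)
  also have "\<dots> = (\<integral>\<^sup>+t. indicator {0<..} t * g (2 * t) \<partial>lborel) + (\<integral>\<^sup>+t. indicator {0<..} (- t) * g (2 * (- t)) \<partial>lborel)"
    by (rule nn_integral_add) measurable
  also have "(\<integral>\<^sup>+t. indicator {0<..} (- t) * g (2 * (- t)) \<partial>lborel) = (\<integral>\<^sup>+t. indicator {0<..} t * g (2 * t) \<partial>lborel)"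
    by (subst nn_integral_real_affine[where c="-1" and t=0]) auto
  also have "(\<integral>\<^sup>+t. indicator {0<..} t * g (2 * t) \<partial>lborel) + (\<integral>\<^sup>+t. indicator {0<..} t * g (2 * t) \<partial>lborel) = (ennreal (1 / 2) + ennreal (1 / 2)) * I"
    unfolding half by (simp only: distrib_right)
  also have "ennreal (1 / 2) + ennreal (1 / 2) = 1"
    by (subst ennreal_plus[symmetric]) auto
  finally show ?thesis by (simp add: I_def)
qed

text \<open>The substitution \<^term>\<open>exp t = sqrt a * exp s\<close> turns the exponent into
  \<open>a cosh (2 s)\<close>, which is linear in \<open>a\<close>; this is what makes the coordinates separate.\<close>

lemma nn_integral_Bessel_substitution:
  assumes a: "a > 0"
  shows "(\<integral>\<^sup>+t. ennreal (exp (- ((exp t)\<^sup>2 + (a / exp t)\<^sup>2) / 2)) \<partial>lborel) = (\<integral>\<^sup>+s. ennreal (exp (- a * cosh \<bar>2 * s\<bar>)) \<partial>lborel)"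
proof -
  have "(\<integral>\<^sup>+t. ennreal (exp (- ((exp t)\<^sup>2 + (a / exp t)\<^sup>2) / 2)) \<partial>lborel) =
    (\<integral>\<^sup>+s. ennreal (exp (- ((exp (s + ln a / 2))\<^sup>2 + (a / exp (s + ln a / 2))\<^sup>2) / 2)) \<partial>lborel)"
    by (rule nn_integral_translate[symmetric, where f="\<lambda>t. ennreal (exp (- ((exp t)\<^sup>2 + (a / exp t)\<^sup>2) / 2))"]) measurable
  also have "\<dots> = (\<integral>\<^sup>+s. ennreal (exp (- a * cosh \<bar>2 * s\<bar>)) \<partial>lborel)"
  proof (intro nn_integral_cong arg_cong[where f=ennreal] arg_cong[where f=exp])
    fix s :: real
    have e: "(exp (s + ln a / 2))\<^sup>2 = a * exp (2 * s)"
      by (simp only: exp_double[symmetric]) (use a in \<open>simp add: distrib_left exp_add\<close>)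
    have "(a / exp (s + ln a / 2))\<^sup>2 = a * exp (- (2 * s))"
      unfolding power_divide e using a by (simp add: power2_eq_square exp_minus field_simps)
    with e show "- ((exp (s + ln a / 2))\<^sup>2 + (a / exp (s + ln a / 2))\<^sup>2) / 2 = - a * cosh \<bar>2 * s\<bar>"
      by (simp add: cosh_def abs_if field_simps)
  qed
  finally show ?thesis .
qed

text \<open>The power of \<open>1 + (norm c)^2\<close> depends on the dimension, so it is exchanged
  for an integral over \<open>exp t\<close>. Scaling \<open>c\<close> by \<open>exp (- t)\<close>
  then absorbs the dimension and gives \<open>c\<close> and \<open>r\<close> the same Gaussian
  weight, coupled through \<open>r \<bullet> c\<close> only. For fixed \<open>c\<close> and
  \<open>r\<close> the integral over \<open>t\<close> is of Bessel type.\<close>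

lemma nn_integral_orthants:
  "(\<integral>\<^sup>+c. indicator orthant c * (ennreal ((1 / sqrt (1 + (norm c)\<^sup>2)) ^ CARD('n)) * ennreal (gauss_moment CARD('n))) *
      (\<integral>\<^sup>+r. indicator orthant r * ennreal (exp (- ((norm r)\<^sup>2 + (r \<bullet> c)\<^sup>2) / 2)) \<partial>lborel) \<partial>(lborel :: (real^'n) measure)) =
   (\<integral>\<^sup>+y. indicator {0<..} y * ennreal ((y / sinh y) ^ CARD('n)) \<partial>lborel)"
proof -
  let ?m = "CARD('n)"
  let ?L = "lborel :: (real^'n) measure"
  have m: "?m \<ge> 1" by (simp add: Suc_leI)
  define ind where "ind c = (indicator orthant c :: ennreal)" for c :: "real^'n"
  have [measurable]: "ind \<in> borel_measurable borel" unfolding ind_def by measurable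
  \<comment> \<open>\<open>F\<close>, \<open>G\<close> and \<open>K\<close> are the successive
    integrands: \<open>F\<close> contains the new scaling variable, \<open>G\<close> arises from it
    by scaling \<open>c\<close>, and \<open>K\<close> has the same integral over \<open>t\<close> as
    \<open>G\<close>.\<close>
  define F where "F t c r = ind c * ind r * (ennreal (exp (real ?m * t)) *
      ennreal (exp (- ((exp t)\<^sup>2 * (1 + (norm c)\<^sup>2) + (norm r)\<^sup>2 + (r \<bullet> c)\<^sup>2) / 2)))" for t and c r :: "real^'n"
  have [measurable]: "(\<lambda>(t, c, r). F t c r) \<in> borel_measurable (lborel \<Otimes>\<^sub>M lborel \<Otimes>\<^sub>M lborel)"
    unfolding F_def by measurable
  define G where "G t c r = ind c * ind r *
      ennreal (exp (- ((norm c)\<^sup>2 + (norm r)\<^sup>2) / 2)) * ennreal (exp (- ((exp t)\<^sup>2 + ((r \<bullet> c) / exp t)\<^sup>2) / 2))" for t and c r :: "real^'n"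
  have [measurable]: "(\<lambda>(t, c, r). G t c r) \<in> borel_measurable (lborel \<Otimes>\<^sub>M lborel \<Otimes>\<^sub>M lborel)"
    unfolding G_def by measurable
  define K where "K t c r = ind c * ind r *
      ennreal (exp (- ((norm c)\<^sup>2 + (norm r)\<^sup>2) / 2)) * ennreal (exp (- (r \<bullet> c) * cosh \<bar>2 * t\<bar>))" for t and c r :: "real^'n"
  have [measurable]: "(\<lambda>(t, c, r). K t c r) \<in> borel_measurable (lborel \<Otimes>\<^sub>M lborel \<Otimes>\<^sub>M lborel)"
    unfolding K_def by measurable
  have "(\<integral>\<^sup>+c. ind c * (ennreal ((1 / sqrt (1 + (norm c)\<^sup>2)) ^ ?m) * ennreal (gauss_moment ?m)) *
      (\<integral>\<^sup>+r. ind r * ennreal (exp (- ((norm r)\<^sup>2 + (r \<bullet> c)\<^sup>2) / 2)) \<partial>lborel) \<partial>?L) =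
    (\<integral>\<^sup>+c. \<integral>\<^sup>+r. \<integral>\<^sup>+t. F t c r \<partial>lborel \<partial>lborel \<partial>?L)"
  proof (rule nn_integral_cong)
    fix c :: "real^'n"
    let ?R = "radial_integral ?m (\<lambda>r. ennreal (exp (- r\<^sup>2 * (1 + (norm c)\<^sup>2) / 2)))"
    have "ind c * (ennreal ((1 / sqrt (1 + (norm c)\<^sup>2)) ^ ?m) * ennreal (gauss_moment ?m)) *
      (\<integral>\<^sup>+r. ind r * ennreal (exp (- ((norm r)\<^sup>2 + (r \<bullet> c)\<^sup>2) / 2)) \<partial>lborel) =
      (\<integral>\<^sup>+r. ind c * ?R * (ind r * ennreal (exp (- ((norm r)\<^sup>2 + (r \<bullet> c)\<^sup>2) / 2))) \<partial>lborel)"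
      by (subst radial_integral_scaled_Gauss) (use m in \<open>auto simp: add_pos_nonneg nn_integral_cmult\<close>)
    also have "\<dots> = (\<integral>\<^sup>+r. \<integral>\<^sup>+t. F t c r \<partial>lborel \<partial>lborel)"
    proof (rule nn_integral_cong)
      fix r :: "real^'n"
      have "(\<integral>\<^sup>+t. F t c r \<partial>lborel) = (\<integral>\<^sup>+t. (ind c * (ind r * ennreal (exp (- ((norm r)\<^sup>2 + (r \<bullet> c)\<^sup>2) / 2)))) *
         (ennreal (exp (real ?m * t)) * ennreal (exp (- (exp t)\<^sup>2 * (1 + (norm c)\<^sup>2) / 2))) \<partial>lborel)"
      proof (rule nn_integral_cong)
        fix t :: real
        have "exp (- ((exp t)\<^sup>2 * (1 + (norm c)\<^sup>2) + (norm r)\<^sup>2 + (r \<bullet> c)\<^sup>2) / 2) =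
           exp (- ((norm r)\<^sup>2 + (r \<bullet> c)\<^sup>2) / 2) * exp (- (exp t)\<^sup>2 * (1 + (norm c)\<^sup>2) / 2)"
          unfolding exp_add[symmetric] by (rule arg_cong[where f=exp]) (simp add: field_simps)
        then show "F t c r = (ind c * (ind r * ennreal (exp (- ((norm r)\<^sup>2 + (r \<bullet> c)\<^sup>2) / 2)))) *
         (ennreal (exp (real ?m * t)) * ennreal (exp (- (exp t)\<^sup>2 * (1 + (norm c)\<^sup>2) / 2)))"
          by (simp only: F_def) (simp add: ennreal_mult mult_ac)
      qed
      also have "\<dots> = (ind c * (ind r * ennreal (exp (- ((norm r)\<^sup>2 + (r \<bullet> c)\<^sup>2) / 2)))) * ?R"
        unfolding radial_integral_def by (rule nn_integral_cmult) measurable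
      finally show "ind c * ?R * (ind r * ennreal (exp (- ((norm r)\<^sup>2 + (r \<bullet> c)\<^sup>2) / 2))) = (\<integral>\<^sup>+t. F t c r \<partial>lborel)"
        by (simp only: mult_ac)
    qed
    finally show "ind c * (ennreal ((1 / sqrt (1 + (norm c)\<^sup>2)) ^ ?m) * ennreal (gauss_moment ?m)) *
      (\<integral>\<^sup>+r. ind r * ennreal (exp (- ((norm r)\<^sup>2 + (r \<bullet> c)\<^sup>2) / 2)) \<partial>lborel) = (\<integral>\<^sup>+r. \<integral>\<^sup>+t. F t c r \<partial>lborel \<partial>lborel)" .
  qed
  also have "\<dots> = (\<integral>\<^sup>+t. \<integral>\<^sup>+c. \<integral>\<^sup>+r. F t c r \<partial>lborel \<partial>?L \<partial>lborel)"
    by (rule nn_integral_swap3) measurable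
  also have "\<dots> = (\<integral>\<^sup>+t. \<integral>\<^sup>+c. \<integral>\<^sup>+r. G t c r \<partial>lborel \<partial>?L \<partial>lborel)"
  proof (rule nn_integral_cong)
    fix t :: real
    have sc: "ennreal (\<bar>exp (- t)\<bar> ^ ?m) * F t (exp (- t) *\<^sub>R c) r = G t c r" for c r
    proof -
      have o: "ind (exp (- t) *\<^sub>R c) = ind c"
        by (simp add: ind_def indicator_def zero_less_mult_iff)
      have "\<bar>exp (- t)\<bar> ^ ?m * (exp (real ?m * t) * exp (- ((exp t)\<^sup>2 * (1 + (norm (exp (- t) *\<^sub>R c))\<^sup>2) + (norm r)\<^sup>2 + (r \<bullet> (exp (- t) *\<^sub>R c))\<^sup>2) / 2)) =
        exp (- ((norm c)\<^sup>2 + (norm r)\<^sup>2) / 2) * exp (- ((exp t)\<^sup>2 + ((r \<bullet> c) / exp t)\<^sup>2) / 2)"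
      proof -
        have "\<bar>exp (- t)\<bar> ^ ?m * exp (real ?m * t) = 1"
          by (simp add: exp_of_nat_mult[symmetric] exp_add[symmetric])
        moreover have "- ((exp t)\<^sup>2 * (1 + (norm (exp (- t) *\<^sub>R c))\<^sup>2) + (norm r)\<^sup>2 + (r \<bullet> (exp (- t) *\<^sub>R c))\<^sup>2) / 2 =
           - ((norm c)\<^sup>2 + (norm r)\<^sup>2) / 2 + (- ((exp t)\<^sup>2 + ((r \<bullet> c) / exp t)\<^sup>2) / 2)"
        proof -
          have n: "(norm (exp (- t) *\<^sub>R c))\<^sup>2 = (norm c)\<^sup>2 / (exp t)\<^sup>2"
            by (simp add: exp_minus power_divide divide_inverse power_mult_distrib power_inverse)
          have i: "r \<bullet> (exp (- t) *\<^sub>R c) = (r \<bullet> c) / exp t"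
            by (simp add: exp_minus divide_inverse)
          have e: "(exp t)\<^sup>2 * (1 + (norm c)\<^sup>2 / (exp t)\<^sup>2) = (exp t)\<^sup>2 + (norm c)\<^sup>2"
            by (simp add: distrib_left)
          have "- (a + b + c' + d) / 2 = - (b + c') / 2 + (- (a + d) / 2)" for a b c' d :: real
            by (simp add: field_simps)
          then show ?thesis unfolding n i e .
        qed
        ultimately show ?thesis unfolding mult.assoc[symmetric] by (simp only: exp_add mult_1_left)
      qed
      then have "ennreal (\<bar>exp (- t)\<bar> ^ ?m) * (ennreal (exp (real ?m * t)) * ennreal (exp (- ((exp t)\<^sup>2 * (1 + (norm (exp (- t) *\<^sub>R c))\<^sup>2) + (norm r)\<^sup>2 + (r \<bullet> (exp (- t) *\<^sub>R c))\<^sup>2) / 2))) =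
        ennreal (exp (- ((norm c)\<^sup>2 + (norm r)\<^sup>2) / 2)) * ennreal (exp (- ((exp t)\<^sup>2 + ((r \<bullet> c) / exp t)\<^sup>2) / 2))"
        by (drule_tac arg_cong[where f=ennreal])
           (simp only: ennreal_mult zero_le_power abs_ge_zero exp_ge_zero mult_nonneg_nonneg)
      then show ?thesis unfolding F_def G_def o by (metis (no_types, lifting) mult.assoc mult.left_commute)
    qed
    have "(\<integral>\<^sup>+c. \<integral>\<^sup>+r. F t c r \<partial>lborel \<partial>?L) = ennreal (\<bar>exp (- t)\<bar> ^ DIM(real^'n)) * (\<integral>\<^sup>+c. \<integral>\<^sup>+r. F t (exp (- t) *\<^sub>R c) r \<partial>lborel \<partial>?L)"
      by (rule nn_integral_scaleR) auto
    also have "\<dots> = (\<integral>\<^sup>+c. \<integral>\<^sup>+r. G t c r \<partial>lborel \<partial>?L)"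
      by (subst nn_integral_cmult[symmetric], measurable, intro nn_integral_cong,
          subst nn_integral_cmult[symmetric], measurable, simp add: sc[simplified])
    finally show "(\<integral>\<^sup>+c. \<integral>\<^sup>+r. F t c r \<partial>lborel \<partial>?L) = (\<integral>\<^sup>+c. \<integral>\<^sup>+r. G t c r \<partial>lborel \<partial>?L)" .
  qed
  also have "\<dots> = (\<integral>\<^sup>+c. \<integral>\<^sup>+r. \<integral>\<^sup>+t. G t c r \<partial>lborel \<partial>lborel \<partial>?L)"
    by (rule nn_integral_swap3[symmetric]) measurable
  also have "\<dots> = (\<integral>\<^sup>+c. \<integral>\<^sup>+r. \<integral>\<^sup>+t. K t c r \<partial>lborel \<partial>lborel \<partial>?L)"
  proof (rule nn_integral_cong, rule nn_integral_cong)
    fix c r :: "real^'n"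
    show "(\<integral>\<^sup>+t. G t c r \<partial>lborel) = (\<integral>\<^sup>+t. K t c r \<partial>lborel)"
    proof (cases "c \<in> orthant \<and> r \<in> orthant")
      case True
      then have "r \<bullet> c > 0" by (auto simp: inner_vec_def intro!: sum_pos)
      from nn_integral_Bessel_substitution[OF this] show ?thesis
        unfolding G_def K_def by (subst (1 2) nn_integral_cmult) auto
    next
      case False
      then have "ind c * ind r = 0" by (auto simp: ind_def indicator_def)
      then have "G t c r = 0" "K t c r = 0" for t by (simp_all add: G_def K_def)
      then show ?thesis by simp
    qed
  qed
  also have "\<dots> = (\<integral>\<^sup>+t. \<integral>\<^sup>+c. \<integral>\<^sup>+r. K t c r \<partial>lborel \<partial>?L \<partial>lborel)"
    by (rule nn_integral_swap3) measurable
  also have "\<dots> = (\<integral>\<^sup>+t. ennreal ((\<bar>2 * t\<bar> / sinh \<bar>2 * t\<bar>) ^ ?m) \<partial>lborel)"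
  proof (rule nn_integral_cong_AE, rule AE_mp[OF AE_lborel_singleton[of "0::real"]], rule AE_I2, rule impI)
    fix t :: real assume "t \<noteq> 0"
    then have t: "\<bar>2 * t\<bar> > 0" by simp
    have "(\<integral>\<^sup>+c. \<integral>\<^sup>+r. K t c r \<partial>lborel \<partial>?L) = 
      (\<integral>\<^sup>+c. \<integral>\<^sup>+r. indicator orthant c * indicator orthant r * ennreal (exp (- ((norm c)\<^sup>2 + (norm r)\<^sup>2) / 2 - (r \<bullet> c) * cosh \<bar>2 * t\<bar>)) \<partial>?L \<partial>?L)"
    proof -
      have "ennreal (exp (x - z * w)) = ennreal (exp x) * ennreal (exp (- z * w))" for x z w :: real
        by (simp add: ennreal_mult[symmetric] exp_add[symmetric])
      then show ?thesis unfolding K_def ind_def by (simp only: mult.assoc)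
    qed
    also have "\<dots> = ennreal (\<bar>2 * t\<bar> / sinh \<bar>2 * t\<bar>) ^ ?m"
      unfolding nn_integral_quadrant_vec nn_integral_quadrant[OF t] ..
    also have "\<dots> = ennreal ((\<bar>2 * t\<bar> / sinh \<bar>2 * t\<bar>) ^ ?m)"
      using t by (intro ennreal_power) (simp add: divide_nonneg_nonneg)
    finally show "(\<integral>\<^sup>+c. \<integral>\<^sup>+r. K t c r \<partial>lborel \<partial>?L) = ennreal ((\<bar>2 * t\<bar> / sinh \<bar>2 * t\<bar>) ^ ?m)" .
  qed
  also have "\<dots> = (\<integral>\<^sup>+y. indicator {0<..} y * ennreal ((y / sinh y) ^ ?m) \<partial>lborel)"
    by (rule nn_integral_even_scale[where g="\<lambda>y. ennreal ((y / sinh y) ^ ?m)"]) (simp add: sinh_def)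
  finally show ?thesis by (simp only: ind_def)
qed

section \<open>The value of the determinant constant and the simplex integral\<close>

lemma nn_integral_gauss_matrix:
  "(\<integral>\<^sup>+Z. ennreal (gauss Z) \<partial>(lborel :: (real^'n^'n) measure)) = ennreal (sqrt (2 * pi) ^ CARD('n)) ^ CARD('n)"
proof -
  have "(\<integral>\<^sup>+Z. ennreal (gauss Z) \<partial>(lborel :: (real^'n^'n) measure)) =
      (\<integral>\<^sup>+Z. (\<Prod>k\<in>UNIV. ennreal (gauss (Z $ k))) \<partial>(lborel :: (real^'n^'n) measure))"
    by (intro nn_integral_cong) (simp add: gauss_vec[of Z for Z :: "real^'n^'n"] prod_ennreal)
  also have "\<dots> = (\<Prod>k\<in>(UNIV::'n set). \<integral>\<^sup>+z. ennreal (gauss (z :: real^'n)) \<partial>lborel)"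
    by (rule nn_integral_lborel_vec_prod) measurable
  finally show ?thesis by (simp only: nn_integral_gauss_vec prod_constant)
qed

lemma nn_integral_vector_matrix_mult:
  fixes Z :: "real ^ 'n ^ 'n" and f :: "real ^ 'n \<Rightarrow> ennreal"
  assumes "det Z \<noteq> 0" and "f \<in> borel_measurable borel"
  shows "(\<integral>\<^sup>+x. f x \<partial>lborel) = ennreal \<bar>det Z\<bar> * (\<integral>\<^sup>+c. f (c v* Z) \<partial>lborel)"
  using nn_integral_matrix_vector_mult[of "transpose Z" f] assms by (simp add: det_transpose)

text \<open>Here the full Gaussian law is split, without any positivity constraint, in order to determine
  the constant \<open>cofactor_integral\<close> from the total mass.\<close>

lemma cofactor_integral_value:
  fixes i0 :: "'n::finite"
  shows "cofactor_integral i0 (axis i0 1) * ennreal (gauss_moment 1) =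
    ennreal (sqrt (2 * pi) ^ CARD('n)) ^ CARD('n) * ennreal (gauss_moment CARD('n))"
proof -
  let ?m = "CARD('n)"
  let ?N = "ennreal (sqrt (2 * pi) ^ ?m)" and ?k = "cofactor_integral i0 (axis i0 1)"
  let ?M = "ennreal (gauss_moment ?m)" and ?M' = "ennreal (gauss_moment (?m + 1))"
  let ?w = "\<lambda>c :: real^'n. 1 / sqrt (1 + (norm c)\<^sup>2)"
  let ?H = "\<lambda>(c :: real^'n) r. (norm r)\<^sup>2 + (r \<bullet> c)\<^sup>2"
  \<comment> \<open>The mass of \<open>?m + 1\<close> independent Gaussian vectors: \<open>Z\<close>
    supplies \<open>?N ^ ?m\<close>, and the further vector, written as \<open>c v* Z\<close>,
    supplies \<open>?N\<close>.\<close>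
  have "?N ^ ?m * ?N = (\<integral>\<^sup>+Z. ennreal (gauss Z) * ?N \<partial>(lborel :: (real^'n^'n) measure))"
    by (subst nn_integral_multc) (simp_all add: nn_integral_gauss_matrix)
  also have "\<dots> = (\<integral>\<^sup>+Z. ennreal \<bar>det Z\<bar> * ennreal (gauss Z) * indicator UNIV (transpose Z $ i0) *
       (\<integral>\<^sup>+c. ennreal (gauss (c v* Z)) * indicator UNIV c \<partial>lborel) \<partial>(lborel :: (real^'n^'n) measure))"
  proof (rule nn_integral_cong_AE, rule AE_mp[OF AE_det_nonzero], rule AE_I2, rule impI)
    fix Z :: "real^'n^'n" assume "det Z \<noteq> 0"
    then have "?N = ennreal \<bar>det Z\<bar> * (\<integral>\<^sup>+c. ennreal (gauss (c v* Z)) \<partial>lborel)"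
      unfolding nn_integral_gauss_vec[symmetric] by (rule nn_integral_vector_matrix_mult) measurable
    then show "ennreal (gauss Z) * ?N = ennreal \<bar>det Z\<bar> * ennreal (gauss Z) * indicator UNIV (transpose Z $ i0) *
       (\<integral>\<^sup>+c. ennreal (gauss (c v* Z)) * indicator UNIV c \<partial>lborel)"
      by (simp add: mult_ac)
  qed
  finally have "?N * (?N ^ ?m * ?N) = ?k * (\<integral>\<^sup>+c. indicator UNIV c * ennreal (?w c ^ ?m) *
      (\<integral>\<^sup>+r. indicator UNIV r * ennreal (sqrt (?H c r) * exp (- ?H c r / 2)) \<partial>lborel) \<partial>lborel)"
    by (simp only: nn_integral_det_split[OF sets.top sets.top, unfolded space_borel])
  then have "?N * (?N ^ ?m * ?N) * ?M = ?k * (\<integral>\<^sup>+c. indicator UNIV c * ennreal (?w c ^ ?m) *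
      ((\<integral>\<^sup>+r. indicator UNIV r * ennreal (sqrt (?H c r) * exp (- ?H c r / 2)) \<partial>lborel) * ?M) \<partial>lborel)"
    by (simp add: nn_integral_multc[symmetric] mult.assoc)
  also have "\<dots> = ?k * (\<integral>\<^sup>+c. ennreal (?w c ^ (?m + 1)) * (?N * ?M') \<partial>(lborel :: (real^'n) measure))"
  proof (rule arg_cong2[where f="(*)", OF refl nn_integral_cong])
    fix c :: "real^'n"
    have "(\<integral>\<^sup>+r. indicator UNIV r * ennreal (sqrt (?H c r) * exp (- ?H c r / 2)) \<partial>lborel) * ?M =
      (\<integral>\<^sup>+r. indicator UNIV r * ennreal (exp (- ?H c r / 2)) \<partial>lborel) * ?M'"
      by (rule nn_integral_cone_sqrt_quadratic) auto
    also have "\<dots> = ennreal (?w c) * ?N * ?M'"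
      using nn_integral_shear_gauss[of c] by simp
    finally show "indicator UNIV c * ennreal (?w c ^ ?m) *
      ((\<integral>\<^sup>+r. indicator UNIV r * ennreal (sqrt (?H c r) * exp (- ?H c r / 2)) \<partial>lborel) * ?M) =
      ennreal (?w c ^ (?m + 1)) * (?N * ?M')"
      by (simp add: ennreal_mult[symmetric] mult.assoc[symmetric])
  qed
  also have "\<dots> = ?k * ?N * ((\<integral>\<^sup>+c. ennreal (?w c ^ (?m + 1)) \<partial>(lborel :: (real^'n) measure)) * ?M')"
    by (subst nn_integral_multc) (auto simp: mult_ac)
  also have "\<dots> = ?k * ?N * (?N * ennreal (gauss_moment 1))"
    by (simp only: nn_integral_Cauchy_vec)
  finally have "(?N * ?N) * (?N ^ ?m * ?M) = (?N * ?N) * (?k * ennreal (gauss_moment 1))"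
    by (simp only: mult_ac)
  moreover have "?N * ?N \<noteq> 0" "?N * ?N \<noteq> top"
    by (simp_all add: ennreal_mult[symmetric] del: ennreal_mult)
  ultimately show ?thesis
    unfolding ennreal_mult_cancel_left by auto
qed

lemma AE_lborel_vec_nonzero: "AE x in (lborel :: (real ^ 'n) measure). \<forall>k. x $ k \<noteq> 0"
proof -
  have "AE x in (lborel :: (real ^ 'n) measure). x $ k \<noteq> 0" for k
  proof -
    have "(\<integral>\<^sup>+x. indicator {x. x $ k = 0} x \<partial>(lborel :: (real^'n) measure)) =
      (\<integral>\<^sup>+x. (\<Prod>i\<in>UNIV. (if i = k then indicator {0} (x $ i) else 1 :: ennreal)) \<partial>(lborel :: (real^'n) measure))"
      by (intro nn_integral_cong) (simp add: indicator_def)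
    also have "\<dots> = (\<Prod>i\<in>UNIV. \<integral>\<^sup>+x. (if i = k then indicator {0} x else 1 :: ennreal) \<partial>(lborel :: real measure))"
      by (rule nn_integral_lborel_vec_prod) measurable
    also have "\<dots> = 0" by (rule prod_zero) (simp, simp, rule exI[of _ k], simp)
    finally have "emeasure lborel {x :: real^'n. x $ k = 0} = 0" by simp
    then show ?thesis by (intro AE_I[of _ _ "{x. x $ k = 0}"]) auto
  qed
  then show ?thesis by (simp add: AE_all_countable)
qed

text \<open>Both sets of \<open>nn_integral_det_split\<close> become the orthant: on
  \<open>c\<close> it says that the further point lies in the cone of the rows, on column
  \<open>i0\<close> that all rows lie in the half-space.\<close>

lemma nn_integral_simplex:
  fixes i0 :: "'n::finite"
  assumes J: "(\<integral>\<^sup>+y. indicator {0<..} y * ennreal ((y / sinh y) ^ CARD('n)) \<partial>lborel) = ennreal j" "j \<ge> 0"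
  defines "orth \<equiv> {x :: real^'n. \<forall>k. x $ k \<ge> 0}"
  shows "(\<integral>\<^sup>+Z. ennreal \<bar>det Z\<bar> * ennreal (gauss Z) * indicator orth (transpose Z $ i0) *
       (\<integral>\<^sup>+c. ennreal (gauss (c v* Z)) * indicator orth c \<partial>lborel) \<partial>(lborel :: (real^'n^'n) measure)) =
    ennreal ((sqrt (2 * pi) ^ CARD('n)) ^ CARD('n) * gauss_moment (CARD('n) + 1) * j /
      (sqrt (2 * pi) ^ CARD('n) * gauss_moment 1 * gauss_moment CARD('n)))" (is "?E = _")
proof -
  let ?m = "CARD('n)"
  define N where "N = sqrt (2 * pi) ^ ?m"
  define k where "k = cofactor_integral i0 (axis i0 1)"
  define a where "a = gauss_moment 1"
  define M where "M = gauss_moment ?m"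
  define M' where "M' = gauss_moment (?m + 1)"
  have pos: "N > 0" "a > 0" "M > 0" "M' > 0"
    by (auto simp: N_def a_def M_def M'_def intro!: gauss_moment_pos simp: Suc_leI)
  let ?w = "\<lambda>c :: real^'n. 1 / sqrt (1 + (norm c)\<^sup>2)"
  let ?H = "\<lambda>(c :: real^'n) r. (norm r)\<^sup>2 + (r \<bullet> c)\<^sup>2"
  have [measurable]: "orth \<in> sets borel" unfolding orth_def by measurable
  \<comment> \<open>The orthants of the geometric condition are closed, those of
    \<open>nn_integral_orthants\<close> are open; the difference is a null set.\<close>
  have oo: "AE x in (lborel :: (real ^ 'n) measure). indicator orth x = (indicator orthant x :: ennreal)"
    using AE_lborel_vec_nonzero by eventually_elim (auto simp: orth_def indicator_def order.order_iff_strict)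
  have E: "ennreal N * ?E = k * (\<integral>\<^sup>+c. indicator orth c * ennreal (?w c ^ ?m) *
      (\<integral>\<^sup>+r. indicator orth r * ennreal (sqrt (?H c r) * exp (- ?H c r / 2)) \<partial>lborel) \<partial>lborel)"
    unfolding N_def k_def by (rule nn_integral_det_split) measurable
  \<comment> \<open>One factor \<open>M\<close> serves to remove the square root of the quadratic
    form, the other is the moment that accompanies the power of \<open>?w c\<close> in
    \<open>nn_integral_orthants\<close>.\<close>
  have "ennreal N * ?E * (ennreal M * ennreal M) = k * (\<integral>\<^sup>+c. indicator orth c * ennreal (?w c ^ ?m) *
      (\<integral>\<^sup>+r. indicator orth r * ennreal (sqrt (?H c r) * exp (- ?H c r / 2)) \<partial>lborel) * (ennreal M * ennreal M) \<partial>lborel)"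
    unfolding E mult.assoc[of k] by (subst nn_integral_multc) auto
  also have "\<dots> = k * (\<integral>\<^sup>+c. indicator orthant c * (ennreal (?w c ^ ?m) * ennreal M) *
      (\<integral>\<^sup>+r. indicator orthant r * ennreal (exp (- ?H c r / 2)) \<partial>lborel) * ennreal M' \<partial>lborel)"
  proof (rule arg_cong2[where f="(*)", OF refl nn_integral_cong_AE], use oo in eventually_elim)
    fix c :: "real^'n" assume c: "indicator orth c = (indicator orthant c :: ennreal)"
    have "(\<integral>\<^sup>+r. indicator orth r * ennreal (sqrt (?H c r) * exp (- ?H c r / 2)) \<partial>lborel) =
      (\<integral>\<^sup>+r. indicator orthant r * ennreal (sqrt (?H c r) * exp (- ?H c r / 2)) \<partial>lborel)"
      by (intro nn_integral_cong_AE, use oo in eventually_elim) simp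
    also have "\<dots> * ennreal M = (\<integral>\<^sup>+r. indicator orthant r * ennreal (exp (- ?H c r / 2)) \<partial>lborel) * ennreal M'"
      unfolding M_def M'_def by (rule nn_integral_cone_sqrt_quadratic) (auto simp: zero_less_mult_iff)
    finally have *: "(\<integral>\<^sup>+r. indicator orth r * ennreal (sqrt (?H c r) * exp (- ?H c r / 2)) \<partial>lborel) * ennreal M =
      (\<integral>\<^sup>+r. indicator orthant r * ennreal (exp (- ?H c r / 2)) \<partial>lborel) * ennreal M'" .
    have "x * y * z * (u * u) = x * (y * u) * (z * u)" for x y z u :: ennreal by (simp add: mult_ac)
    then show "indicator orth c * ennreal (?w c ^ ?m) *
      (\<integral>\<^sup>+r. indicator orth r * ennreal (sqrt (?H c r) * exp (- ?H c r / 2)) \<partial>lborel) * (ennreal M * ennreal M) =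
      indicator orthant c * (ennreal (?w c ^ ?m) * ennreal M) *
      (\<integral>\<^sup>+r. indicator orthant r * ennreal (exp (- ?H c r / 2)) \<partial>lborel) * ennreal M'"
      by (simp only: c * mult.assoc)
  qed
  also have "\<dots> = k * ((\<integral>\<^sup>+c. indicator orthant c * (ennreal (?w c ^ ?m) * ennreal M) *
      (\<integral>\<^sup>+r. indicator orthant r * ennreal (exp (- ?H c r / 2)) \<partial>lborel) \<partial>lborel) * ennreal M')"
    by (subst nn_integral_multc) auto
  also have "\<dots> = k * (ennreal j * ennreal M')"
    unfolding M_def nn_integral_orthants J(1) ..
  finally have "ennreal N * ?E * (ennreal M * ennreal M) * ennreal a = (k * ennreal a) * (ennreal j * ennreal M')"
    by (simp only: mult_ac)
  also have "k * ennreal a = ennreal N ^ ?m * ennreal M"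
    unfolding k_def a_def N_def M_def by (rule cofactor_integral_value)
  also have "\<dots> * (ennreal j * ennreal M') = ennreal (N ^ ?m * M * (j * M'))"
    using pos J(2) by (simp add: ennreal_mult ennreal_power)
  also have "ennreal N * ?E * (ennreal M * ennreal M) * ennreal a = ?E * ennreal (N * (M * M) * a)"
    using pos by (simp add: ennreal_mult mult_ac)
  finally have "?E * ennreal (N * (M * M) * a) = ennreal (N ^ ?m * M * (j * M'))" .
  then have "?E * ennreal (N * (M * M) * a) / ennreal (N * (M * M) * a) = ennreal (N ^ ?m * M * (j * M')) / ennreal (N * (M * M) * a)"
    by simp
  moreover have "?E * ennreal (N * (M * M) * a) / ennreal (N * (M * M) * a) = ?E"
    using pos by (intro ennreal_mult_divide_eq) auto
  moreover have "ennreal (N ^ ?m * M * (j * M')) / ennreal (N * (M * M) * a) = ennreal (N ^ ?m * M' * j / (N * a * M))"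
    using pos J(2) by (subst divide_ennreal) (auto simp: field_simps)
  ultimately show ?thesis unfolding N_def M_def M'_def a_def by simp
qed

section \<open>Simplicial cones\<close>

text \<open>Independence of an indexed family, where a repeated vector counts as a dependence; the
  image set alone would not show the repetition.\<close>

definition independent_family :: "'i set \<Rightarrow> ('i \<Rightarrow> 'a::real_vector) \<Rightarrow> bool" where
  "independent_family J u \<longleftrightarrow> (\<forall>c. (\<Sum>i\<in>J. c i *\<^sub>R u i) = 0 \<longrightarrow> (\<forall>i\<in>J. c i = 0))"

lemma independent_familyD:
  "independent_family J u \<Longrightarrow> (\<Sum>i\<in>J. c i *\<^sub>R u i) = 0 \<Longrightarrow> i \<in> J \<Longrightarrow> c i = 0"
  by (auto simp: independent_family_def)

lemma independent_family_imp_inj_on: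
  assumes "finite J" "independent_family J u"
  shows "inj_on u J"
proof (rule inj_onI, rule ccontr)
  fix i j assume ij: "i \<in> J" "j \<in> J" "u i = u j" "i \<noteq> j"
  define c where "c k = (if k = i then 1 else 0) - (if k = j then 1 else 0 :: real)" for k
  have "(\<Sum>k\<in>J. c k *\<^sub>R u k) = u i - u j"
    using ij assms(1) by (simp add: c_def scaleR_left_diff_distrib sum_subtractf if_distrib[of "\<lambda>x. x *\<^sub>R _"] if_distribR cong: if_cong)
  with ij independent_familyD[OF assms(2), of c i] show False by (simp add: c_def)
qed

lemma independent_family_iff:
  assumes "finite J"
  shows "independent_family J u \<longleftrightarrow> inj_on u J \<and> independent (u ` J)"
proof (intro iffI conjI)
  assume I: "independent_family J u"
  then show inj: "inj_on u J" using independent_family_imp_inj_on assms by blast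
  show "independent (u ` J)"
  proof (rule independent_if_scalars_zero)
    fix f x assume *: "(\<Sum>x\<in>u ` J. f x *\<^sub>R x) = 0" "x \<in> u ` J"
    then have "(\<Sum>i\<in>J. f (u i) *\<^sub>R u i) = 0" by (simp add: sum.reindex[OF inj])
    with independent_familyD[OF I this] * show "f x = 0" by blast
  qed (use assms in simp)
next
  assume *: "inj_on u J \<and> independent (u ` J)"
  show "independent_family J u"
    unfolding independent_family_def
  proof (intro allI impI ballI)
    fix c i assume c: "(\<Sum>i\<in>J. c i *\<^sub>R u i) = 0" and i: "i \<in> J"
    define f where "f x = c (the_inv_into J u x)" for x
    have "(\<Sum>x\<in>u ` J. f x *\<^sub>R x) = (\<Sum>i\<in>J. c i *\<^sub>R u i)"
      using * by (subst sum.reindex) (auto simp: f_def the_inv_into_f_f intro!: sum.cong)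
    then have "f (u i) = 0"
      using * c i assms by (intro independentD[of "u ` J" "u ` J" f]) auto
    then show "c i = 0" using * i by (simp add: f_def the_inv_into_f_f)
  qed
qed

lemma mem_pos_singleton: "x \<in> pos {v} (\<lambda>v. v) \<longleftrightarrow> (\<exists>t\<ge>0. x = t *\<^sub>R v)"
  by (auto simp: pos_def)

lemma pos_generator: 
  assumes "finite J" "i \<in> J" "t \<ge> 0" shows "t *\<^sub>R u i \<in> pos J u"
  unfolding pos_def using assms
  by (auto intro!: exI[of _ "\<lambda>k. if k = i then t else 0"] simp: if_distrib[of "\<lambda>x. x *\<^sub>R _"] if_distribR cong: if_cong)

lemma pos_scaleR: "x \<in> pos J u \<Longrightarrow> t \<ge> 0 \<Longrightarrow> t *\<^sub>R x \<in> pos J u"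
  unfolding pos_def
proof safe
  fix c assume "t \<ge> 0" "\<forall>i\<in>J. c i \<ge> (0::real)"
  then show "\<exists>c'. t *\<^sub>R (\<Sum>i\<in>J. c i *\<^sub>R u i) = (\<Sum>i\<in>J. c' i *\<^sub>R u i) \<and> (\<forall>i\<in>J. 0 \<le> c' i)"
    by (intro exI[of _ "\<lambda>i. t * c i"]) (auto simp: scaleR_sum_right)
qed

lemma pos_add: "x \<in> pos J u \<Longrightarrow> y \<in> pos J u \<Longrightarrow> x + y \<in> pos J u"
  unfolding pos_def
proof safe
  fix c d assume "\<forall>i\<in>J. c i \<ge> (0::real)" "\<forall>i\<in>J. d i \<ge> (0::real)"
  then show "\<exists>c'. (\<Sum>i\<in>J. c i *\<^sub>R u i) + (\<Sum>i\<in>J. d i *\<^sub>R u i) = (\<Sum>i\<in>J. c' i *\<^sub>R u i) \<and> (\<forall>i\<in>J. 0 \<le> c' i)"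
    by (intro exI[of _ "\<lambda>i. c i + d i"]) (auto simp: scaleR_add_left sum.distrib)
qed

lemma convex_pos: "convex (pos J u)"
  by (auto simp: convex_def intro!: pos_add pos_scaleR)

lemma zero_in_pos: "0 \<in> pos J u"
  unfolding pos_def by (auto intro!: exI[of _ "\<lambda>_. 0"])

lemma pos_image:
  assumes "inj_on u J"
  shows "pos (u ` J) (\<lambda>v. v) = pos J u"
proof (intro set_eqI iffI)
  fix x assume "x \<in> pos (u ` J) (\<lambda>v. v)"
  then obtain c where "\<forall>v\<in>u ` J. c v \<ge> 0" "x = (\<Sum>v\<in>u ` J. c v *\<^sub>R v)" by (auto simp: pos_def)
  then show "x \<in> pos J u"
    unfolding pos_def by (auto intro!: exI[of _ "\<lambda>i. c (u i)"] simp: sum.reindex[OF assms])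
next
  fix x assume "x \<in> pos J u"
  then obtain c where c: "\<forall>i\<in>J. c i \<ge> 0" "x = (\<Sum>i\<in>J. c i *\<^sub>R u i)" by (auto simp: pos_def)
  have "(\<Sum>v\<in>u ` J. c (the_inv_into J u v) *\<^sub>R v) = x"
    using assms c by (subst sum.reindex) (auto simp: the_inv_into_f_f intro!: sum.cong)
  with c assms show "x \<in> pos (u ` J) (\<lambda>v. v)"
    unfolding pos_def by (auto intro!: exI[of _ "\<lambda>v. c (the_inv_into J u v)"] simp: the_inv_into_f_f)
qed

text \<open>\<open>v\<close> is the midpoint of \<open>a\<close>, twice one nonzero summand of
  \<open>v\<close>, and \<open>b\<close>, twice the rest. Both lie in the cone, so extremality puts
  \<open>a\<close> on the ray of \<open>v\<close>, and unit length turns this into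
  \<open>u i = v\<close>.\<close>

lemma spherical_vertices_pos_subset:
  fixes u :: "'i \<Rightarrow> 'a::euclidean_space"
  assumes J: "finite J" and u: "\<And>i. i \<in> J \<Longrightarrow> norm (u i) = 1"
  shows "spherical_vertices (pos J u) \<subseteq> u ` J"
proof
  fix v assume "v \<in> spherical_vertices (pos J u)"
  then have v: "norm v = 1" and face: "pos {v} (\<lambda>v. v) face_of pos J u"
    by (auto simp: spherical_vertices_def)
  have vr: "v \<in> pos {v} (\<lambda>v. v)" by (auto simp: mem_pos_singleton intro!: exI[of _ 1])
  then have "v \<in> pos J u" using face face_of_imp_subset by blast
  then obtain c where c: "\<forall>i\<in>J. c i \<ge> 0" "v = (\<Sum>i\<in>J. c i *\<^sub>R u i)" by (auto simp: pos_def)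
  from v c obtain i where i: "i \<in> J" "c i \<noteq> 0"
    by (force intro: ccontr)
  define a where "a = (2 * c i) *\<^sub>R u i"
  define b where "b = 2 *\<^sub>R (\<Sum>k\<in>J - {i}. c k *\<^sub>R u k)"
  have a: "a \<in> pos J u" unfolding a_def using J i c by (intro pos_generator) auto
  have "(\<Sum>k\<in>J - {i}. c k *\<^sub>R u k) = (\<Sum>k\<in>J. (if k = i then 0 else c k) *\<^sub>R u k)"
    using J i by (simp add: sum.remove[of J i])
  then have "(\<Sum>k\<in>J - {i}. c k *\<^sub>R u k) \<in> pos J u"
    unfolding pos_def using c by (auto intro!: exI[of _ "\<lambda>k. if k = i then 0 else c k"])
  then have b: "b \<in> pos J u" unfolding b_def by (rule pos_scaleR) simp
  have mid: "v = midpoint a b"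
    unfolding midpoint_def a_def b_def c(2) using J i by (simp add: sum.remove[of J i] scaleR_add_right)
  have "a \<in> pos {v} (\<lambda>v. v)"
  proof (cases "a = b")
    case True with mid vr show ?thesis by simp
  next
    case False
    then have "v \<in> open_segment a b" using mid midpoint_in_open_segment by blast
    with face a b vr show ?thesis unfolding face_of_def by blast
  qed
  then obtain t where t: "t \<ge> 0" "(2 * c i) *\<^sub>R u i = t *\<^sub>R v" by (auto simp: mem_pos_singleton a_def)
  then have "norm ((2 * c i) *\<^sub>R u i) = norm (t *\<^sub>R v)" by simp
  then have "\<bar>2 * c i\<bar> = \<bar>t\<bar>" unfolding norm_scaleR using i u v by simp
  then have "t = 2 * c i" using t c i by auto
  with t i have "u i = v" by simp
  with i show "v \<in> u ` J" by blast
qed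

text \<open>By independence, coefficients in the cone are unique. On the ray of \<open>u i\<close>
  all other coefficients vanish, and a proper convex combination of two nonnegative numbers vanishes
  only if both do; so both ends of a segment whose interior meets the ray lie on it.\<close>

lemma spherical_vertices_pos_independent:
  fixes u :: "'i \<Rightarrow> 'a::euclidean_space"
  assumes J: "finite J" and u: "\<And>i. i \<in> J \<Longrightarrow> norm (u i) = 1" and ind: "independent_family J u"
  shows "spherical_vertices (pos J u) = u ` J"
proof (intro equalityI spherical_vertices_pos_subset[OF J u] subsetI)
  fix v assume "v \<in> u ` J"
  then obtain i where i: "i \<in> J" "v = u i" by blast
  have ray: "x \<in> pos {v} (\<lambda>v. v)" if "\<forall>k\<in>J. c k \<ge> 0" "x = (\<Sum>k\<in>J. c k *\<^sub>R u k)" "\<forall>k\<in>J - {i}. c k = 0" for x c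
    using that i J by (auto simp: mem_pos_singleton sum.remove[of J i])
  have "a \<in> pos {v} (\<lambda>v. v) \<and> b \<in> pos {v} (\<lambda>v. v)"
    if ab: "a \<in> pos J u" "b \<in> pos J u" and x: "x \<in> pos {v} (\<lambda>v. v)" "x \<in> open_segment a b" for a b x
  proof -
    from ab obtain c d where c: "\<forall>k\<in>J. c k \<ge> 0" "a = (\<Sum>k\<in>J. c k *\<^sub>R u k)"
      and d: "\<forall>k\<in>J. d k \<ge> 0" "b = (\<Sum>k\<in>J. d k *\<^sub>R u k)" by (auto simp: pos_def)
    from x obtain t where t: "x = t *\<^sub>R v" by (auto simp: mem_pos_singleton)
    from x obtain s where s: "0 < s" "s < 1" "x = (1 - s) *\<^sub>R a + s *\<^sub>R b"
      by (auto simp: in_segment)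
    \<comment> \<open>The difference of two representations of \<open>x\<close>: as a point of the
      segment, and as the multiple \<open>t\<close> of \<open>u i\<close>.\<close>
    define e where "e k = (1 - s) * c k + s * d k - (if k = i then t else 0)" for k
    have "(\<Sum>k\<in>J. e k *\<^sub>R u k) = x - t *\<^sub>R v"
      unfolding s(3) e_def c(2) d(2) using i J
      by (simp add: scaleR_left_diff_distrib scaleR_add_left sum.distrib sum_subtractf scaleR_sum_right
          if_distrib[of "\<lambda>x. x *\<^sub>R _"] if_distribR cong: if_cong)
    then have e0: "e k = 0" if "k \<in> J" for k using independent_familyD[OF ind _ that, of e] t by simp
    have "c k = 0 \<and> d k = 0" if "k \<in> J - {i}" for k
    proof -
      have "(1 - s) * c k + s * d k = 0" using e0[of k] that by (simp add: e_def)
      moreover have "(1 - s) * c k \<ge> 0" "s * d k \<ge> 0" using s c d that by auto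
      ultimately have "(1 - s) * c k = 0" "s * d k = 0" by linarith+
      with s show ?thesis by simp
    qed
    with ray[OF c] ray[OF d] show ?thesis by blast
  qed
  moreover have "pos {v} (\<lambda>v. v) \<subseteq> pos J u"
    using i J by (auto simp: mem_pos_singleton intro!: pos_generator)
  ultimately have "pos {v} (\<lambda>v. v) face_of pos J u"
    unfolding face_of_def using convex_pos by blast
  with i u show "v \<in> spherical_vertices (pos J u)" by (simp add: spherical_vertices_def)
qed

text \<open>A cone is recovered from its unit vectors by scaling, so an equality of spherical sets
  can be read as one of cones.\<close>

lemma pos_Int_sphere_cancel:
  fixes u :: "'i \<Rightarrow> 'a::euclidean_space" and v :: "'j \<Rightarrow> 'a"
  assumes "pos J u \<inter> sphere 0 1 \<subseteq> pos K v"
  shows "pos J u \<subseteq> pos K v"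
proof
  fix x assume x: "x \<in> pos J u"
  show "x \<in> pos K v"
  proof (cases "x = 0")
    case False
    then have "(1 / norm x) *\<^sub>R x \<in> pos J u \<inter> sphere 0 1" using pos_scaleR[OF x] by simp
    with assms have "(1 / norm x) *\<^sub>R x \<in> pos K v" by blast
    from pos_scaleR[OF this, of "norm x"] False show ?thesis by simp
  qed (simp add: zero_in_pos)
qed

lemma pos_remove_generator:
  assumes "finite I" "j \<in> I" "u j \<in> pos (I - {j}) u"
  shows "pos I u = pos (I - {j}) u"
proof (intro equalityI subsetI)
  fix x assume "x \<in> pos I u"
  then obtain c where c: "\<forall>i\<in>I. c i \<ge> 0" "x = (\<Sum>i\<in>I. c i *\<^sub>R u i)" by (auto simp: pos_def)
  have "x = c j *\<^sub>R u j + (\<Sum>i\<in>I-{j}. c i *\<^sub>R u i)" using assms c by (simp add: sum.remove[of I j])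
  moreover have "(\<Sum>i\<in>I-{j}. c i *\<^sub>R u i) \<in> pos (I - {j}) u" using c by (auto simp: pos_def)
  moreover have "c j *\<^sub>R u j \<in> pos (I - {j}) u" using assms c by (intro pos_scaleR) auto
  ultimately show "x \<in> pos (I - {j}) u" by (simp add: pos_add)
next
  fix x assume "x \<in> pos (I - {j}) u"
  then obtain c where c: "\<forall>i\<in>I-{j}. c i \<ge> 0" "x = (\<Sum>i\<in>I-{j}. c i *\<^sub>R u i)" by (auto simp: pos_def)
  have "x = (\<Sum>i\<in>I. (if i = j then 0 else c i) *\<^sub>R u i)" using c assms by (simp add: sum.remove[of I j])
  with c show "x \<in> pos I u" unfolding pos_def by (auto intro!: exI[of _ "\<lambda>i. if i = j then 0 else c i"])
qed

lemma pos_Int_half_sphere: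
  fixes u :: "'i \<Rightarrow> real ^ 'n"
  assumes "\<And>i. i \<in> I \<Longrightarrow> u i \<in> half_sphere i0"
  shows "pos I u \<inter> half_sphere i0 = pos I u \<inter> sphere 0 1"
proof -
  have "x $ i0 \<ge> 0" if "x \<in> pos I u" for x
    using that assms by (auto simp: pos_def half_sphere_def intro!: sum_nonneg)
  then show ?thesis by (auto simp: half_sphere_def)
qed

lemma spherical_simplex_pos_iff:
  fixes u :: "'i \<Rightarrow> real ^ 'n"
  assumes I: "finite I" "card I = CARD('n) + 1" and u: "\<And>i. i \<in> I \<Longrightarrow> u i \<in> half_sphere i0"
  shows "spherical_simplex (pos I u \<inter> half_sphere i0) \<and> card (spherical_vertices (pos I u)) = CARD('n)
    \<longleftrightarrow> (\<exists>j\<in>I. independent_family (I - {j}) u \<and> u j \<in> pos (I - {j}) u)"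
proof -
  have half: "pos I u \<inter> half_sphere i0 = pos I u \<inter> sphere 0 1"
    using u by (rule pos_Int_half_sphere)
  show ?thesis
proof
  assume "\<exists>j\<in>I. independent_family (I - {j}) u \<and> u j \<in> pos (I - {j}) u"
  then obtain j where j: "j \<in> I" "independent_family (I - {j}) u" "u j \<in> pos (I - {j}) u" by blast
  have fin: "finite (I - {j})" using I by simp
  have inj: "inj_on u (I - {j})" "independent (u ` (I - {j}))" 
    using j independent_family_iff[OF fin] by blast+
  have eq: "pos I u = pos (I - {j}) u" using pos_remove_generator I j by metis
  have "spherical_vertices (pos I u) = u ` (I - {j})"
    unfolding eq using u by (intro spherical_vertices_pos_independent fin j) (auto simp: half_sphere_def)
  then have "card (spherical_vertices (pos I u)) = CARD('n)"
    using inj I j by (simp add: card_image)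
  moreover have "spherical_simplex (pos I u \<inter> half_sphere i0)"
    unfolding spherical_simplex_def half unfolding eq
    using inj by (intro exI[of _ "u ` (I - {j})"]) (simp add: pos_image)
  ultimately show "spherical_simplex (pos I u \<inter> half_sphere i0) \<and> card (spherical_vertices (pos I u)) = CARD('n)"
    by blast
next
  assume *: "spherical_simplex (pos I u \<inter> half_sphere i0) \<and> card (spherical_vertices (pos I u)) = CARD('n)"
  then obtain V where V: "independent V" "pos I u \<inter> sphere 0 1 = pos V (\<lambda>v. v) \<inter> sphere 0 1"
    unfolding spherical_simplex_def half by blast
  have fV: "finite V" using V independent_bound by blast
  have V0: "v \<noteq> 0" if "v \<in> V" for v using that V dependent_zero by blast
  have eq: "pos I u = pos V (\<lambda>v. v)"
    using pos_Int_sphere_cancel[of I u V "\<lambda>v. v"] pos_Int_sphere_cancel[of V "\<lambda>v. v" I u] V by blast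
  \<comment> \<open>The generators of a simplex may have any length; normalising them keeps the cone
    and makes them comparable with vertices, which are unit vectors.\<close>
  also have "\<dots> = pos V sgn"
  proof -
    have "\<exists>c'. (\<Sum>v\<in>V. c v *\<^sub>R v) = (\<Sum>v\<in>V. c' v *\<^sub>R sgn v) \<and> (\<forall>i\<in>V. 0 \<le> c' i)" if "\<forall>v\<in>V. c v \<ge> 0" for c
      using that V0 by (intro exI[of _ "\<lambda>v. c v * norm v"]) (auto simp: sgn_div_norm intro!: sum.cong)
    moreover have "\<exists>c'. (\<Sum>v\<in>V. c v *\<^sub>R sgn v) = (\<Sum>v\<in>V. c' v *\<^sub>R v) \<and> (\<forall>i\<in>V. 0 \<le> c' i)" if "\<forall>v\<in>V. c v \<ge> 0" for c
      using that V0 by (intro exI[of _ "\<lambda>v. c v / norm v"]) (auto simp: sgn_div_norm divide_inverse intro!: sum.cong)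
    ultimately show ?thesis by (fastforce simp: pos_def)
  qed
  finally have eqs: "pos I u = pos V sgn" .
  have ind: "independent_family V sgn"
    unfolding independent_family_def
  proof (intro allI impI ballI)
    fix c v assume c: "(\<Sum>v\<in>V. c v *\<^sub>R sgn v) = 0" and v: "v \<in> V"
    have "independent_family V (\<lambda>v. v)" using V fV by (simp add: independent_family_iff)
    from independent_familyD[OF this _ v, of "\<lambda>v. c v / norm v"] c
    have "c v / norm v = 0" by (simp add: sgn_div_norm divide_inverse)
    with V0[OF v] show "c v = 0" by simp
  qed
  have verts: "spherical_vertices (pos I u) = sgn ` V"
    unfolding eqs by (intro spherical_vertices_pos_independent fV ind) (auto simp: norm_sgn V0)
  have "sgn ` V \<subseteq> u ` I"
    unfolding verts[symmetric] using u by (intro spherical_vertices_pos_subset I) (auto simp: half_sphere_def)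
  then obtain J where J: "J \<subseteq> I" "inj_on u J" "sgn ` V = u ` J"
    unfolding subset_image_inj by blast
  have cJ: "card J = CARD('n)"
    using * J verts by (metis card_image)
  have fJ: "finite J" using J I finite_subset by blast
  have "card (I - J) = 1" using J I cJ fJ by (simp add: card_Diff_subset)
  then obtain j where j: "I - J = {j}" using card_1_singletonE by blast
  then have JI: "J = I - {j}" and jI: "j \<in> I" using J by blast+
  have "independent (u ` J)" using ind fV independent_family_iff J by metis
  then have "independent_family J u" using J fJ independent_family_iff by blast
  moreover have "u j \<in> pos J u"
  proof -
    have "pos V sgn = pos (sgn ` V) (\<lambda>v. v)"
      using pos_image independent_family_imp_inj_on[OF fV ind] by metis
    also have "\<dots> = pos J u" unfolding J(3) using J by (intro pos_image)
    finally have "pos I u = pos J u" using eqs by simp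
    moreover have "u j \<in> pos I u" using pos_generator[OF I(1) jI, of 1 u] by simp
    ultimately show ?thesis by simp
  qed
  ultimately show "\<exists>j\<in>I. independent_family (I - {j}) u \<and> u j \<in> pos (I - {j}) u"
    using JI jI by blast
qed
qed

section \<open>Cones and independence in matrix form\<close>

lemma vector_matrix_mult_eq_sum: "c v* Z = (\<Sum>k\<in>UNIV. c $ k *\<^sub>R (Z $ k))"
  for Z :: "real ^ 'n ^ 'm"
  by (simp add: vector_matrix_mult_def vec_eq_iff mult.commute)

text \<open>\<open>b\<close> enumerates the chosen indices by the row index type, so that the
  vectors become the rows of a square matrix.\<close>

lemma independent_family_iff_det:
  fixes u :: "'i \<Rightarrow> real ^ 'n"
  assumes b: "bij_betw b (UNIV :: 'n set) J"
  shows "independent_family J u \<longleftrightarrow> det (\<chi> k. u (b k)) \<noteq> 0"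
proof -
  let ?Z = "(\<chi> k. u (b k)) :: real^'n^'n"
  have "det ?Z \<noteq> 0 \<longleftrightarrow> (\<forall>c. (\<Sum>k\<in>UNIV. c k *\<^sub>R u (b k)) = 0 \<longrightarrow> (\<forall>k. c k = 0))"
    unfolding invertible_det_nz[symmetric] invertible_right_inverse
      matrix_right_invertible_independent_rows
    by (simp add: row_def vector_scalar_mult_def scaleR_vec_def vec_lambda_eta)
  also have "\<dots> \<longleftrightarrow> independent_family J u"
  proof
    assume L: "\<forall>c. (\<Sum>k\<in>UNIV. c k *\<^sub>R u (b k)) = 0 \<longrightarrow> (\<forall>k. c k = 0)"
    show "independent_family J u"
      unfolding independent_family_def
    proof (intro allI impI ballI)
      fix c i assume c: "(\<Sum>i\<in>J. c i *\<^sub>R u i) = 0" and i: "i \<in> J"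
      have "(\<Sum>k\<in>UNIV. c (b k) *\<^sub>R u (b k)) = 0"
        using sum.reindex_bij_betw[OF b, of "\<lambda>i. c i *\<^sub>R u i"] c by simp
      with L have "\<forall>k. c (b k) = 0" by (auto dest: spec[of _ "\<lambda>k. c (b k)"])
      with i b show "c i = 0" by (metis bij_betw_imp_surj_on imageE)
    qed
  next
    assume R: "independent_family J u"
    show "\<forall>c. (\<Sum>k\<in>UNIV. c k *\<^sub>R u (b k)) = 0 \<longrightarrow> (\<forall>k. c k = 0)"
    proof (intro allI impI)
      fix c :: "'n \<Rightarrow> real" and k assume c: "(\<Sum>k\<in>UNIV. c k *\<^sub>R u (b k)) = 0"
      have inv: "the_inv_into UNIV b (b k) = k" for k
        using b by (simp add: the_inv_into_f_f bij_betw_imp_inj_on)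
      have "(\<Sum>i\<in>J. c (the_inv_into UNIV b i) *\<^sub>R u i) = 0"
        using sum.reindex_bij_betw[OF b, of "\<lambda>i. c (the_inv_into UNIV b i) *\<^sub>R u i"] c inv by simp
      from independent_familyD[OF R this, of "b k"] b inv show "c k = 0"
        by (auto simp: bij_betw_def)
    qed
  qed
  finally show ?thesis by simp
qed

lemma mem_pos_iff_vector_matrix_mult:
  fixes u :: "'i \<Rightarrow> real ^ 'n"
  assumes b: "bij_betw b (UNIV :: 'm::finite set) J"
  shows "x \<in> pos J u \<longleftrightarrow> (\<exists>c::real^'m. (\<forall>k. c $ k \<ge> 0) \<and> x = c v* (\<chi> k. u (b k)))"
proof
  assume "x \<in> pos J u"
  then obtain c where c: "\<forall>i\<in>J. c i \<ge> 0" "x = (\<Sum>i\<in>J. c i *\<^sub>R u i)" by (auto simp: pos_def)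
  then have "x = (\<Sum>k\<in>UNIV. c (b k) *\<^sub>R u (b k))"
    using sum.reindex_bij_betw[OF b, of "\<lambda>i. c i *\<^sub>R u i"] by simp
  with c b show "\<exists>c::real^'m. (\<forall>k. c $ k \<ge> 0) \<and> x = c v* (\<chi> k. u (b k))"
    by (intro exI[of _ "\<chi> k. c (b k)"]) (auto simp: vector_matrix_mult_eq_sum bij_betw_def)
next
  assume "\<exists>c::real^'m. (\<forall>k. c $ k \<ge> 0) \<and> x = c v* (\<chi> k. u (b k))"
  then obtain c :: "real^'m" where c: "\<forall>k. c $ k \<ge> 0" "x = (\<Sum>k\<in>UNIV. c $ k *\<^sub>R u (b k))"
    by (auto simp: vector_matrix_mult_eq_sum)
  have inv: "the_inv_into UNIV b (b k) = k" for k
    using b by (simp add: the_inv_into_f_f bij_betw_imp_inj_on)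
  have "x = (\<Sum>i\<in>J. c $ (the_inv_into UNIV b i) *\<^sub>R u i)"
    using sum.reindex_bij_betw[OF b, of "\<lambda>i. c $ (the_inv_into UNIV b i) *\<^sub>R u i"] c inv by simp
  with c show "x \<in> pos J u"
    unfolding pos_def by (auto intro!: exI[of _ "\<lambda>i. c $ (the_inv_into UNIV b i)"])
qed

section \<open>The integrals of powers of y / sinh y\<close>

text \<open>For \<open>1 \<le> m\<close> and \<open>m \<le> k\<close>, the factor
  \<open>2 ^ m * fact k\<close> turns this into the integral of \<open>y ^ k / sinh y ^ m\<close>
  over \<open>y > 0\<close>. A power of \<open>y / sinh y\<close> is the case \<open>k = m\<close>;
  the recursion also involves other differences \<open>k - m\<close>, so the two indices are kept
  apart.\<close>

definition sinh_sum :: "nat \<Rightarrow> nat \<Rightarrow> real" where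
  "sinh_sum k m = (\<Sum>p. real ((p + m - 1) choose (m - 1)) / real (2 * p + m) ^ Suc k)"

text \<open>The binomial coefficient is at most \<open>(2 p + m) ^ (m - 1)\<close>, so for
  \<open>k \<ge> m\<close> the terms are dominated by \<open>1 / (p + 1)^2\<close>.\<close>

lemma summable_sinh_sum:
  assumes "1 \<le> m" "m \<le> k"
  shows "summable (\<lambda>p. real ((p + m - 1) choose (m - 1)) / real (2 * p + m) ^ Suc k)"
proof (rule summable_comparison_test')
  have "summable (\<lambda>p. inverse (real (Suc p) ^ 2))"
    using inverse_power_summable[of 2, where ?'a = real] by (subst summable_Suc_iff) simp
  then show "summable (\<lambda>p. 1 / real (Suc p) ^ 2)" by (simp add: inverse_eq_divide)
  fix p :: nat
  have "real ((p + m - 1) choose (m - 1)) \<le> real ((p + m - 1) ^ (m - 1))"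
    using binomial_le_pow2 by (metis binomial_le_pow le_add_diff_inverse2 of_nat_mono assms add_diff_assoc diff_le_mono le_add2 binomial_eq_0_iff not_le)
  also have "\<dots> \<le> real (2 * p + m) ^ (m - 1)" unfolding of_nat_power[symmetric] by (intro of_nat_mono power_mono) auto
  finally have c: "real ((p + m - 1) choose (m - 1)) \<le> real (2 * p + m) ^ (m - 1)" .
  have u: "real (2 * p + m) \<ge> real (Suc p)" "real (2 * p + m) \<ge> 1" using assms by auto
  have "real (2 * p + m) ^ (m - 1) * real (Suc p) ^ 2 \<le> real (2 * p + m) ^ (m - 1) * real (2 * p + m) ^ 2"
    using u by (intro mult_left_mono power_mono) auto
  also have "\<dots> = real (2 * p + m) ^ (m + 1)" using assms by (simp only: power_add[symmetric]) (simp add: Suc_diff_Suc)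
  also have "\<dots> \<le> real (2 * p + m) ^ Suc k" using u assms by (intro power_increasing) auto
  finally have "real (2 * p + m) ^ (m - 1) * real (Suc p) ^ 2 \<le> real (2 * p + m) ^ Suc k" .
  with c have le: "real ((p + m - 1) choose (m - 1)) * real (Suc p) ^ 2 \<le> real (2 * p + m) ^ Suc k"
    by (meson mult_right_mono order_trans zero_le_power2)
  have "real ((p + m - 1) choose (m - 1)) / real (2 * p + m) ^ Suc k \<le> 1 / real (Suc p) ^ 2"
  proof -
    have frac: "b / X \<le> 1 / S" if "b * S \<le> X" "X > 0" "S > 0" for b X S :: real
      using that by (simp add: field_simps)
    have "real (2 * p + m) ^ Suc k > 0" using u(2) by (intro zero_less_power) linarith
    with le show ?thesis by (rule frac) simp
  qed
  then show "norm (real ((p + m - 1) choose (m - 1)) / real (2 * p + m) ^ Suc k) \<le> 1 / real (Suc p) ^ 2"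
    by simp
qed

text \<open>With \<open>u = 2 p + m\<close>, passing from \<open>m\<close> to \<open>m + 2\<close> multiplies the binomial coefficient
  by \<open>(u\<^sup>2 - m\<^sup>2) / (4 m (m + 1))\<close>.\<close>

lemma sinh_sum_step:
  assumes m: "1 \<le> m" and k: "m + 2 \<le> k"
  shows "4 * real m * real (m + 1) * sinh_sum k (m + 2) = sinh_sum (k - 2) m - real m ^ 2 * sinh_sum k m"
proof -
  let ?f = "\<lambda>p. real ((p + m - 1) choose (m - 1)) / real (2 * p + m) ^ Suc (k - 2) -
      real m ^ 2 * (real ((p + m - 1) choose (m - 1)) / real (2 * p + m) ^ Suc k)"
  have s: "?f sums (sinh_sum (k - 2) m - real m ^ 2 * sinh_sum k m)"
    unfolding sinh_sum_def using m k
    by (intro sums_diff sums_mult summable_sums summable_sinh_sum) auto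
  \<comment> \<open>For \<open>p = 0\<close> the base \<open>2 p + m\<close> equals \<open>m\<close>
    and the two parts cancel. So the sum may start at \<open>p = 1\<close>, and shifting
    \<open>p\<close> by one turns \<open>2 p + m\<close> into \<open>2 p + (m + 2)\<close>.\<close>
  have f0: "?f 0 = 0"
  proof -
    have "Suc k = 2 + Suc (k - 2)" using k by simp
    then have "real m ^ Suc k = real m ^ 2 * real m ^ Suc (k - 2)" by (metis power_add)
    then show ?thesis using m by (simp add: field_simps)
  qed
  have fS: "?f (Suc p) = 4 * real m * real (m + 1) * (real ((p + (m + 2) - 1) choose (m + 2 - 1)) / real (2 * p + (m + 2)) ^ Suc k)" for p
  proof -
    obtain n where n: "m = Suc n" using m by (cases m) auto
    let ?u = "real (2 * p + m + 2)"
    have e: "2 * Suc p + m = 2 * p + m + 2" "2 * p + (m + 2) = 2 * p + m + 2" by auto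
    have b: "4 * real m * real (m + 1) * real ((p + m + 1) choose (m + 1)) = (?u ^ 2 - real m ^ 2) * real ((p + m) choose (m - 1))"
    proof -
      have 1: "real (m + 1) * real ((p + m + 1) choose (m + 1)) = real (p + m + 1) * real ((p + m) choose m)"
        using Suc_times_binomial[of m "p + m"] by (simp del: of_nat_Suc of_nat_add flip: of_nat_mult) 
      have 2: "real m * real ((p + m) choose m) = real (Suc p) * real ((p + m) choose (m - 1))"
      proof -
        have "Suc n * ((p + m) choose (Suc n)) = ((p + m) choose n) * (p + m - n)"
          using binomial_absorb_comp[of "p + m" n] binomial_absorption[of n "p + m"]
          by (metis binomial_absorption binomial_absorb_comp mult.commute)
        then have "m * ((p + m) choose m) = Suc p * ((p + m) choose (m - 1))"
          by (simp add: n mult.commute)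
        then show ?thesis by (simp only: of_nat_mult[symmetric])
      qed
      have "4 * real m * real (m + 1) * real ((p + m + 1) choose (m + 1)) = 4 * real (p + m + 1) * (real m * real ((p + m) choose m))"
        by (simp only: 1 mult.assoc) (simp only: mult_ac)
      also have "\<dots> = 4 * real (p + m + 1) * real (Suc p) * real ((p + m) choose (m - 1))" by (simp only: 2 mult.assoc)
      \<comment> \<open>With \<open>u = 2 p + m + 2\<close> the two factors are
        \<open>(u + m) / 2\<close> and \<open>(u - m) / 2\<close>.\<close>
      also have "4 * real (p + m + 1) * real (Suc p) = ?u ^ 2 - real m ^ 2"
        by (simp add: power2_eq_square algebra_simps)
      finally show ?thesis .
    qed
    have k2: "?u ^ Suc k = ?u ^ 2 * ?u ^ Suc (k - 2)" using k by (simp add: power_add[symmetric] flip: power_Suc)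
    have u0: "?u > 0" by simp
    have "?f (Suc p) = real ((p + m) choose (m - 1)) / ?u ^ Suc (k - 2) - real m ^ 2 * (real ((p + m) choose (m - 1)) / ?u ^ Suc k)"
      by (simp only: e) (simp add: add.commute)
    also have "\<dots> = (?u ^ 2 - real m ^ 2) * real ((p + m) choose (m - 1)) / ?u ^ Suc k"
      unfolding k2 using u0 by (simp add: field_simps del: power_Suc)
    also have "\<dots> = 4 * real m * real (m + 1) * (real ((p + m + 1) choose (m + 1)) / ?u ^ Suc k)"
      unfolding b[symmetric] by simp
    finally show ?thesis by (simp only: e) simp
  qed
  from s have "(\<lambda>p. ?f (Suc p)) sums (sinh_sum (k - 2) m - real m ^ 2 * sinh_sum k m)"
    using f0 by (subst sums_Suc_iff) simp
  moreover have "(\<lambda>p. ?f (Suc p)) sums (4 * real m * real (m + 1) * sinh_sum k (m + 2))"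
    unfolding fS unfolding sinh_sum_def using m k
    by (intro sums_mult summable_sums summable_sinh_sum) auto
  ultimately show ?thesis using sums_unique2 by blast
qed

lemma nn_integral_power_exp:
  fixes u :: real assumes u: "u > 0"
  shows "(\<integral>\<^sup>+y. ennreal (y ^ k * exp (- u * y)) * indicator {0..} y \<partial>lborel) = ennreal (fact k / u ^ Suc k)"
proof -
  have "(\<integral>\<^sup>+y. ennreal (y ^ k * exp (- u * y)) * indicator {0..} y \<partial>lborel) =
     ennreal \<bar>1 / u\<bar> * (\<integral>\<^sup>+x. ennreal ((0 + 1 / u * x) ^ k * exp (- u * (0 + 1 / u * x))) * indicator {0..} (0 + 1 / u * x) \<partial>lborel)"
    by (rule nn_integral_real_affine) (use u in auto)
  also have "\<dots> = ennreal \<bar>1 / u\<bar> * (\<integral>\<^sup>+x. ennreal ((1 / u) ^ k) * (ennreal (x ^ k * exp (- x)) * indicator {0..} x) \<partial>lborel)"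
    using u by (intro arg_cong2[where f="(*)", OF refl nn_integral_cong])
      (auto simp: indicator_def ennreal_mult[symmetric] power_divide zero_le_divide_iff)
  also have "\<dots> = ennreal \<bar>1 / u\<bar> * (ennreal ((1 / u) ^ k) * ennreal (fact k))"
    by (subst nn_integral_cmult) (auto simp: nn_intergal_power_times_exp_Ici)
  also have "\<dots> = ennreal (fact k / u ^ Suc k)"
    using u by (simp add: ennreal_mult[symmetric] power_divide)
  finally show ?thesis .
qed

text \<open>The negative binomial series in \<open>exp (- 2 y)\<close>, applied to
  \<open>1 / sinh y = 2 exp (- y) / (1 - exp (- 2 y))\<close>.\<close>

lemma power_sinh_sums:
  fixes y :: real assumes y: "y > 0" and m: "m \<ge> 1"
  shows "(\<lambda>p. 2 ^ m * real ((p + m - 1) choose (m - 1)) * exp (- real (2 * p + m) * y)) sums (1 / sinh y ^ m)"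
proof -
  let ?z = "exp (- 2 * y)"
  obtain n where n: "m = Suc n" using m by (cases m) auto
  have z: "norm ?z < 1" using y by simp
  have "(\<lambda>p. ((real m + real p - 1) gchoose p) * ?z ^ p) sums (1 - ?z) powr (- real m)"
  proof -
    have "(\<lambda>p. ((- real m) gchoose p) * (- ?z) ^ p) sums (1 + (- ?z)) powr (- real m)"
      using z by (intro gen_binomial_real) auto
    moreover have "((- real m) gchoose p) * (- ?z) ^ p = ((real m + real p - 1) gchoose p) * ?z ^ p" for p
      by (simp add: gbinomial_minus power_minus[of ?z] mult.assoc[symmetric] power_mult_distrib[symmetric])
    ultimately show ?thesis by simp
  qed
  moreover have "((real m + real p - 1) gchoose p) = real ((p + m - 1) choose (m - 1))" for p
  proof -
    have "real m + real p - 1 = real (p + m - 1)" using m by simp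
    then have "((real m + real p - 1) gchoose p) = real ((p + m - 1) choose p)" by (simp only: binomial_gbinomial)
    also have "(p + m - 1) choose p = (p + m - 1) choose (m - 1)"
      by (subst binomial_symmetric) (auto simp: n)
    finally show ?thesis .
  qed
  ultimately have "(\<lambda>p. real ((p + m - 1) choose (m - 1)) * ?z ^ p) sums (1 - ?z) powr (- real m)" by simp
  from sums_mult[OF this, of "2 ^ m * exp (- real m * y)"]
  have "(\<lambda>p. 2 ^ m * exp (- real m * y) * (real ((p + m - 1) choose (m - 1)) * ?z ^ p)) sums (2 ^ m * exp (- real m * y) * (1 - ?z) powr (- real m))" .
  moreover have "2 ^ m * exp (- real m * y) * (real ((p + m - 1) choose (m - 1)) * ?z ^ p) =
     2 ^ m * real ((p + m - 1) choose (m - 1)) * exp (- real (2 * p + m) * y)" for p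
    by (simp add: exp_of_nat_mult[symmetric] exp_add[symmetric] algebra_simps)
  moreover have "2 ^ m * exp (- real m * y) * (1 - ?z) powr (- real m) = 1 / sinh y ^ m"
  proof -
    have z1: "1 - ?z > 0" using y by simp
    have s: "sinh y = exp y * (1 - ?z) / 2"
      by (simp add: sinh_def right_diff_distrib exp_add[symmetric] mult.commute)
    have "exp (- real m * y) = 1 / exp y ^ m" by (simp add: exp_of_nat_mult exp_minus divide_inverse)
    moreover have "(1 - ?z) powr (- real m) = 1 / (1 - ?z) ^ m"
      using z1 by (simp add: powr_minus powr_realpow divide_inverse)
    ultimately show ?thesis unfolding s using z1 by (simp add: power_mult_distrib power_divide)
  qed
  ultimately show ?thesis by (simp only:)
qed

text \<open>Termwise integration of the series for \<open>1 / sinh y ^ m\<close>; the terms are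
  nonnegative, so sum and integral may be exchanged.\<close>

lemma nn_integral_power_over_sinh:
  assumes m: "1 \<le> m"
  shows "(\<integral>\<^sup>+y. indicator {0<..} y * ennreal ((y / sinh y) ^ m) \<partial>lborel) = ennreal (2 ^ m * fact m * sinh_sum m m)"
proof -
  let ?c = "\<lambda>p. 2 ^ m * real ((p + m - 1) choose (m - 1))"
  let ?u = "\<lambda>p. real (2 * p + m)"
  have "(\<integral>\<^sup>+y. indicator {0<..} y * ennreal ((y / sinh y) ^ m) \<partial>lborel) =
     (\<integral>\<^sup>+y. (\<Sum>p. ennreal (?c p) * (ennreal (y ^ m * exp (- ?u p * y)) * indicator {0..} y)) \<partial>lborel)"
  proof (rule nn_integral_cong_AE, rule AE_mp[OF AE_lborel_singleton[of "0::real"]], rule AE_I2, rule impI)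
    fix y :: real assume y0: "y \<noteq> 0"
    show "indicator {0<..} y * ennreal ((y / sinh y) ^ m) =
      (\<Sum>p. ennreal (?c p) * (ennreal (y ^ m * exp (- ?u p * y)) * indicator {0..} y))"
    proof (cases "y > 0")
      case y: True
      have "(\<lambda>p. y ^ m * (?c p * exp (- ?u p * y))) sums (y ^ m * (1 / sinh y ^ m))"
        using power_sinh_sums[OF y m] by (rule sums_mult)
      then have "(\<Sum>p. ennreal (y ^ m * (?c p * exp (- ?u p * y)))) = ennreal (y ^ m * (1 / sinh y ^ m))"
        using y by (intro suminf_ennreal_eq) auto
      moreover have "ennreal (y ^ m * (?c p * exp (- ?u p * y))) = ennreal (?c p) * (ennreal (y ^ m * exp (- ?u p * y)) * indicator {0..} y)" for p
        using y by (simp add: ennreal_mult[symmetric] mult_ac)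
      ultimately show ?thesis using y by (simp add: power_divide)
    next
      case False
      with y0 show ?thesis by simp
    qed
  qed
  also have "\<dots> = (\<Sum>p. \<integral>\<^sup>+y. ennreal (?c p) * (ennreal (y ^ m * exp (- ?u p * y)) * indicator {0..} y) \<partial>lborel)"
    by (rule nn_integral_suminf) measurable
  also have "\<dots> = (\<Sum>p. ennreal (2 ^ m * fact m * (real ((p + m - 1) choose (m - 1)) / ?u p ^ Suc m)))"
  proof (intro arg_cong[where f=suminf] ext)
    fix p
    have "?u p > 0" using m by simp
    then show "(\<integral>\<^sup>+y. ennreal (?c p) * (ennreal (y ^ m * exp (- ?u p * y)) * indicator {0..} y) \<partial>lborel) =
       ennreal (2 ^ m * fact m * (real ((p + m - 1) choose (m - 1)) / ?u p ^ Suc m))"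
      by (subst nn_integral_cmult, measurable, subst nn_integral_power_exp) (simp_all add: ennreal_mult[symmetric] mult_ac)
  qed
  also have "\<dots> = ennreal (2 ^ m * fact m * sinh_sum m m)"
    unfolding sinh_sum_def
  proof (rule suminf_ennreal_eq)
    show "(\<lambda>p. 2 ^ m * fact m * (real ((p + m - 1) choose (m - 1)) / ?u p ^ Suc m)) sums
        (2 ^ m * fact m * (\<Sum>p. real ((p + m - 1) choose (m - 1)) / ?u p ^ Suc m))"
      by (intro sums_mult summable_sums summable_sinh_sum) (use m in auto)
  qed simp
  finally show ?thesis .
qed

section \<open>Laurent coefficients of the tanh and coth series\<close>

text \<open>The transcendental factor of \<open>A_series\<close> for odd \<open>k\<close>. It
  depends on \<open>n\<close> through its parity only, which is why the recursion goes in steps of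
  two.\<close>

definition tanh_series :: "nat \<Rightarrow> complex fls" where
  "tanh_series n = (if even n then laurent_expansion (\<lambda>z. tanh (of_real pi * z / 2)) 0
     else laurent_expansion (\<lambda>z. cosh (of_real pi * z / 2) / sinh (of_real pi * z / 2)) 0)"

text \<open>Of the two new candidates \<open>n\<close> and \<open>n + 1\<close>, only
  \<open>n + 1\<close> has parity opposite to \<open>n\<close>.\<close>

lemma Q_Suc_Suc:
  fixes x :: "'a::comm_ring_1"
  shows "Q (n + 2) x = Q n x * (1 + of_nat (n + 1) ^ 2 * x ^ 2)"
proof -
  have "{j. j \<in> {1..n + 2 - 1} \<and> j mod 2 \<noteq> (n + 2) mod 2} =
      insert (n + 1) {j. j \<in> {1..n - 1} \<and> j mod 2 \<noteq> n mod 2}"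
  proof (rule set_eqI)
    fix j :: nat
    have "j = n \<or> j = n + 1 \<or> j \<le> n - 1 \<or> j > n + 1" by linarith
    then show "j \<in> {j. j \<in> {1..n + 2 - 1} \<and> j mod 2 \<noteq> (n + 2) mod 2} \<longleftrightarrow>
        j \<in> insert (n + 1) {j. j \<in> {1..n - 1} \<and> j mod 2 \<noteq> n mod 2}"
      by (elim disjE) (auto simp: mod_Suc)
  qed
  note S = this
  show ?thesis
    unfolding Q_def S by (subst prod.insert) (auto simp: mult.commute)
qed

lemma Q_0 [simp]: "Q 0 x = 1" and Q_1 [simp]: "Q (Suc 0) x = 1"
  by (simp_all add: Q_def)

text \<open>The exponent \<open>l\<close> belongs to \<open>z = 1 / x\<close>, so
  \<open>A n (- 1)\<close> is read off at \<open>l = 1\<close>. Other exponents are included because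
  the recursion shifts \<open>l\<close>.\<close>

definition tanh_coeff :: "nat \<Rightarrow> int \<Rightarrow> complex" where
  "tanh_coeff n l = fls_nth (tanh_series n * Q n fls_X_inv) l"

text \<open>The new factor of \<open>Q\<close> is \<open>1 + (n + 1)^2 / z^2\<close>, and division
  by \<open>z^2\<close> shifts the coefficients by two.\<close>

lemma tanh_coeff_Suc_Suc:
  "tanh_coeff (n + 2) l = tanh_coeff n l + of_nat (n + 1) ^ 2 * tanh_coeff n (l + 2)"
proof -
  have "tanh_series (n + 2) = tanh_series n" by (simp add: tanh_series_def)
  then have "tanh_series (n + 2) * Q (n + 2) fls_X_inv =
     tanh_series n * Q n fls_X_inv + fls_const (of_nat (n + 1) ^ 2) * (fls_X_inv ^ 2 * (tanh_series n * Q n fls_X_inv))"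
    unfolding Q_Suc_Suc by (simp add: algebra_simps fls_of_nat fls_const_power fls_const_mult_const[symmetric])
  then show ?thesis
    unfolding tanh_coeff_def
    by (simp add: fls_X_inv_power_times_conv_shift)
qed

lemma A_eq_tanh_coeff: "A n (- 1) = Re (tanh_coeff n 1)"
  by (simp add: A_def A_series_def tanh_coeff_def tanh_series_def)

text \<open>The derivative of the reflection formula for \<open>rGamma\<close>, computed on both
  sides, with denominators cleared.\<close>

lemma Digamma_reflection:
  fixes z :: complex
  assumes z: "z \<notin> \<int>\<^sub>\<le>\<^sub>0" "1 - z \<notin> \<int>\<^sub>\<le>\<^sub>0"
  shows "of_real pi * cos (of_real pi * z) = sin (of_real pi * z) * (Digamma (1 - z) - Digamma z)"
proof -
  have "((\<lambda>z. rGamma z * rGamma (1 - z)) has_field_derivative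
      (rGamma z * rGamma (1 - z)) * (Digamma (1 - z) - Digamma z)) (at z)"
    using z by (auto intro!: derivative_eq_intros simp: algebra_simps)
  moreover have "((\<lambda>z. rGamma z * rGamma (1 - z)) has_field_derivative cos (of_real pi * z)) (at z)"
    unfolding rGamma_reflection_complex by (auto intro!: derivative_eq_intros)
  ultimately have "(rGamma z * rGamma (1 - z)) * (Digamma (1 - z) - Digamma z) = cos (of_real pi * z)"
    by (rule DERIV_unique)
  then show ?thesis unfolding rGamma_reflection_complex by (simp add: field_simps)
qed

text \<open>An odd function of \<open>z\<close>. Near 0 it is \<open>tanh (pi z / 2)\<close> for
  \<open>c = 1 / 2\<close>, and for \<open>c = 1\<close> it is \<open>coth (pi z / 2)\<close>
  without its pole; its Taylor coefficients are accessible through the polygamma functions.\<close>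

definition digamma_odd :: "complex \<Rightarrow> complex \<Rightarrow> complex" where
  "digamma_odd c z = (Digamma (c + \<i> / 2 * z) - Digamma (c + (- \<i> / 2) * z)) * (1 / (\<i> * of_real pi))"

definition digamma_odd_fps :: "complex \<Rightarrow> complex fps" where
  "digamma_odd_fps c =
    (fps_compose (fps_expansion Digamma c) (fps_const (\<i> / 2) * fps_X)
      - fps_compose (fps_expansion Digamma c) (fps_const (- \<i> / 2) * fps_X)) * fps_const (1 / (\<i> * of_real pi))"

lemma Re_pos_not_nonpos_Int: "Re z > 0 \<Longrightarrow> z \<notin> \<int>\<^sub>\<le>\<^sub>0"
  by (auto elim!: nonpos_Ints_cases)

lemma digamma_odd_has_fps_expansion:
  assumes "Re c > 0"
  shows "digamma_odd c has_fps_expansion digamma_odd_fps c"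
proof -
  have "Digamma analytic_on {c}"
    using assms by (intro analytic_on_Polygamma) (auto dest: Re_pos_not_nonpos_Int)
  then have D: "(\<lambda>x. Digamma (c + x)) has_fps_expansion fps_expansion Digamma c"
    by (rule analytic_at_imp_has_fps_expansion)
  have L: "(\<lambda>z. k * z) has_fps_expansion fps_const k * fps_X" for k :: complex
    by (intro fps_expansion_intros)
  have C: "(\<lambda>z. Digamma (c + k * z)) has_fps_expansion fps_compose (fps_expansion Digamma c) (fps_const k * fps_X)" for k
    using has_fps_expansion_compose[OF D L[of k]] by (simp add: o_def)
  show ?thesis
    unfolding digamma_odd_def[abs_def] digamma_odd_fps_def
    by (intro fps_expansion_intros C)
qed

text \<open>For odd \<open>l\<close> the Taylor coefficient of the digamma function at
  \<open>c\<close> is the sum of \<open>1 / (c + k) ^ (l + 1)\<close> over \<open>k\<close>. The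
  \<open>l\<close>-th powers of \<open>\<i> / 2\<close> and \<open>- \<i> / 2\<close> have opposite
  signs, so the two compositions reinforce each other.\<close>

lemma fps_nth_digamma_odd_fps:
  assumes c: "c > 0" 
  shows "fps_nth (digamma_odd_fps (of_real c)) (2 * i + 1) =
    of_real (2 / pi * (- 1) ^ i * (1 / 2) ^ (2 * i + 1) * (\<Sum>k. 1 / (c + real k) ^ (2 * i + 2)))"
proof -
  define l where "l = 2 * i + 1"
  have l: "odd l" "l \<noteq> 0" "Suc l = 2 * i + 2" by (auto simp: l_def)
  define S where "S = (\<Sum>k. 1 / (c + real k) ^ Suc l)"
  have np: "complex_of_real c \<notin> \<int>\<^sub>\<le>\<^sub>0" using c by (intro Re_pos_not_nonpos_Int) simp
  have "(deriv ^^ l) Digamma (complex_of_real c) = Polygamma l (complex_of_real c)"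
    using higher_deriv_Polygamma[OF np, of l 0] by simp
  also have "\<dots> = of_real (Polygamma l c)" using c by (intro Polygamma_of_real) simp
  also have "Polygamma l c = fact l * S"
    using l by (simp add: Polygamma_def S_def inverse_eq_divide del: power_Suc)
  finally have D: "fps_nth (fps_expansion Digamma (complex_of_real c)) l = of_real S"
    by (simp add: fps_expansion_def)
  have "\<i> ^ l = \<i> * (- 1) ^ i" by (simp add: l_def power_mult)
  then have p: "(\<i> / 2) ^ l = \<i> * (- 1) ^ i * (1 / 2) ^ l" by (simp add: power_divide)
  have I: "(\<i> / 2) ^ l - (- \<i> / 2) ^ l = 2 * (\<i> * (- 1) ^ i * (1 / 2) ^ l)"
    using power_minus_odd[OF l(1), of "\<i> / 2"] by (simp add: p)
  have "fps_nth (digamma_odd_fps (of_real c)) l = ((\<i> / 2) ^ l - (- \<i> / 2) ^ l) * of_real S * (1 / (\<i> * of_real pi))"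
    unfolding digamma_odd_fps_def
    by (simp only: fps_compose_linear fps_mult_right_const_nth fps_sub_nth fps_nth_Abs_fps D left_diff_distrib)
  also have "\<dots> = of_real (2 / pi * (- 1) ^ i * (1 / 2) ^ l * S)"
    unfolding I by (simp add: field_simps)
  finally show ?thesis by (simp only: l_def S_def l(3)[unfolded l_def])
qed

text \<open>Reflection at \<open>1 / 2 + \<i> / 2 * z\<close>, where the sine becomes
  \<open>cosh\<close> and the cosine a multiple of \<open>sinh\<close>. The bound on
  \<open>z\<close> keeps both digamma arguments in the right half-plane.\<close>

lemma tanh_eq_digamma_odd:
  assumes z: "norm z < 1" and c: "cosh (of_real pi * z / 2) \<noteq> 0"
  shows "tanh (of_real pi * z / 2) = digamma_odd (1 / 2) z"
proof -
  let ?w = "\<i> / 2 * z" and ?a = "of_real pi * z / 2"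
  have "\<bar>Im z\<bar> < 1" using z abs_Im_le_cmod[of z] by linarith
  then have "1 / 2 + ?w \<notin> \<int>\<^sub>\<le>\<^sub>0" "1 - (1 / 2 + ?w) \<notin> \<int>\<^sub>\<le>\<^sub>0"
    by (auto intro!: Re_pos_not_nonpos_Int)
  from Digamma_reflection[OF this]
  have "of_real pi * cos (of_real pi / 2 + \<i> * ?a) = sin (of_real pi / 2 + \<i> * ?a) * (Digamma (1 / 2 + (- \<i> / 2) * z) - Digamma (1 / 2 + ?w))"
    by (simp add: algebra_simps)
  moreover have "cos (of_real pi / 2 + \<i> * ?a) = - \<i> * sinh ?a" 
    by (simp add: cos_add sinh_conv_sin)
  moreover have "sin (of_real pi / 2 + \<i> * ?a) = cosh ?a" 
    by (simp add: sin_add cosh_conv_cos)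
  ultimately have "of_real pi * (\<i> * sinh ?a) = cosh ?a * (Digamma (1 / 2 + ?w) - Digamma (1 / 2 + (- \<i> / 2) * z))"
    by (simp add: algebra_simps)
  then show ?thesis using c by (simp add: tanh_def digamma_odd_def field_simps)
qed

text \<open>Reflection at \<open>\<i> / 2 * z\<close>. The digamma function has a pole at 0, and its
  shift by one splits off the term \<open>2 / (pi z)\<close>.\<close>

lemma coth_eq_digamma_odd:
  assumes z: "norm z < 1" "z \<noteq> 0" and c: "cosh (of_real pi * z / 2) \<noteq> 0"
  shows "cosh (of_real pi * z / 2) / sinh (of_real pi * z / 2) = digamma_odd 1 z + 2 / of_real pi * inverse z"
proof -
  let ?w = "\<i> / 2 * z" and ?a = "of_real pi * z / 2"
  have im: "\<bar>Im z\<bar> < 1" using z abs_Im_le_cmod[of z] by linarith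
  have w0: "?w \<notin> \<int>\<^sub>\<le>\<^sub>0"
  proof
    assume "?w \<in> \<int>\<^sub>\<le>\<^sub>0"
    then obtain n where n: "?w = of_int n" by (auto elim!: nonpos_Ints_cases)
    have "norm ?w < 1 / 2" using z by (simp add: norm_mult norm_divide)
    then have "\<bar>real_of_int n\<bar> < 1 / 2" unfolding n by simp
    then have "n = 0" by linarith
    with n z show False by simp
  qed
  have "1 - ?w \<notin> \<int>\<^sub>\<le>\<^sub>0" using im by (auto intro!: Re_pos_not_nonpos_Int)
  note R = Digamma_reflection[OF w0 this]
  moreover have "cos (\<i> * ?a) = cosh ?a" "sin (\<i> * ?a) = \<i> * sinh ?a"
    by (simp_all add: cosh_conv_cos sinh_conv_sin)
  moreover have "Digamma ?w = Digamma (1 + ?w) - 1 / ?w"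
    using Digamma_plus1[of ?w] z by (simp add: add.commute)
  moreover have "of_real pi * ?w = \<i> * ?a" "1 - ?w = 1 + (- \<i> / 2) * z" by simp_all
  ultimately have eq: "of_real pi * cosh ?a = \<i> * sinh ?a * (Digamma (1 + (- \<i> / 2) * z) - Digamma (1 + ?w) + 1 / ?w)"
    by (simp only: diff_diff_eq2 diff_add_eq)
  \<comment> \<open>The identity expresses \<open>cosh ?a\<close> as a multiple of
    \<open>sinh ?a\<close>, so a nonzero \<open>cosh ?a\<close> forces a nonzero
    \<open>sinh ?a\<close>.\<close>
  then have s: "sinh ?a \<noteq> 0" using c by auto
  have "cosh ?a / sinh ?a = \<i> * (Digamma (1 + (- \<i> / 2) * z) - Digamma (1 + ?w) + 1 / ?w) / of_real pi"
    using eq s by (simp add: field_simps)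
  also have "\<dots> = digamma_odd 1 z + 2 / of_real pi * inverse z"
    using z by (simp add: digamma_odd_def field_simps)
  finally show ?thesis .
qed

text \<open>The digamma formulas hold in a punctured neighbourhood of 0, and this determines the
  Laurent expansion.\<close>

lemma tanh_series_eq:
  "tanh_series n = (if even n then fps_to_fls (digamma_odd_fps (1 / 2))
     else fps_to_fls (digamma_odd_fps 1) + fls_const (2 / of_real pi) * fls_X_inv)"
proof -
  have "((\<lambda>z::complex. cosh (of_real pi * z / 2)) \<longlongrightarrow> cosh (of_real pi * 0 / 2)) (at 0)"
    by (intro tendsto_intros) simp_all
  then have c: "eventually (\<lambda>z::complex. cosh (of_real pi * z / 2) \<noteq> 0) (at 0)"
    by (rule tendsto_imp_eventually_ne) simp
  have n1: "eventually (\<lambda>z::complex. norm z < 1) (at 0)"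
    using eventually_at_in_open'[of "ball 0 1" 0] by (auto elim!: eventually_mono)
  have n0: "eventually (\<lambda>z::complex. z \<noteq> 0) (at 0)" by (simp add: eventually_at_filter)
  show ?thesis
  proof (cases "even n")
    case True
    have "digamma_odd (1 / 2) has_laurent_expansion fps_to_fls (digamma_odd_fps (1 / 2))"
      by (intro has_laurent_expansion_fps digamma_odd_has_fps_expansion) simp
    also have "?this \<longleftrightarrow> (\<lambda>z. tanh (of_real pi * z / 2)) has_laurent_expansion fps_to_fls (digamma_odd_fps (1 / 2))"
    proof (rule has_laurent_expansion_cong[OF _ refl])
      show "eventually (\<lambda>z. digamma_odd (1 / 2) z = tanh (of_real pi * z / 2)) (at 0)"
        using c n1 by eventually_elim (simp add: tanh_eq_digamma_odd)
    qed
    finally show ?thesis using True by (simp add: tanh_series_def laurent_expansion_0_eqI)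
  next
    case False
    have "(\<lambda>z. digamma_odd 1 z + 2 / of_real pi * inverse z) has_laurent_expansion
        fps_to_fls (digamma_odd_fps 1) + fls_const (2 / of_real pi) * fls_X_inv"
      by (intro has_laurent_expansion_add has_laurent_expansion_fps digamma_odd_has_fps_expansion
          has_laurent_expansion_cmult_left has_laurent_expansion_fls_X_inv) simp
    also have "?this \<longleftrightarrow> (\<lambda>z. cosh (of_real pi * z / 2) / sinh (of_real pi * z / 2)) has_laurent_expansion
        fps_to_fls (digamma_odd_fps 1) + fls_const (2 / of_real pi) * fls_X_inv"
    proof (rule has_laurent_expansion_cong[OF _ refl])
      show "eventually (\<lambda>z. digamma_odd 1 z + 2 / of_real pi * inverse z =
          cosh (of_real pi * z / 2) / sinh (of_real pi * z / 2)) (at 0)"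
        using c n1 n0 by eventually_elim (rule coth_eq_digamma_odd[symmetric])
    qed
    finally show ?thesis using False by (simp add: tanh_series_def laurent_expansion_0_eqI)
  qed
qed

text \<open>All positive odd exponents are treated at once, since the step to \<open>n + 2\<close>
  uses the coefficient two places higher. There the sign \<open>(- 1) ^ i\<close> flips, which
  yields the minus sign in \<open>sinh_sum_step\<close>.\<close>

lemma tanh_coeff_eq:
  "tanh_coeff n (2 * int i + 1) =
    of_real (2 / pi * (- 1) ^ i * 2 ^ (n + 1) * fact n * sinh_sum (n + 1 + 2 * i) (n + 1))"
proof (induction n arbitrary: i rule: induct_nat_012)
  case 0
  have nn: "nat (2 * int i + 1) = 2 * i + 1" by simp
  \<comment> \<open>Doubling \<open>1 / 2 + k\<close> gives the odd numbers \<open>2 k + 1\<close>;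
    this is \<open>m = 1\<close>, where all binomial coefficients are 1.\<close>
  have "(\<Sum>k. 1 / (1 / 2 + real k) ^ (2 * i + 2)) = (\<Sum>k. 2 ^ (2 * i + 2) * (1 / real (2 * k + 1) ^ (2 * i + 2)))"
  proof (intro arg_cong[where f=suminf] ext)
    fix k have "1 / 2 + real k = real (2 * k + 1) / 2" by simp
    then show "1 / (1 / 2 + real k) ^ (2 * i + 2) = 2 ^ (2 * i + 2) * (1 / real (2 * k + 1) ^ (2 * i + 2))"
      by (simp only: power_divide) simp
  qed
  also have "\<dots> = 2 ^ (2 * i + 2) * sinh_sum (2 * i + 1) 1"
    unfolding sinh_sum_def using summable_sinh_sum[of 1 "2 * i + 1"]
    by (subst suminf_mult) simp_all
  finally have "fps_nth (digamma_odd_fps (1 / 2)) (2 * i + 1) = of_real (2 / pi * (- 1) ^ i * (1 / 2) ^ (2 * i + 1) * (2 ^ (2 * i + 2) * sinh_sum (2 * i + 1) 1))"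
    using fps_nth_digamma_odd_fps[of "1 / 2" i] by (simp only: of_real_divide of_real_1 of_real_numeral)
  also have "2 / pi * (- 1) ^ i * (1 / 2) ^ (2 * i + 1) * (2 ^ (2 * i + 2) * sinh_sum (2 * i + 1) 1) =
      2 / pi * (- 1) ^ i * (2 * sinh_sum (2 * i + 1) 1)"
    by (simp add: power_divide)
  finally show ?case by (simp add: tanh_coeff_def tanh_series_eq nn mult.assoc)
next
  case 1
  have nn: "nat (2 * int i + 1) = 2 * i + 1" by simp
  \<comment> \<open>For \<open>m = 2\<close> the binomial coefficient is \<open>k + 1\<close>, half
    of \<open>2 k + 2\<close>; it accounts for the additional power in the denominator. The pole of
    \<open>coth\<close> has exponent \<open>- 1\<close> and does not meet the exponent
    \<open>2 i + 1\<close>.\<close>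
  have "(\<Sum>k. 1 / (1 + real k) ^ (2 * i + 2)) = (\<Sum>k. 2 ^ (2 * i + 3) * (real ((k + 2 - 1) choose (2 - 1)) / real (2 * k + 2) ^ Suc (2 * i + 2)))"
  proof (intro arg_cong[where f=suminf] ext)
    fix k
    have e: "real (2 * k + 2) = 2 * (1 + real k)" "Suc (2 * i + 2) = 2 * i + 3" by simp_all
    have p: "(1 + real k) ^ (2 * i + 3) = (1 + real k) * (1 + real k) ^ (2 * i + 2)"
      by (simp add: numeral_3_eq_3)
    have "1 + real k \<noteq> 0" by (metis of_nat_Suc of_nat_eq_0_iff nat.distinct(1))
    then show "1 / (1 + real k) ^ (2 * i + 2) = 2 ^ (2 * i + 3) * (real ((k + 2 - 1) choose (2 - 1)) / real (2 * k + 2) ^ Suc (2 * i + 2))"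
      unfolding e power_mult_distrib p by simp
  qed
  also have "\<dots> = 2 ^ (2 * i + 3) * sinh_sum (2 * i + 2) 2"
    unfolding sinh_sum_def by (rule suminf_mult) (rule summable_sinh_sum, auto)
  finally have "fps_nth (digamma_odd_fps 1) (2 * i + 1) = of_real (2 / pi * (- 1) ^ i * (1 / 2) ^ (2 * i + 1) * (2 ^ (2 * i + 3) * sinh_sum (2 * i + 2) 2))"
    using fps_nth_digamma_odd_fps[of 1 i] by (simp only: of_real_1)
  also have "2 / pi * (- 1) ^ i * (1 / 2) ^ (2 * i + 1) * (2 ^ (2 * i + 3) * sinh_sum (2 * i + 2) 2) =
      2 / pi * (- 1) ^ i * (4 * sinh_sum (2 * i + 2) 2)"
    by (simp add: power_divide numeral_3_eq_3)
  finally show ?case by (simp add: tanh_coeff_def tanh_series_eq nn mult.assoc numeral_2_eq_2)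
next
  case (ge2 n)
  let ?C = "2 / pi * (- 1) ^ i * 2 ^ (n + 1) * fact n :: real"
  have l: "2 * int i + 1 + 2 = 2 * int (Suc i) + 1" by simp
  have "tanh_coeff (Suc (Suc n)) (2 * int i + 1) = tanh_coeff n (2 * int i + 1) + of_nat (n + 1) ^ 2 * tanh_coeff n (2 * int (Suc i) + 1)"
    using tanh_coeff_Suc_Suc[of n "2 * int i + 1"] unfolding l by simp
  also have "\<dots> = of_real (?C * (sinh_sum (n + 1 + 2 * i) (n + 1) - real (n + 1) ^ 2 * sinh_sum (n + 1 + 2 * Suc i) (n + 1)))"
    unfolding ge2.IH(1) by (simp add: algebra_simps)
  also have "sinh_sum (n + 1 + 2 * i) (n + 1) - real (n + 1) ^ 2 * sinh_sum (n + 1 + 2 * Suc i) (n + 1) =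
      4 * real (n + 1) * real (n + 2) * sinh_sum (n + 1 + 2 * Suc i) (n + 3)"
    using sinh_sum_step[of "n + 1" "n + 1 + 2 * Suc i"] by (simp add: numeral_3_eq_3)
  also have "?C * \<dots> = 2 / pi * (- 1) ^ i * 2 ^ (Suc (Suc n) + 1) * fact (Suc (Suc n)) * sinh_sum (Suc (Suc n) + 1 + 2 * i) (Suc (Suc n) + 1)"
    by (simp add: field_simps numeral_3_eq_3)
  finally show ?case .
qed

text \<open>The case \<open>i = 0\<close> of \<open>tanh_coeff_eq\<close> for
  \<open>n = m - 1\<close>; the factor \<open>m\<close> turns \<open>fact (m - 1)\<close> into
  \<open>fact m\<close>.\<close>

lemma sinh_sum_eq_A:
  assumes "m \<ge> 1"
  shows "2 ^ m * fact m * sinh_sum m m = pi / 2 * real m * A (m - 1) (- 1)"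
proof -
  obtain n where n: "m = Suc n" using assms by (cases m) auto
  have "A n (- 1) = 2 / pi * 2 ^ (n + 1) * fact n * sinh_sum (n + 1) (n + 1)"
    unfolding A_eq_tanh_coeff using tanh_coeff_eq[of n 0] by simp
  then show ?thesis by (simp add: n)
qed

section \<open>The probability\<close>

lemma prob_space_uniform_half_sphere: "prob_space (uniform_half_sphere i0)" for i0 :: "'n::finite"
proof -
  let ?N = "sqrt (2 * pi) ^ CARD('n)"
  have N: "?N > 0" by simp
  have "emeasure (half_gauss i0) (space (half_gauss i0)) =
     (\<integral>\<^sup>+x. ennreal (2 / ?N) * (ennreal (gauss x) * indicator {x. x $ i0 \<ge> 0} x) \<partial>(lborel :: (real^'n) measure))"
  proof -
    have "ennreal (2 / ?N * gauss x) = ennreal (2 / ?N) * ennreal (gauss x)" for x :: "real^'n"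
      by (rule ennreal_mult) auto
    then show ?thesis
      unfolding half_gauss_def
      by (subst emeasure_density) (auto simp only: mult.assoc intro!: nn_integral_cong, auto)
  qed
  also have "\<dots> = ennreal (2 / ?N) * ennreal (?N / 2)"
    by (subst nn_integral_cmult) (auto simp: nn_integral_gauss_half_space)
  also have "\<dots> = 1" using N by (subst ennreal_mult[symmetric]) auto
  finally have "prob_space (half_gauss i0)" by (rule prob_spaceI)
  then show ?thesis
    unfolding uniform_half_sphere_eq by (rule prob_space.prob_space_distr) (simp add: half_gauss_def)
qed

definition half_gauss_density :: "'n \<Rightarrow> real ^ 'n \<Rightarrow> ennreal" where
  "half_gauss_density i0 x = ennreal (2 / sqrt (2 * pi) ^ CARD('n) * gauss x) * indicator {x. x $ i0 \<ge> 0} x"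

lemma borel_measurable_half_gauss_density [measurable]:
  "half_gauss_density i0 \<in> borel_measurable borel" for i0 :: "'n::finite"
  unfolding half_gauss_density_def by measurable

lemma nn_integral_uniform_half_sphere:
  fixes i0 :: "'n::finite"
  assumes [measurable]: "f \<in> borel_measurable borel"
  shows "(\<integral>\<^sup>+x. f x \<partial>uniform_half_sphere i0) = (\<integral>\<^sup>+x. half_gauss_density i0 x * f (sgn x) \<partial>lborel)"
proof -
  have "half_gauss i0 = density lborel (half_gauss_density i0)"
    by (simp add: half_gauss_def half_gauss_density_def[abs_def])
  then show ?thesis
    unfolding uniform_half_sphere_eq
    by (simp only:) (subst nn_integral_distr, auto simp: nn_integral_density)
qed

text \<open>Independent uniform points are the directions of independent Gaussian rows conditioned
  on the half-space. It is enough to compare product sets, where both sides factorise.\<close>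

lemma nn_integral_PiM_uniform_half_sphere:
  fixes i0 :: "'n::finite" and f :: "('n \<Rightarrow> real ^ 'n) \<Rightarrow> ennreal"
  assumes [measurable]: "f \<in> borel_measurable (PiM UNIV (\<lambda>_. borel))"
  shows "(\<integral>\<^sup>+u. f u \<partial>PiM UNIV (\<lambda>_. uniform_half_sphere i0)) =
    (\<integral>\<^sup>+Z. (\<Prod>k\<in>UNIV. half_gauss_density i0 (Z $ k)) * f (\<lambda>k. sgn (Z $ k)) \<partial>(lborel :: (real^'n^'n) measure))"
proof -
  let ?U = "uniform_half_sphere i0" and ?B = "PiM UNIV (\<lambda>_::'n. borel :: (real^'n) measure)"
  let ?w = "\<lambda>Z :: real^'n^'n. \<Prod>k\<in>UNIV. half_gauss_density i0 (Z $ k)"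
  let ?T = "\<lambda>Z (k::'n). sgn (Z $ k :: real^'n)"
  interpret prob_space ?U by (rule prob_space_uniform_half_sphere)
  interpret product_sigma_finite "\<lambda>_::'n. ?U"
    by (simp add: product_sigma_finite_def sigma_finite_measure_axioms)
  have sU: "sets ?U = sets borel" by (simp add: uniform_half_sphere_def)
  have T[measurable]: "?T \<in> borel \<rightarrow>\<^sub>M ?B"
    by (rule measurable_PiM_single') (auto simp: space_PiM)
  have sB: "sets ?B = sets (PiM UNIV (\<lambda>_. ?U))" by (rule sets_PiM_cong) (simp_all add: sU)
  have "distr (density lborel ?w) ?B ?T = PiM UNIV (\<lambda>_. ?U)"
  proof (rule PiM_eqI)
    fix C :: "'n \<Rightarrow> (real^'n) set" assume "\<And>i. i \<in> UNIV \<Longrightarrow> C i \<in> sets ?U"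
    then have C[measurable]: "C i \<in> sets borel" for i by (simp add: sU)
    have [measurable]: "Pi\<^sub>E UNIV C \<in> sets ?B" by (rule sets_PiM_I_finite) auto
    have "emeasure (distr (density lborel ?w) ?B ?T) (Pi\<^sub>E UNIV C) =
       (\<integral>\<^sup>+Z. indicator (Pi\<^sub>E UNIV C) (?T Z) \<partial>density lborel ?w)"
      by (subst nn_integral_indicator[symmetric], simp, subst nn_integral_distr) auto
    also have "\<dots> = (\<integral>\<^sup>+Z. ?w Z * indicator (Pi\<^sub>E UNIV C) (?T Z) \<partial>lborel)"
      by (rule nn_integral_density) measurable
    also have "\<dots> = (\<integral>\<^sup>+Z. (\<Prod>k\<in>UNIV. half_gauss_density i0 (Z $ k) * indicator (C k) (sgn (Z $ k))) \<partial>(lborel :: (real^'n^'n) measure))"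
    proof (rule nn_integral_cong)
      fix Z :: "real^'n^'n"
      have "indicator (Pi\<^sub>E UNIV C) (?T Z) = (\<Prod>k\<in>UNIV. indicator (C k) (sgn (Z $ k)) :: ennreal)"
        by (auto simp: indicator_def PiE_iff prod_eq_1_iff intro!: prod_zero[symmetric])
      then show "?w Z * indicator (Pi\<^sub>E UNIV C) (?T Z) = (\<Prod>k\<in>UNIV. half_gauss_density i0 (Z $ k) * indicator (C k) (sgn (Z $ k)))"
        by (simp only: prod.distrib)
    qed
    also have "\<dots> = (\<Prod>k\<in>UNIV. \<integral>\<^sup>+x. half_gauss_density i0 x * indicator (C k) (sgn x) \<partial>lborel)"
      by (rule nn_integral_lborel_vec_prod) measurable
    also have "\<dots> = (\<Prod>k\<in>UNIV. emeasure ?U (C k))"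
      by (intro prod.cong refl, subst nn_integral_uniform_half_sphere[symmetric])
         (auto simp: sU)
    finally show "emeasure (distr (density lborel ?w) ?B ?T) (Pi\<^sub>E UNIV C) = (\<Prod>k\<in>UNIV. emeasure ?U (C k))" .
  qed (auto simp: sB)
  then have "(\<integral>\<^sup>+u. f u \<partial>PiM UNIV (\<lambda>_. ?U)) = (\<integral>\<^sup>+u. f u \<partial>distr (density lborel ?w) ?B ?T)" by simp
  also have "\<dots> = (\<integral>\<^sup>+Z. ?w Z * f (?T Z) \<partial>lborel)"
    by (subst nn_integral_distr) (auto simp: nn_integral_density)
  finally show ?thesis .
qed

section \<open>The event that one point lies in the cone of the others\<close>

text \<open>The rows of \<open>Z\<close> span a simplicial cone and \<open>x\<close> is the further
  point; invertibility of \<open>Z\<close> makes the coefficients \<open>c\<close> unique.\<close>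

definition simplex_pairs :: "((real ^ 'n ^ 'n) \<times> (real ^ 'n)) set" where
  "simplex_pairs = {(Z, x). det Z \<noteq> 0 \<and> (\<exists>c. (\<forall>k. c $ k \<ge> 0) \<and> x = c v* Z)}"

text \<open>Cramer's rule. It eliminates the existential quantifier over \<open>c\<close>, which
  makes the set visibly Borel.\<close>

lemma mem_simplex_pairs_iff:
  "(Z, x) \<in> simplex_pairs \<longleftrightarrow> det Z \<noteq> 0 \<and> (\<forall>k. det (\<chi> i. if i = k then x else Z $ i) / det Z \<ge> 0)"
  for Z :: "real ^ 'n ^ 'n"
proof -
  have cr: "det (\<chi> i. if i = k then c v* Z else Z $ i) = c $ k * det Z" for c k
    using cramer_lemma_transpose[of k c Z]
    by (simp add: vector_matrix_mult_eq_sum row_def vec_lambda_eta scalar_mult_eq_scaleR cong: if_cong)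
  have ex: "\<exists>c. x = c v* Z" if "det Z \<noteq> 0"
  proof -
    from that have "det (transpose Z) \<noteq> 0" by (simp add: det_transpose)
    then obtain B where "\<And>x. transpose Z *v (B *v x) = x" using matrix_vector_mult_inverse_cancel by metis
    then have "x = (B *v x) v* Z" by simp
    then show ?thesis by blast
  qed
  show ?thesis
  proof (cases "det Z = 0")
    case True
    then show ?thesis by (simp add: simplex_pairs_def)
  next
    case False
    then obtain c where c: "x = c v* Z" using ex by blast
    have "c' = c" if "x = c' v* Z" for c'
    proof (rule vec_eq_iff[THEN iffD2], rule allI)
      fix k
      have "c' v* Z = c v* Z" using that c by (rule subst)
      then have "c' $ k * det Z = c $ k * det Z" unfolding cr[symmetric] by (simp only:)
      with False show "c' $ k = c $ k" by simp
    qed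
    then have "(\<exists>c'. (\<forall>k. c' $ k \<ge> 0) \<and> x = c' v* Z) \<longleftrightarrow> (\<forall>k. c $ k \<ge> 0)"
      using c by metis
    then show ?thesis using False by (simp add: simplex_pairs_def) (simp add: c cr cong: if_cong)
  qed
qed

lemma simplex_pairs_borel [measurable]: "(simplex_pairs :: ((real ^ 'n ^ 'n) \<times> (real ^ 'n)) set) \<in> sets (borel \<Otimes>\<^sub>M borel)"
proof -
  have [measurable]: "(\<lambda>p. (\<chi> i. if i = k then snd p else fst p $ i) :: real^'n^'n) \<in> borel_measurable (borel \<Otimes>\<^sub>M borel)" for k :: 'n
  proof (intro borel_measurable_vec_lambda)
    fix i show "(\<lambda>p :: (real^'n^'n) \<times> (real^'n). if i = k then snd p else fst p $ i) \<in> borel_measurable (borel \<Otimes>\<^sub>M borel)"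
      by (cases "i = k") (simp_all, measurable)
  qed
  have "simplex_pairs = {p \<in> space (borel \<Otimes>\<^sub>M borel). det (fst p :: real^'n^'n) \<noteq> 0 \<and>
      (\<forall>k. det (\<chi> i. if i = k then snd p else fst p $ i) / det (fst p) \<ge> 0)}"
    by (rule set_eqI, case_tac x) (simp add: mem_simplex_pairs_iff space_pair_measure cong: if_cong)
  also have "\<dots> \<in> sets (borel \<Otimes>\<^sub>M borel)" by measurable
  finally show ?thesis .
qed

lemma det_sgn_rows: "det (\<chi> k. sgn (Z $ k)) = (\<Prod>k\<in>UNIV. inverse (norm (Z $ k))) * det Z" for Z :: "real ^ 'n ^ 'n"
  using det_rows_mul[of "\<lambda>k. inverse (norm (Z $ k))" "\<lambda>k. Z $ k"]
  by (simp add: sgn_div_norm scalar_mult_eq_scaleR vec_lambda_eta)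

lemma row_nonzero: "det Z \<noteq> 0 \<Longrightarrow> Z $ k \<noteq> 0" for Z :: "real ^ 'n ^ 'n"
  using det_zero_row(2)[of k Z] by (auto simp: row_def vec_lambda_eta)

lemma det_sgn_rows_eq_0_iff: "det (\<chi> k. sgn (Z $ k)) = 0 \<longleftrightarrow> det Z = 0" for Z :: "real ^ 'n ^ 'n"
  using row_nonzero[of Z] by (auto simp: det_sgn_rows)

text \<open>Membership depends on directions only, since positive factors can be absorbed into the
  coefficients. This is what permits Gaussian vectors in place of unit vectors.\<close>

lemma simplex_pairs_sgn_iff:
  "((\<chi> k. sgn (Z $ k)), sgn x) \<in> simplex_pairs \<longleftrightarrow> (Z, x) \<in> simplex_pairs" for Z :: "real ^ 'n ^ 'n"
proof (cases "det Z = 0")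
  case True
  then show ?thesis by (simp add: simplex_pairs_def det_sgn_rows_eq_0_iff)
next
  case False
  then have n: "norm (Z $ k) > 0" for k using row_nonzero by auto
  have "(\<exists>c. (\<forall>k. c $ k \<ge> 0) \<and> sgn x = c v* (\<chi> k. sgn (Z $ k))) \<longleftrightarrow> (\<exists>c. (\<forall>k. c $ k \<ge> 0) \<and> x = c v* Z)"
  proof
    assume "\<exists>c. (\<forall>k. c $ k \<ge> 0) \<and> sgn x = c v* (\<chi> k. sgn (Z $ k))"
    then obtain c where c: "\<forall>k. c $ k \<ge> 0" "sgn x = (\<Sum>k\<in>UNIV. c $ k *\<^sub>R sgn (Z $ k))"
      by (auto simp: vector_matrix_mult_eq_sum)
    have "x = norm x *\<^sub>R sgn x" by (cases "x = 0") (simp_all add: sgn_div_norm)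
    also have "\<dots> = (\<Sum>k\<in>UNIV. (norm x * c $ k / norm (Z $ k)) *\<^sub>R (Z $ k))"
      unfolding c(2) by (simp add: scaleR_sum_right sgn_div_norm divide_inverse mult.assoc)
    finally show "\<exists>c. (\<forall>k. c $ k \<ge> 0) \<and> x = c v* Z"
      using c by (intro exI[of _ "\<chi> k. norm x * c $ k / norm (Z $ k)"]) (auto simp: vector_matrix_mult_eq_sum)
  next
    assume "\<exists>c. (\<forall>k. c $ k \<ge> 0) \<and> x = c v* Z"
    then obtain c where c: "\<forall>k. c $ k \<ge> 0" "x = (\<Sum>k\<in>UNIV. c $ k *\<^sub>R (Z $ k))"
      by (auto simp: vector_matrix_mult_eq_sum)
    have "sgn x = inverse (norm x) *\<^sub>R (\<Sum>k\<in>UNIV. c $ k *\<^sub>R (Z $ k))" unfolding c(2)[symmetric] by (simp add: sgn_div_norm)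
    also have "\<dots> = (\<Sum>k\<in>UNIV. (inverse (norm x) * c $ k * norm (Z $ k)) *\<^sub>R sgn (Z $ k))"
      using n by (auto simp: scaleR_sum_right sgn_div_norm intro!: sum.cong)
    finally show "\<exists>c. (\<forall>k. c $ k \<ge> 0) \<and> sgn x = c v* (\<chi> k. sgn (Z $ k))"
      using c by (intro exI[of _ "\<chi> k. inverse (norm x) * c $ k * norm (Z $ k)"]) (auto simp: vector_matrix_mult_eq_sum)
  qed
  with False show ?thesis by (simp add: simplex_pairs_def det_sgn_rows_eq_0_iff)
qed

lemma simplex_pairs_vector_matrix_mult:
  fixes Z :: "real ^ 'n ^ 'n"
  assumes "det Z \<noteq> 0"
  shows "(Z, c v* Z) \<in> simplex_pairs \<longleftrightarrow> (\<forall>k. c $ k \<ge> 0)"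
proof
  assume "(Z, c v* Z) \<in> simplex_pairs"
  then obtain c' where c': "\<forall>k. c' $ k \<ge> 0" "c v* Z = c' v* Z" by (auto simp: simplex_pairs_def)
  obtain B where B: "\<And>x. B *v (transpose Z *v x) = x"
    using matrix_vector_mult_inverse_cancel[of "transpose Z"] assms by (metis det_transpose)
  have "c = c'" using B[of c] B[of c'] c'(2) by simp
  with c' show "\<forall>k. c $ k \<ge> 0" by simp
qed (use assms in \<open>auto simp: simplex_pairs_def\<close>)

text \<open>The further point is parametrised by its coefficients, \<open>x = c v* Z\<close>, with
  Jacobian \<open>\<bar>det Z\<bar>\<close>. The factor \<open>2 / N\<close> comes once from each of
  the \<open>m + 1\<close> densities.\<close>

lemma nn_integral_simplex_pairs:
  fixes i0 :: "'n::finite"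
  defines "m \<equiv> CARD('n)" and "N \<equiv> sqrt (2 * pi) ^ CARD('n)"
  assumes J: "(\<integral>\<^sup>+y. indicator {0<..} y * ennreal ((y / sinh y) ^ CARD('n)) \<partial>lborel) = ennreal j" "j \<ge> 0"
  shows "(\<integral>\<^sup>+u. \<integral>\<^sup>+x. indicator simplex_pairs (vec_lambda u, x) \<partial>uniform_half_sphere i0 \<partial>PiM UNIV (\<lambda>_::'n. uniform_half_sphere i0)) =
    ennreal ((2 / N) ^ (m + 1) * (N ^ m * gauss_moment (m + 1) * j / (N * gauss_moment 1 * gauss_moment m)))"
proof -
  let ?U = "uniform_half_sphere i0" and ?g = "half_gauss_density i0"
  let ?o = "{x :: real^'n. \<forall>k. x $ k \<ge> 0}"
  have N: "N > 0" by (simp add: N_def)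
  have sU[measurable_cong]: "sets ?U = sets borel" by (simp add: uniform_half_sphere_def)
  interpret U: prob_space ?U by (rule prob_space_uniform_half_sphere)
  have [measurable]: "vec_lambda \<in> PiM UNIV (\<lambda>_::'n. borel :: (real^'n) measure) \<rightarrow>\<^sub>M borel"
    using borel_measurable_vec_lambda[of "\<lambda>i x. x i" "PiM UNIV (\<lambda>_::'n. borel :: (real^'n) measure)"]
    by measurable
  have "(\<integral>\<^sup>+u. \<integral>\<^sup>+x. indicator simplex_pairs (vec_lambda u, x) \<partial>?U \<partial>PiM UNIV (\<lambda>_::'n. ?U)) =
    (\<integral>\<^sup>+Z. (\<Prod>k\<in>UNIV. ?g (Z $ k)) * (\<integral>\<^sup>+x. indicator simplex_pairs ((\<chi> k. sgn (Z $ k)), x) \<partial>?U) \<partial>(lborel :: (real^'n^'n) measure))"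
    by (rule nn_integral_PiM_uniform_half_sphere) measurable
  also have "\<dots> = (\<integral>\<^sup>+Z. ennreal ((2 / N) ^ (m + 1)) * (ennreal \<bar>det Z\<bar> * ennreal (gauss Z) * indicator ?o (transpose Z $ i0) *
       (\<integral>\<^sup>+c. ennreal (gauss (c v* Z)) * indicator ?o c \<partial>lborel)) \<partial>(lborel :: (real^'n^'n) measure))"
  proof (rule nn_integral_cong)
    fix Z :: "real^'n^'n"
    have in1: "(\<integral>\<^sup>+x. indicator simplex_pairs ((\<chi> k. sgn (Z $ k)), x) \<partial>?U) = (\<integral>\<^sup>+x. ?g x * indicator simplex_pairs (Z, x) \<partial>lborel)"
      by (subst nn_integral_uniform_half_sphere, measurable) (simp add: indicator_def simplex_pairs_sgn_iff)
    have w: "(\<Prod>k\<in>UNIV. ?g (Z $ k)) = ennreal ((2 / N) ^ m * gauss Z) * indicator ?o (transpose Z $ i0)"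
    proof -
      have "(\<Prod>k\<in>UNIV. indicator {x. x $ i0 \<ge> 0} (Z $ k) :: ennreal) = indicator ?o (transpose Z $ i0)"
        by (auto simp: indicator_def prod_eq_1_iff transpose_def intro!: prod_zero)
      moreover have "(\<Prod>k\<in>UNIV. ennreal (2 / N * gauss (Z $ k))) = ennreal ((2 / N) ^ m * gauss Z)"
        using N by (subst prod_ennreal) (simp, simp only: prod.distrib prod_constant gauss_vec[of Z] m_def)
      ultimately show ?thesis
        unfolding half_gauss_density_def N_def[symmetric] by (simp only: prod.distrib)
    qed
    show "(\<Prod>k\<in>UNIV. ?g (Z $ k)) * (\<integral>\<^sup>+x. indicator simplex_pairs ((\<chi> k. sgn (Z $ k)), x) \<partial>?U) =
      ennreal ((2 / N) ^ (m + 1)) * (ennreal \<bar>det Z\<bar> * ennreal (gauss Z) * indicator ?o (transpose Z $ i0) *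
       (\<integral>\<^sup>+c. ennreal (gauss (c v* Z)) * indicator ?o c \<partial>lborel))"
    proof (cases "det Z \<noteq> 0 \<and> transpose Z $ i0 \<in> ?o")
      case True
      then have Z: "det Z \<noteq> 0" and pos: "\<And>k. Z $ k $ i0 \<ge> 0" by (auto simp: transpose_def)
      have "(\<integral>\<^sup>+x. ?g x * indicator simplex_pairs (Z, x) \<partial>lborel) =
         ennreal \<bar>det Z\<bar> * (\<integral>\<^sup>+c. ?g (c v* Z) * indicator simplex_pairs (Z, c v* Z) \<partial>lborel)"
        by (rule nn_integral_vector_matrix_mult[OF Z]) measurable
      also have "(\<integral>\<^sup>+c. ?g (c v* Z) * indicator simplex_pairs (Z, c v* Z) \<partial>lborel) =
         (\<integral>\<^sup>+c. ennreal (2 / N) * (ennreal (gauss (c v* Z)) * indicator ?o c) \<partial>lborel)"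
      proof (rule nn_integral_cong)
        fix c
        have i: "(indicator simplex_pairs (Z, c v* Z) :: ennreal) = indicator ?o c"
          using simplex_pairs_vector_matrix_mult[OF Z, of c] by (simp add: indicator_def)
        \<comment> \<open>A nonnegative combination of points of the half-space stays in it, so the
          half-space indicator in the density of the further point is 1 whenever \<open>c\<close> is
          in the orthant.\<close>
        have "(c v* Z) $ i0 \<ge> 0" if "c \<in> ?o"
          using that pos by (auto simp: vector_matrix_mult_def intro!: sum_nonneg)
        then show "?g (c v* Z) * indicator simplex_pairs (Z, c v* Z) = ennreal (2 / N) * (ennreal (gauss (c v* Z)) * indicator ?o c)"
          unfolding i half_gauss_density_def N_def[symmetric] using N
          by (cases "c \<in> ?o") (simp_all only: ennreal_mult indicator_simps mem_Collect_eq mult_zero_right,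
            simp_all add: ennreal_mult[symmetric])
      qed
      also have "\<dots> = ennreal (2 / N) * (\<integral>\<^sup>+c. ennreal (gauss (c v* Z)) * indicator ?o c \<partial>lborel)"
        by (rule nn_integral_cmult) measurable
      finally have inner: "(\<integral>\<^sup>+x. ?g x * indicator simplex_pairs (Z, x) \<partial>lborel) =
         ennreal \<bar>det Z\<bar> * (ennreal (2 / N) * (\<integral>\<^sup>+c. ennreal (gauss (c v* Z)) * indicator ?o c \<partial>lborel))" .
      show ?thesis
      proof -
        have "ennreal ((2 / N) ^ (m + 1)) = ennreal (2 / N) * ennreal ((2 / N) ^ m)"
          using N by (subst ennreal_mult[symmetric]) simp_all
        moreover have "ennreal ((2 / N) ^ m * gauss Z) = ennreal ((2 / N) ^ m) * ennreal (gauss Z)"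
          using N by (intro ennreal_mult) simp_all
        ultimately show ?thesis unfolding in1 w inner by (simp only: mult_ac)
      qed
    next
      case False
      then consider "det Z = 0" | "transpose Z $ i0 \<notin> ?o" by blast
      then show ?thesis
      proof cases
        case 1
        then have "indicator simplex_pairs (Z, x) = (0 :: ennreal)" for x by (simp add: simplex_pairs_def)
        with 1 show ?thesis unfolding in1 w by simp
      next
        case 2
        then have "indicator ?o (transpose Z $ i0) = (0 :: ennreal)" by (rule indicator_simps)
        then show ?thesis unfolding in1 w by (simp only: mult_zero_right mult_zero_left)
      qed
    qed
  qed
  also have "\<dots> = ennreal ((2 / N) ^ (m + 1)) * (\<integral>\<^sup>+Z. ennreal \<bar>det Z\<bar> * ennreal (gauss Z) * indicator ?o (transpose Z $ i0) *
       (\<integral>\<^sup>+c. ennreal (gauss (c v* Z)) * indicator ?o c \<partial>lborel) \<partial>(lborel :: (real^'n^'n) measure))"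
  proof (rule nn_integral_cmult)
    have [measurable]: "(transpose :: real^'n^'n \<Rightarrow> _) \<in> borel_measurable borel"
      unfolding transpose_def by measurable
    show "(\<lambda>Z. ennreal \<bar>det Z\<bar> * ennreal (gauss Z) * indicator ?o (transpose Z $ i0) *
       (\<integral>\<^sup>+c. ennreal (gauss (c v* Z)) * indicator ?o c \<partial>lborel)) \<in> borel_measurable (lborel :: (real^'n^'n) measure)"
      by measurable
  qed
  also have "\<dots> = ennreal ((2 / N) ^ (m + 1)) * ennreal (N ^ m * gauss_moment (m + 1) * j / (N * gauss_moment 1 * gauss_moment m))"
    unfolding nn_integral_simplex[OF J] m_def N_def ..
  also have "\<dots> = ennreal ((2 / N) ^ (m + 1) * (N ^ m * gauss_moment (m + 1) * j / (N * gauss_moment 1 * gauss_moment m)))"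
    by (rule ennreal_mult'[symmetric]) (use N in simp)
  finally show ?thesis .
qed

section \<open>Disjointness of the events and the final constant\<close>

text \<open>Inserting the representation of \<open>u i\<close> into that of \<open>u j\<close> gives
  a linear relation among the independent vectors other than \<open>u i\<close>, so its coefficients
  vanish. Away from \<open>i\<close> and \<open>j\<close> they are sums of nonnegative terms, which
  forces \<open>b k = 0\<close> and leaves \<open>u j = b i *\<^sub>R u i\<close>.\<close>

lemma two_simplices_imp_parallel:
  assumes I: "finite I" "i \<in> I" "j \<in> I" "i \<noteq> j"
    and ind: "independent_family (I - {i}) u"
    and ui: "u i \<in> pos (I - {i}) u" and uj: "u j \<in> pos (I - {j}) u"
  obtains t where "u j = t *\<^sub>R u i"
proof -
  from ui obtain a where a: "\<forall>k\<in>I-{i}. a k \<ge> 0" "u i = (\<Sum>k\<in>I-{i}. a k *\<^sub>R u k)" by (auto simp: pos_def)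
  from uj obtain b where b: "\<forall>k\<in>I-{j}. b k \<ge> 0" "u j = (\<Sum>k\<in>I-{j}. b k *\<^sub>R u k)" by (auto simp: pos_def)
  define e where "e k = (if k = j then - 1 else b k) + b i * a k" for k
  have "(\<Sum>k\<in>I-{i}. e k *\<^sub>R u k) = (\<Sum>k\<in>I-{i}. (if k = j then - 1 else b k) *\<^sub>R u k) + b i *\<^sub>R u i"
    unfolding e_def a(2) by (simp add: scaleR_add_left sum.distrib scaleR_sum_right)
  also have "(\<Sum>k\<in>I-{i}. (if k = j then - 1 else b k) *\<^sub>R u k) = - u j + (\<Sum>k\<in>I-{i}-{j}. b k *\<^sub>R u k)"
    using I by (subst sum.remove[of _ j]) auto
  also have "(\<Sum>k\<in>I-{i}-{j}. b k *\<^sub>R u k) = u j - b i *\<^sub>R u i"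
  proof -
    have "I - {j} - {i} = I - {i} - {j}" by auto
    then show ?thesis
      unfolding b(2) using I sum.remove[of "I - {j}" i "\<lambda>k. b k *\<^sub>R u k"] by simp
  qed
  finally have "(\<Sum>k\<in>I-{i}. e k *\<^sub>R u k) = 0" by simp
  then have e0: "e k = 0" if "k \<in> I - {i}" for k using independent_familyD[OF ind _ that] by blast
  have bi: "b i \<ge> 0" using b I by auto
  have "b k = 0" if "k \<in> I - {j} - {i}" for k
  proof -
    have "b k + b i * a k = 0" using e0[of k] that by (simp add: e_def)
    moreover have "b k \<ge> 0" "b i * a k \<ge> 0" using b a bi that by auto
    ultimately show ?thesis by linarith
  qed
  then have "(\<Sum>k\<in>I-{j}-{i}. b k *\<^sub>R u k) = 0" by (intro sum.neutral) auto
  then have "u j = b i *\<^sub>R u i"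
    unfolding b(2) using I by (simp add: sum.remove[of "I - {j}" i])
  then show ?thesis by (rule that)
qed

lemma not_independent_family_parallel:
  assumes "finite J" "i \<in> J" "j \<in> J" "i \<noteq> j" "u j = t *\<^sub>R u i"
  shows "\<not> independent_family J u"
proof
  assume ind: "independent_family J u"
  define c where "c k = (if k = i then t else 0) - (if k = j then 1 else 0 :: real)" for k
  have "(\<Sum>k\<in>J. c k *\<^sub>R u k) = t *\<^sub>R u i - u j"
    using assms(1-4) by (simp add: c_def scaleR_left_diff_distrib sum_subtractf if_distrib[of "\<lambda>x. x *\<^sub>R _"] if_distribR cong: if_cong)
  with assms independent_familyD[OF ind, of c j] show False by (simp add: c_def)
qed

text \<open>\<open>a\<close> stands for \<open>A (m - 1) (- 1)\<close>, and
  \<open>pi / 2 * real m * a\<close> for the integral of \<open>(y / sinh y) ^ m\<close>. The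
  ingredients are \<open>N^2 = (2 pi)^m\<close>, the powers of 2 in the moments, and one step of the
  functional equation of Gamma.\<close>

lemma simplex_probability_constant:
  assumes m: "m \<ge> 2"
  defines "N \<equiv> sqrt (2 * pi) ^ m"
  shows "real (m + 1) * ((2 / N) ^ (m + 1) * (N ^ m * gauss_moment (m + 1) * (pi / 2 * real m * a) / (N * gauss_moment 1 * gauss_moment m))) =
    pi powi (- int m) * real (m + 1) * (sqrt pi * Gamma (real (m + 1) / 2) / Gamma (real (m + 2) / 2)) * (real m)\<^sup>2 * a"
proof -
  have N: "N > 0" by (simp add: N_def)
  have N2: "N\<^sup>2 = 2 ^ m * pi ^ m"
  proof -
    have "(s ^ m)\<^sup>2 = (s\<^sup>2) ^ m" for s :: real by (simp add: power_mult[symmetric] mult.commute)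
    then show ?thesis by (simp add: N_def power_mult_distrib)
  qed
  have g1: "gauss_moment 1 = 2 powr (- 1 / 2) * sqrt pi" by (simp add: gauss_moment_def Gamma_one_half_real)
  have G: "Gamma (real (m + 2) / 2) = real m / 2 * Gamma (real m / 2)"
  proof -
    have np: "real m / 2 \<notin> \<int>\<^sub>\<le>\<^sub>0" using m by (auto elim!: nonpos_Ints_cases)
    have "real (m + 2) / 2 = real m / 2 + 1" by simp
    then show ?thesis by (simp only: Gamma_plus1[OF np])
  qed
  have Gp: "Gamma (real m / 2) > 0" "Gamma (real (m + 1) / 2) > 0" using m by (auto intro!: Gamma_real_pos)
  have pw: "(2::real) powr ((m + 1) / 2 - 1) = 2 * (2 powr (- 1 / 2) * 2 powr (m / 2 - 1))"
  proof -
    have "(2::real) * (2 powr (- 1 / 2) * 2 powr (m / 2 - 1)) = 2 powr (1 + (- 1 / 2 + (m / 2 - 1)))"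
      by (simp only: powr_add) simp
    also have "1 + (- 1 / 2 + (m / 2 - 1)) = (m + 1) / 2 - (1::real)" by (simp add: field_simps)
    finally show ?thesis by simp
  qed
  have "gauss_moment (m + 1) / (gauss_moment 1 * gauss_moment m) = 2 * Gamma (real (m + 1) / 2) / (sqrt pi * Gamma (real m / 2))"
    unfolding g1 unfolding gauss_moment_def pw using Gp by (simp add: field_simps)
  moreover have "(2 / N) ^ (m + 1) * N ^ m / N = 2 * (1 / pi ^ m)"
  proof -
    have "(2 / N) ^ (m + 1) * N ^ m / N = 2 ^ (m + 1) / N\<^sup>2"
      using N by (simp add: power_divide power2_eq_square field_simps)
    then show ?thesis unfolding N2 by simp
  qed
  moreover have "(2 / N) ^ (m + 1) * (N ^ m * gauss_moment (m + 1) * x / (N * gauss_moment 1 * gauss_moment m)) =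
     ((2 / N) ^ (m + 1) * N ^ m / N) * (gauss_moment (m + 1) / (gauss_moment 1 * gauss_moment m)) * x" for x
    by (simp add: mult_ac)
  ultimately have eq: "(2 / N) ^ (m + 1) * (N ^ m * gauss_moment (m + 1) * x / (N * gauss_moment 1 * gauss_moment m)) =
     2 * (1 / pi ^ m) * (2 * Gamma (real (m + 1) / 2) / (sqrt pi * Gamma (real m / 2))) * x" for x by (simp only:)
  have P: "pi powi (- int m) = 1 / pi ^ m" by (simp add: power_int_minus divide_inverse)
  \<comment> \<open>What remains is algebra, with \<open>s\<close> for \<open>sqrt pi\<close>, so
    that \<open>s * s\<close> stands for \<open>pi\<close>.\<close>
  have "k * (2 * (1 / P) * (2 * h / (s * g)) * (s * s / 2 * x * a)) = 1 / P * k * (s * h / (x / 2 * g)) * x\<^sup>2 * a"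
    if "P > 0" "s > 0" "g > 0" "x > 0" for k P s g h x :: real
    using that by (simp add: field_simps power2_eq_square)
  from this[of "pi ^ m" "sqrt pi" "Gamma (real m / 2)" "real m" "real (m + 1)" "Gamma (real (m + 1) / 2)"] Gp m
  show ?thesis unfolding eq G P by simp
qed

theorem theorem2p6:
  fixes d :: nat and i0 :: "'n::finite"
    and M :: "'w measure" and U :: "nat \<Rightarrow> 'w \<Rightarrow> real ^ 'n"
  assumes d: "d \<ge> 1" and dim: "CARD('n) = d + 1"
    and prob: "prob_space M"
    and on_half_sphere: "\<And>i w. i \<in> {1..d+2} \<Longrightarrow> w \<in> space M \<Longrightarrow> U i w \<in> half_sphere i0"
    and indep: "prob_space.indep_vars M (\<lambda>_. borel) U {1..d+2}"
    and uniform: "\<And>i. i \<in> {1..d+2} \<Longrightarrow> distr M borel (U i) = uniform_half_sphere i0"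
  shows "measure M {w \<in> space M.
            spherical_simplex (pos {1..d+2} (\<lambda>i. U i w) \<inter> half_sphere i0) \<and>
            card (spherical_vertices (pos {1..d+2} (\<lambda>i. U i w))) = d + 1}
         = pi powi (- int (d + 1)) * real (d + 2)
           * (sqrt pi * Gamma (real (d + 2) / 2) / Gamma (real (d + 3) / 2))
           * (real (d + 1))\<^sup>2 * A d (-1)"
proof -
  interpret prob_space M by (rule prob)
  let ?V = "uniform_half_sphere i0"
  \<comment> \<open>The value of the integral of \<open>(y / sinh y) ^ (d + 1)\<close> over
    \<open>y > 0\<close>, expressed through \<open>A\<close>.\<close>
  define q where "q = pi / 2 * real (d + 1) * A d (- 1)"
  have q: "2 ^ (d + 1) * fact (d + 1) * sinh_sum (d + 1) (d + 1) = q"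
    using sinh_sum_eq_A[of "d + 1", OF le_add2] by (simp only: q_def add_diff_cancel_right')
  have j0: "q \<ge> 0"
    unfolding q[symmetric] sinh_sum_def
    by (intro mult_nonneg_nonneg suminf_nonneg summable_sinh_sum) auto
  have J: "(\<integral>\<^sup>+y. indicator {0<..} y * ennreal ((y / sinh y) ^ CARD('n)) \<partial>lborel) = ennreal q"
    by (simp only: dim nn_integral_power_over_sinh[OF le_add2] q)
  define I where "I = {1..d+2}"
  note I = I_def[symmetric]
  have fI: "finite I" and cI: "card I = CARD('n) + 1" by (simp_all add: I_def dim)
  note on_half_sphere = on_half_sphere[unfolded I] and indep = indep[unfolded I] and uniform = uniform[unfolded I]
  have sV: "sets ?V = sets borel" by (simp add: uniform_half_sphere_def)
  interpret V: prob_space ?V by (rule prob_space_uniform_half_sphere)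
  interpret PV: product_sigma_finite "\<lambda>_::nat. ?V"
    by (simp add: product_sigma_finite_def V.sigma_finite_measure_axioms)
  have U[measurable]: "U i \<in> borel_measurable M" if "i \<in> I" for i
    using indep that by (auto simp: indep_vars_def)
  have joint: "distr M (PiM I (\<lambda>_. borel)) (\<lambda>w. \<lambda>i\<in>I. U i w) = PiM I (\<lambda>_. ?V)"
  proof -
    have "distr M (PiM I (\<lambda>_. borel)) (\<lambda>w. \<lambda>i\<in>I. U i w) = PiM I (\<lambda>i. distr M borel (U i))"
      using indep cI by (subst (asm) indep_vars_iff_distr_eq_PiM') (auto simp: U)
    also have "\<dots> = PiM I (\<lambda>_. ?V)" by (rule PiM_cong) (simp_all add: uniform)
    finally show ?thesis .
  qed
  have [measurable]: "vec_lambda \<in> PiM UNIV (\<lambda>_::'n. borel :: (real^'n) measure) \<rightarrow>\<^sub>M borel"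
    using borel_measurable_vec_lambda[of "\<lambda>i x. x i" "PiM UNIV (\<lambda>_::'n. borel :: (real^'n) measure)"]
    by measurable
  have sP: "sets (PiM K (\<lambda>_. ?V)) = sets (PiM K (\<lambda>_. borel))" for K :: "'k set"
    by (rule sets_PiM_cong) (simp_all add: sV)
  \<comment> \<open>By the product form of the joint law, point \<open>j\<close> can be integrated
    separately and the other indices renamed through \<open>b\<close> to the row index type. The
    right-hand side does not depend on \<open>j\<close>, which is why the events \<open>S j\<close>
    are equally likely.\<close>
  have transfer: "(\<integral>\<^sup>+w. f (\<chi> k. U (b k) w) (U j w) \<partial>M) =
      (\<integral>\<^sup>+u. \<integral>\<^sup>+x. f (vec_lambda u) x \<partial>?V \<partial>PiM UNIV (\<lambda>_::'n. ?V))"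
    if j: "j \<in> I" and b: "bij_betw b UNIV (I - {j})"
      and f[measurable]: "(\<lambda>(Z, x). f Z x) \<in> borel_measurable (borel \<Otimes>\<^sub>M borel)"
    for j b and f :: "real^'n^'n \<Rightarrow> real^'n \<Rightarrow> ennreal"
  proof -
    have bI: "b k \<in> I" "b k \<noteq> j" for k using bij_betwE[OF b] by blast+
    have mm: "(\<lambda>u. f (\<chi> k. u (b k)) (u j)) \<in> borel_measurable (PiM I (\<lambda>_. borel))"
    proof -
      have "(\<lambda>u. (\<chi> k. u (b k)) :: real^'n^'n) \<in> borel_measurable (PiM I (\<lambda>_. borel))"
        using bI by (intro borel_measurable_vec_lambda measurable_component_singleton) auto
      moreover have "(\<lambda>u. u j) \<in> borel_measurable (PiM I (\<lambda>_. borel))"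
        using j by (rule measurable_component_singleton)
      ultimately show ?thesis using measurable_compose[OF measurable_Pair f] by simp
    qed
    have "(\<integral>\<^sup>+w. f (\<chi> k. U (b k) w) (U j w) \<partial>M) =
      (\<integral>\<^sup>+u. f (\<chi> k. u (b k)) (u j) \<partial>distr M (PiM I (\<lambda>_. borel)) (\<lambda>w. \<lambda>i\<in>I. U i w))"
    proof (subst nn_integral_distr)
      show "(\<lambda>w. \<lambda>i\<in>I. U i w) \<in> M \<rightarrow>\<^sub>M PiM I (\<lambda>_. borel)" by (intro measurable_restrict U)
    qed (use mm bI j in simp_all)
    also have "\<dots> = (\<integral>\<^sup>+u. f (\<chi> k. u (b k)) (u j) \<partial>PiM (insert j (I - {j})) (\<lambda>_. ?V))"
      unfolding joint using j by (simp add: insert_absorb)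
    also have "\<dots> = (\<integral>\<^sup>+u. \<integral>\<^sup>+x. f (\<chi> k. (u(j := x)) (b k)) ((u(j := x)) j) \<partial>?V \<partial>PiM (I - {j}) (\<lambda>_. ?V))"
      using mm j fI by (intro PV.product_nn_integral_insert) (auto simp: insert_absorb measurable_cong_sets[OF sP refl])
    also have "\<dots> = (\<integral>\<^sup>+u. \<integral>\<^sup>+x. f (vec_lambda (\<lambda>n\<in>UNIV. u (b n))) x \<partial>?V \<partial>PiM (I - {j}) (\<lambda>_. ?V))"
      using bI by (simp add: restrict_def)
    also have "\<dots> = (\<integral>\<^sup>+u. \<integral>\<^sup>+x. f (vec_lambda u) x \<partial>?V \<partial>distr (PiM (I - {j}) (\<lambda>_. ?V)) (PiM UNIV (\<lambda>_. ?V)) (\<lambda>u. \<lambda>n\<in>UNIV. u (b n)))"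
    proof (subst nn_integral_distr)
      show "(\<lambda>u. \<lambda>n\<in>UNIV. u (b n)) \<in> PiM (I - {j}) (\<lambda>_. ?V) \<rightarrow>\<^sub>M PiM UNIV (\<lambda>_. ?V)"
        using bI by (intro measurable_restrict measurable_component_singleton) auto
      have "(\<lambda>u. \<integral>\<^sup>+x. f (vec_lambda u) x \<partial>?V) \<in> borel_measurable (PiM UNIV (\<lambda>_::'n. borel :: (real^'n) measure))"
      proof (rule V.borel_measurable_nn_integral)
        have "(\<lambda>p. (vec_lambda (fst p), snd p)) \<in> PiM UNIV (\<lambda>_::'n. borel :: (real^'n) measure) \<Otimes>\<^sub>M borel \<rightarrow>\<^sub>M borel \<Otimes>\<^sub>M borel"
          by measurable
        from measurable_compose[OF this f]
        show "(\<lambda>(u, x). f (vec_lambda u) x) \<in> borel_measurable (PiM UNIV (\<lambda>_::'n. borel :: (real^'n) measure) \<Otimes>\<^sub>M ?V)"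
          by (simp add: case_prod_beta' measurable_cong_sets[OF sets_pair_measure_cong[OF refl sV] refl])
      qed
      then show "(\<lambda>u. \<integral>\<^sup>+x. f (vec_lambda u) x \<partial>?V) \<in> borel_measurable (distr (PiM (I - {j}) (\<lambda>_. ?V)) (PiM UNIV (\<lambda>_::'n. ?V)) (\<lambda>u. \<lambda>n\<in>UNIV. u (b n)))"
        by (simp add: measurable_cong_sets[OF sP refl])
    qed simp
    also have "distr (PiM (I - {j}) (\<lambda>_. ?V)) (PiM UNIV (\<lambda>_. ?V)) (\<lambda>u. \<lambda>n\<in>UNIV. u (b n)) = PiM UNIV (\<lambda>_::'n. ?V)"
      by (rule distr_PiM_reindex) (use b bI in \<open>auto simp: bij_betw_def V.prob_space_axioms\<close>)
    finally show ?thesis .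
  qed
  have "\<exists>b. bij_betw b (UNIV :: 'n set) (I - {j})" if "j \<in> I" for j
    using that fI by (intro finite_same_card_bij) (auto simp: cI dim)
  then obtain b where b: "\<And>j. j \<in> I \<Longrightarrow> bij_betw (b j) (UNIV :: 'n set) (I - {j})" by metis
  \<comment> \<open>The geometric event for the index \<open>j\<close>, phrased with a matrix of
    rows so that \<open>transfer\<close> applies to it.\<close>
  define S where "S j = {w \<in> space M. ((\<chi> k. U (b j k) w), U j w) \<in> simplex_pairs}" for j
  have bI: "b j k \<in> I" if "j \<in> I" for j k using bij_betwE[OF b[OF that]] by blast
  have Zm: "(\<lambda>w. (\<chi> k. U (b j k) w) :: real^'n^'n) \<in> borel_measurable M" if "j \<in> I" for j
    using bI[OF that] by (intro borel_measurable_vec_lambda U)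
  have S_iff: "w \<in> S j \<longleftrightarrow> w \<in> space M \<and> independent_family (I - {j}) (\<lambda>i. U i w) \<and> U j w \<in> pos (I - {j}) (\<lambda>i. U i w)"
    if "j \<in> I" for j w
    unfolding S_def simplex_pairs_def
    by (simp add: independent_family_iff_det[OF b[OF that]] mem_pos_iff_vector_matrix_mult[OF b[OF that]])
  have "{w \<in> space M. spherical_simplex (pos I (\<lambda>i. U i w) \<inter> half_sphere i0) \<and>
      card (spherical_vertices (pos I (\<lambda>i. U i w))) = d + 1} = (\<Union>j\<in>I. S j)"
  proof (rule set_eqI)
    fix w
    show "w \<in> {w \<in> space M. spherical_simplex (pos I (\<lambda>i. U i w) \<inter> half_sphere i0) \<and>
        card (spherical_vertices (pos I (\<lambda>i. U i w))) = d + 1} \<longleftrightarrow> w \<in> (\<Union>j\<in>I. S j)"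
    proof (cases "w \<in> space M")
      case True
      then have "U i w \<in> half_sphere i0" if "i \<in> I" for i using on_half_sphere that by blast
      from spherical_simplex_pos_iff[OF fI cI, of "\<lambda>i. U i w" i0, OF this]
      show ?thesis using True S_iff by (auto simp: dim)
    next
      case False
      then show ?thesis by (auto simp: S_def)
    qed
  qed
  moreover have Sm: "S j \<in> sets M" if "j \<in> I" for j
  proof -
    have "(\<lambda>w. ((\<chi> k. U (b j k) w) :: real^'n^'n, U j w)) \<in> M \<rightarrow>\<^sub>M borel \<Otimes>\<^sub>M borel"
      using Zm[OF that] U[OF that] by (rule measurable_Pair)
    from measurable_sets[OF this simplex_pairs_borel] show ?thesis
      by (simp add: S_def vimage_def Int_def conj_commute)
  qed
  \<comment> \<open>In the Gaussian description singular matrices form a null set, and passing from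
    rows to their directions does not change whether the determinant vanishes.\<close>
  moreover have nondeg: "AE w in M. det (\<chi> k. U (b j k) w) \<noteq> 0" if "j \<in> I" for j
  proof -
    have "(\<integral>\<^sup>+w. indicator {Z. det Z = 0} (\<chi> k. U (b j k) w) \<partial>M) =
        (\<integral>\<^sup>+u. \<integral>\<^sup>+x. indicator {Z. det Z = 0} (vec_lambda u) \<partial>?V \<partial>PiM UNIV (\<lambda>_::'n. ?V))"
      by (rule transfer[of j "b j" "\<lambda>Z x. indicator {Z. det Z = 0} Z", OF that b[OF that]]) measurable
    also have "\<dots> = (\<integral>\<^sup>+u. indicator {Z. det Z = 0} (vec_lambda u) \<partial>PiM UNIV (\<lambda>_::'n. ?V))"
      by (simp add: V.emeasure_space_1)
    also have "\<dots> = (\<integral>\<^sup>+Z. (\<Prod>k\<in>UNIV. half_gauss_density i0 (Z $ k)) * indicator {Z. det Z = 0} (\<chi> k. sgn (Z $ k)) \<partial>(lborel :: (real^'n^'n) measure))"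
      by (rule nn_integral_PiM_uniform_half_sphere) measurable
    also have "\<dots> = (\<integral>\<^sup>+Z. 0 \<partial>(lborel :: (real^'n^'n) measure))"
      by (rule nn_integral_cong_AE, rule AE_mp[OF AE_det_nonzero]) (auto simp: det_sgn_rows_eq_0_iff)
    finally have "(\<integral>\<^sup>+w. indicator {Z. det Z = 0} (\<chi> k. U (b j k) w) \<partial>M) = 0" by simp
    moreover have "(\<lambda>w. indicator {Z. det Z = 0} (\<chi> k. U (b j k) w) :: ennreal) \<in> borel_measurable M"
      by (rule measurable_compose[OF Zm[OF that]]) measurable
    ultimately have "AE w in M. indicator {Z. det Z = 0} (\<chi> k. U (b j k) w) = (0 :: ennreal)"
      by (subst (asm) nn_integral_0_iff_AE) auto
    then show ?thesis by eventually_elim (auto simp: indicator_def split: if_splits)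
  qed
  \<comment> \<open>If both events occurred, \<open>U i\<close> and \<open>U j\<close> would be
    parallel. Since \<open>d \<ge> 1\<close> there is a third index \<open>l\<close>; omitting it
    leaves a family that contains both points and is almost surely independent.\<close>
  moreover have disj: "AE w in M. w \<notin> S i \<or> w \<notin> S j" if ij: "i \<in> I" "j \<in> I" "i \<noteq> j" for i j
  proof -
    have "card (I - {i, j}) > 0" using ij d fI by (subst card_Diff_subset) (auto simp: cI dim)
    then obtain l where l: "l \<in> I" "l \<noteq> i" "l \<noteq> j" by (metis Diff_iff card_gt_0_iff ex_in_conv insertCI)
    from nondeg[OF l(1)] show ?thesis
    proof eventually_elim
      case (elim w)
      then have ind: "independent_family (I - {l}) (\<lambda>i. U i w)"
        using independent_family_iff_det[OF b[OF l(1)], of "\<lambda>i. U i w"] by simp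
      show ?case
      proof (rule ccontr)
        assume "\<not> (w \<notin> S i \<or> w \<notin> S j)"
        then have "independent_family (I - {i}) (\<lambda>i. U i w)" "U i w \<in> pos (I - {i}) (\<lambda>i. U i w)"
          "U j w \<in> pos (I - {j}) (\<lambda>i. U i w)" using S_iff ij by blast+
        then obtain t where "U j w = t *\<^sub>R U i w"
          using two_simplices_imp_parallel[OF fI ij, of "\<lambda>i. U i w"] by blast
        then have "\<not> independent_family (I - {l}) (\<lambda>i. U i w)"
          using ij l fI by (intro not_independent_family_parallel[of _ i j _ t]) auto
        with ind show False by simp
      qed
    qed
  qed
  ultimately have "measure M {w \<in> space M. spherical_simplex (pos I (\<lambda>i. U i w) \<inter> half_sphere i0) \<and>
      card (spherical_vertices (pos I (\<lambda>i. U i w))) = d + 1} = (\<Sum>j\<in>I. measure M (S j))"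
    by (simp only:) (intro measure_UNION_AE, auto simp: pairwise_def fmeasurable_eq_sets fI)
  also have "\<dots> = (\<Sum>j\<in>I. (2 / sqrt (2 * pi) ^ (d + 1)) ^ (d + 2) * ((sqrt (2 * pi) ^ (d + 1)) ^ (d + 1) * gauss_moment (d + 2) *
      q / (sqrt (2 * pi) ^ (d + 1) * gauss_moment 1 * gauss_moment (d + 1))))"
  proof (rule sum.cong[OF refl])
    fix j assume j: "j \<in> I"
    have "emeasure M (S j) = (\<integral>\<^sup>+w. indicator simplex_pairs ((\<chi> k. U (b j k) w), U j w) \<partial>M)"
      by (subst nn_integral_indicator[symmetric, OF Sm[OF j]]) (auto simp: S_def indicator_def intro!: nn_integral_cong)
    also have "\<dots> = (\<integral>\<^sup>+u. \<integral>\<^sup>+x. indicator simplex_pairs (vec_lambda u, x) \<partial>?V \<partial>PiM UNIV (\<lambda>_::'n. ?V))"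
      by (rule transfer[of j "b j" "\<lambda>Z x. indicator simplex_pairs (Z, x)", OF j b[OF j]]) simp
    also have "\<dots> = ennreal ((2 / sqrt (2 * pi) ^ (d + 1)) ^ (d + 2) * ((sqrt (2 * pi) ^ (d + 1)) ^ (d + 1) * gauss_moment (d + 2) *
      q / (sqrt (2 * pi) ^ (d + 1) * gauss_moment 1 * gauss_moment (d + 1))))"
      using nn_integral_simplex_pairs[OF J j0, of i0] by (simp only: dim add.assoc one_add_one)
    finally show "measure M (S j) = (2 / sqrt (2 * pi) ^ (d + 1)) ^ (d + 2) * ((sqrt (2 * pi) ^ (d + 1)) ^ (d + 1) * gauss_moment (d + 2) *
      q / (sqrt (2 * pi) ^ (d + 1) * gauss_moment 1 * gauss_moment (d + 1)))"
      unfolding measure_def using j0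
      by (simp only:) (intro enn2real_ennreal mult_nonneg_nonneg divide_nonneg_nonneg zero_le_power less_imp_le[OF gauss_moment_pos], simp_all)
  qed
  also have "\<dots> = real (d + 2) * ((2 / sqrt (2 * pi) ^ (d + 1)) ^ (d + 2) * ((sqrt (2 * pi) ^ (d + 1)) ^ (d + 1) * gauss_moment (d + 2) *
      q / (sqrt (2 * pi) ^ (d + 1) * gauss_moment 1 * gauss_moment (d + 1))))"
    by (simp add: cI dim)
  also have "\<dots> = pi powi (- int (d + 1)) * real (d + 2)
           * (sqrt pi * Gamma (real (d + 2) / 2) / Gamma (real (d + 3) / 2))
           * (real (d + 1))\<^sup>2 * A d (-1)"
    unfolding q_def using simplex_probability_constant[of "d + 1" "A d (- 1)"] d
    by (simp only: add.assoc) (simp add: add.commute)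
  finally show ?thesis by (simp only: I_def)
qed

end
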